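(* Let $A$ be the infinitesimal generator of a $C_0$-semigroup $\{U(t)\}_{t\ge 0}$ on $H$ which is exponentially stable: $\|U(t)\|\le \mathcal N e^{-\nu t}$ for all $t\ge 0$, with constants $\mathcal N,\nu>0$. Suppose that - $F,G\in C(\mathbb R\times H,H)$ are globally Lipschitz in $x$: $|F(t,x)-F(t,y)|\le\mathcal L|x-y|$ and $|G(t,x)-G(t,y)|\le\mathcal L|x-y|$ for all $t\in\mathbb R$, $x,y\in H$; - there exists a positive constant $A_0$ such that $|F(t,0)|,|G(t,0)|\le A_0$ for all $t\in\mathbb R$; - $\mathcal L<\dfrac{\nu}{\mathcal N\sqrt{3(\nu+1)}}$. For $t_0\in\mathbb R$ let $x(t;t_0,x_0)$, $t\ge t_0$, denote the mild solution of $$dx(t)=(Ax(t)+F(t,x(t)))\,dt+G(t,x(t))\,dW(t)\qquad(\mathrm{S})$$ with initial value $x(t_0)=x_0$. Then the following hold. (i) For any $t\ge t_0$ and $x_1,x_2\in L^2(\mathbb P,H)$, $$\mathbb E|x(t;t_0,x_1)-x(t;t_0,x_2)|^2\le3\mathcal N^2\exp\Bigl\{-\bigl[\nu-3(1+\tfrac1\nu)\mathcal N^2\mathcal L^2\bigr](t-t_0)\Bigr\}\,\mathbb E|x_1-x_2|^2.$$ (ii) Equation (S) has a unique (mild) solution $\varphi\in C_b(\mathbb R,L^2(\mathbb P,H))$; it is globally asymptotically stable (in the square-mean sense), and $$\mathbb E|x(t;t_0,x_0)-\varphi(t)|^2\le3\mathcal N^2\exp\Bigl\{-\bigl[\nu-3(1+\tfrac1\nu)\mathcal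 N^2\mathcal L^2\bigr](t-t_0)\Bigr\}\,\mathbb E|x_0-\varphi(t_0)|^2$$ for any $t\ge t_0$ and $x_0\in L^2(\mathbb P,H)$.
   Context: $(H,|\cdot|)$ is a real separable Hilbert space, $(\Omega,\mathcal F,\mathbb P)$ a probability space, $L^2(\mathbb P,H)$ the space of $H$-valued random variables with $\|x\|_2:=(\mathbb E|x|^2)^{1/2}<\infty$; $C_b(\mathbb R,L^2(\mathbb P,H))$ is the space of bounded continuous maps $\mathbb R\to L^2(\mathbb P,H)$. $W$ is a two-sided standard one-dimensional Brownian motion, $\mathcal F_t:=\sigma\{W(u)-W(v):u,v\le t\}$ (augmented by null sets). A mild solution with initial value $x(t_0)=x_0$ (initial values at time $t_0$ being $\mathcal F_{t_0}$-measurable) is an $\mathcal F_t$-adapted process $\{x(t)\}_{t\ge t_0}$ satisfying $x(t)=U(t-t_0)x_0+\int_{t_0}^tU(t-s)F(s,x(s))\,ds+\int_{t_0}^tU(t-s)G(s,x(s))\,dW(s)$ for $t\ge t_0$; a mild solution on $\mathbb R$ is an $\mathcal F_t$-adapted process $\{x(t)\}_{t\in\mathbb R}$ satisfying this identity with $x_0=x(t_0)$ for every $t_0\in\mathbb R$ and $t\ge t_0$. "Globally asymptotically stable in the square-mean sense" means: $\varphi$ is Lyapunov stable with respect to the norm $\|\cdot\|_2$ and $\|x(t;t_0,x_0)-\varphi(t)\|_2\to0$ as $t\to\infty$ for every $t_0\in\mathbb R$ and every initial value $x_0\in L^2(\mathbb P,H)$. *)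

theory Defs
  imports "HOL-Probability.Probability"
begin

section \<open>Semigroups\<close>

definition C0_semigroup :: "(real \<Rightarrow> 'h::real_normed_vector \<Rightarrow>\<^sub>L 'h) \<Rightarrow> bool" where
  "C0_semigroup U \<longleftrightarrow>
     U 0 = id_blinfun \<and>
     (\<forall>s\<ge>0. \<forall>t\<ge>0. U (s + t) = U s o\<^sub>L U t) \<and>
     (\<forall>x. ((\<lambda>t. U t x) \<longlongrightarrow> x) (at_right 0))"

text \<open>The generator is in general unbounded; it is given by its domain \<open>D\<close> and a map \<open>A\<close> whose
  values outside \<open>D\<close> are irrelevant.\<close>

definition infinitesimal_generator ::
  "(real \<Rightarrow> 'h::real_normed_vector \<Rightarrow>\<^sub>L 'h) \<Rightarrow> 'h set \<Rightarrow> ('h \<Rightarrow> 'h) \<Rightarrow> bool" where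
  "infinitesimal_generator U D A \<longleftrightarrow>
     D = {x. \<exists>y. ((\<lambda>h. (U h x - x) /\<^sub>R h) \<longlongrightarrow> y) (at_right 0)} \<and>
     (\<forall>x\<in>D. ((\<lambda>h. (U h x - x) /\<^sub>R h) \<longlongrightarrow> A x) (at_right 0))"


section \<open>Square-integrable random variables\<close>

text \<open>Elements of \<open>L\<^sup>2(P, H)\<close> are handled through representatives; equality in \<open>L\<^sup>2(P, H)\<close> is
  almost sure equality.\<close>

definition square_integrable ::
  "'w measure \<Rightarrow> ('w \<Rightarrow> 'h::{real_inner, banach, second_countable_topology}) \<Rightarrow> bool" where
  "square_integrable M x \<longleftrightarrow>
     x \<in> borel_measurable M \<and> integrable M (\<lambda>\<omega>. (norm (x \<omega>))\<^sup>2)"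

definition norm2 ::
  "'w measure \<Rightarrow> ('w \<Rightarrow> 'h::{real_inner, banach, second_countable_topology}) \<Rightarrow> real" where
  "norm2 M x = sqrt (\<integral>\<omega>. (norm (x \<omega>))\<^sup>2 \<partial>M)"

definition Cb_L2 ::
  "'w measure \<Rightarrow> (real \<Rightarrow> 'w \<Rightarrow> 'h::{real_inner, banach, second_countable_topology}) \<Rightarrow> bool" where
  "Cb_L2 M x \<longleftrightarrow>
     (\<forall>t. square_integrable M (x t)) \<and>
     (\<exists>C. \<forall>t. norm2 M (x t) \<le> C) \<and>
     (\<forall>t. ((\<lambda>s. norm2 M (\<lambda>\<omega>. x s \<omega> - x t \<omega>)) \<longlongrightarrow> 0) (at t))"


section \<open>Two-sided Brownian motion and its filtration\<close>

definition two_sided_brownian_motion :: "'w measure \<Rightarrow> (real \<Rightarrow> 'w \<Rightarrow> real) \<Rightarrow> bool" where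
  "two_sided_brownian_motion M W \<longleftrightarrow>
     (\<forall>t. W t \<in> borel_measurable M) \<and>
     (AE \<omega> in M. W 0 \<omega> = 0) \<and>
     (\<forall>s t. s < t \<longrightarrow>
        distributed M lborel (\<lambda>\<omega>. W t \<omega> - W s \<omega>) (normal_density 0 (sqrt (t - s)))) \<and>
     (\<forall>(n::nat) p. (\<forall>i<n. p i < p (Suc i)) \<longrightarrow>
        prob_space.indep_vars M (\<lambda>_. borel) (\<lambda>i \<omega>. W (p (Suc i)) \<omega> - W (p i) \<omega>) {..<n}) \<and>
     (AE \<omega> in M. continuous_on UNIV (\<lambda>t. W t \<omega>))"

definition increment_filtration ::
  "'w measure \<Rightarrow> (real \<Rightarrow> 'w \<Rightarrow> real) \<Rightarrow> real \<Rightarrow> 'w measure" where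
  "increment_filtration M W t = sigma (space M)
     ({(\<lambda>\<omega>. W u \<omega> - W v \<omega>) -` B \<inter> space M | u v B. u \<le> t \<and> v \<le> t \<and> B \<in> sets borel} \<union> null_sets M)"


section \<open>The Ito integral of a process with values in a Hilbert space\<close>

text \<open>A simple process is given by a partition \<open>a = p 0 \<le> \<dots> \<le> p n = b\<close> and by
  random vectors \<open>\<xi> i\<close>, known at time \<open>p i\<close>, which are its values on the intervals \<open>(p i, p (i + 1)]\<close>.\<close>

definition simple_data ::
  "'w measure \<Rightarrow> (real \<Rightarrow> 'w \<Rightarrow> real) \<Rightarrow> real \<Rightarrow> real \<Rightarrow> nat \<Rightarrow> (nat \<Rightarrow> real) \<Rightarrow>
   (nat \<Rightarrow> 'w \<Rightarrow> 'h::{real_inner, banach, second_countable_topology}) \<Rightarrow> bool" where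
  "simple_data M W a b n p \<xi> \<longleftrightarrow>
     p 0 = a \<and> p n = b \<and>
     (\<forall>i<n. p i \<le> p (Suc i) \<and>
        \<xi> i \<in> borel_measurable (increment_filtration M W (p i)) \<and> square_integrable M (\<xi> i))"

definition simple_process ::
  "nat \<Rightarrow> (nat \<Rightarrow> real) \<Rightarrow> (nat \<Rightarrow> 'w \<Rightarrow> 'h::real_vector) \<Rightarrow> real \<Rightarrow> 'w \<Rightarrow> 'h" where
  "simple_process n p \<xi> s \<omega> = (\<Sum>i<n. indicator {p i<..p (Suc i)} s *\<^sub>R \<xi> i \<omega>)"

definition simple_integral ::
  "(real \<Rightarrow> 'w \<Rightarrow> real) \<Rightarrow> nat \<Rightarrow> (nat \<Rightarrow> real) \<Rightarrow> (nat \<Rightarrow> 'w \<Rightarrow> 'h::real_vector) \<Rightarrow> 'w \<Rightarrow> 'h" where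
  "simple_integral W n p \<xi> \<omega> = (\<Sum>i<n. (W (p (Suc i)) \<omega> - W (p i) \<omega>) *\<^sub>R \<xi> i \<omega>)"

definition measurable_process_on ::
  "'w measure \<Rightarrow> real \<Rightarrow> real \<Rightarrow> (real \<Rightarrow> 'w \<Rightarrow> 'h::topological_space) \<Rightarrow> bool" where
  "measurable_process_on M a b x \<longleftrightarrow>
     (\<lambda>(s, \<omega>). x s \<omega>) \<in> borel_measurable (restrict_space lborel {a..b} \<Otimes>\<^sub>M M)"

text \<open>\<open>I\<close> is (a version of) \<open>\<integral>\<^sub>a\<^sup>b f(s) dW(s)\<close>: the \<open>L\<^sup>2(P, H)\<close>-limit of the integrals of simple
  processes converging to \<open>f\<close> in \<open>L\<^sup>2([a, b] \<times> \<Omega>, ds \<otimes> P; H)\<close>.  Extended nonnegative integrals are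
  used so that no convergence can hold through the junk value of a non-existing integral.\<close>

definition has_ito_integral ::
  "'w measure \<Rightarrow> (real \<Rightarrow> 'w \<Rightarrow> real) \<Rightarrow> real \<Rightarrow> real \<Rightarrow>
   (real \<Rightarrow> 'w \<Rightarrow> 'h::{real_inner, banach, second_countable_topology}) \<Rightarrow> ('w \<Rightarrow> 'h) \<Rightarrow> bool" where
  "has_ito_integral M W a b f I \<longleftrightarrow>
     measurable_process_on M a b f \<and> I \<in> borel_measurable M \<and>
     (\<exists>n p \<xi>. (\<forall>k::nat. simple_data M W a b (n k) (p k) (\<xi> k)) \<and>
        (\<lambda>k. \<integral>\<^sup>+s\<in>{a..b}. (\<integral>\<^sup>+\<omega>. ennreal ((norm (simple_process (n k) (p k) (\<xi> k) s \<omega> - f s \<omega>))\<^sup>2) \<partial>M) \<partial>lborel)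
          \<longlonglongrightarrow> 0 \<and>
        (\<lambda>k. \<integral>\<^sup>+\<omega>. ennreal ((norm (simple_integral W (n k) (p k) (\<xi> k) \<omega> - I \<omega>))\<^sup>2) \<partial>M)
          \<longlonglongrightarrow> 0)"


section \<open>Mild solutions\<close>

definition initial_value ::
  "'w measure \<Rightarrow> (real \<Rightarrow> 'w \<Rightarrow> real) \<Rightarrow> real \<Rightarrow>
   ('w \<Rightarrow> 'h::{real_inner, banach, second_countable_topology}) \<Rightarrow> bool" where
  "initial_value M W t0 x0 \<longleftrightarrow>
     x0 \<in> borel_measurable (increment_filtration M W t0) \<and> square_integrable M x0"

text \<open>Joint measurability and (local) square integrability are the conditions under which the two
  integrals of the mild equation are defined in the square-mean setting.  The values of \<open>x\<close>
  before \<open>t0\<close> are irrelevant.  The equation at \<open>t = t0\<close> says that \<open>x t0 = x0\<close> almost surely.\<close>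

definition mild_solution ::
  "'w measure \<Rightarrow> (real \<Rightarrow> 'w \<Rightarrow> real) \<Rightarrow>
   (real \<Rightarrow> 'h \<Rightarrow>\<^sub>L 'h) \<Rightarrow> (real \<Rightarrow> 'h \<Rightarrow> 'h) \<Rightarrow> (real \<Rightarrow> 'h \<Rightarrow> 'h) \<Rightarrow>
   real \<Rightarrow> ('w \<Rightarrow> 'h) \<Rightarrow> (real \<Rightarrow> 'w \<Rightarrow> 'h::{real_inner, banach, second_countable_topology}) \<Rightarrow> bool" where
  "mild_solution M W U F G t0 x0 x \<longleftrightarrow>
     (\<forall>t\<ge>t0. x t \<in> borel_measurable (increment_filtration M W t) \<and> square_integrable M (x t)) \<and>
     (\<forall>t\<ge>t0. measurable_process_on M t0 t x \<and>
        (\<integral>\<^sup>+s\<in>{t0..t}. (\<integral>\<^sup>+\<omega>. ennreal ((norm (x s \<omega>))\<^sup>2) \<partial>M) \<partial>lborel) < \<infinity>) \<and>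
     (\<forall>t\<ge>t0. \<exists>I.
        has_ito_integral M W t0 t (\<lambda>s \<omega>. U (t - s) (G s (x s \<omega>))) I \<and>
        (AE \<omega> in M. set_integrable lborel {t0..t} (\<lambda>s. U (t - s) (F s (x s \<omega>)))) \<and>
        (AE \<omega> in M. x t \<omega> =
           U (t - t0) (x0 \<omega>) + (LINT s:{t0..t}|lborel. U (t - s) (F s (x s \<omega>))) + I \<omega>))"

definition mild_solution_on_line ::
  "'w measure \<Rightarrow> (real \<Rightarrow> 'w \<Rightarrow> real) \<Rightarrow>
   (real \<Rightarrow> 'h \<Rightarrow>\<^sub>L 'h) \<Rightarrow> (real \<Rightarrow> 'h \<Rightarrow> 'h) \<Rightarrow> (real \<Rightarrow> 'h \<Rightarrow> 'h) \<Rightarrow>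
   (real \<Rightarrow> 'w \<Rightarrow> 'h::{real_inner, banach, second_countable_topology}) \<Rightarrow> bool" where
  "mild_solution_on_line M W U F G x \<longleftrightarrow> (\<forall>t0. mild_solution M W U F G t0 (x t0) x)"


section \<open>Stability in the square-mean sense\<close>

definition lyapunov_stable ::
  "'w measure \<Rightarrow> (real \<Rightarrow> 'w \<Rightarrow> real) \<Rightarrow>
   (real \<Rightarrow> 'h \<Rightarrow>\<^sub>L 'h) \<Rightarrow> (real \<Rightarrow> 'h \<Rightarrow> 'h) \<Rightarrow> (real \<Rightarrow> 'h \<Rightarrow> 'h) \<Rightarrow>
   (real \<Rightarrow> 'w \<Rightarrow> 'h::{real_inner, banach, second_countable_topology}) \<Rightarrow> bool" where
  "lyapunov_stable M W U F G \<phi> \<longleftrightarrow>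
     (\<forall>t0. \<forall>\<epsilon>>0. \<exists>\<delta>>0. \<forall>x0 x.
        initial_value M W t0 x0 \<longrightarrow> mild_solution M W U F G t0 x0 x \<longrightarrow>
        norm2 M (\<lambda>\<omega>. x0 \<omega> - \<phi> t0 \<omega>) < \<delta> \<longrightarrow>
        (\<forall>t\<ge>t0. norm2 M (\<lambda>\<omega>. x t \<omega> - \<phi> t \<omega>) < \<epsilon>))"

definition globally_asymptotically_stable ::
  "'w measure \<Rightarrow> (real \<Rightarrow> 'w \<Rightarrow> real) \<Rightarrow>
   (real \<Rightarrow> 'h \<Rightarrow>\<^sub>L 'h) \<Rightarrow> (real \<Rightarrow> 'h \<Rightarrow> 'h) \<Rightarrow> (real \<Rightarrow> 'h \<Rightarrow> 'h) \<Rightarrow>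
   (real \<Rightarrow> 'w \<Rightarrow> 'h::{real_inner, banach, second_countable_topology}) \<Rightarrow> bool" where
  "globally_asymptotically_stable M W U F G \<phi> \<longleftrightarrow>
     lyapunov_stable M W U F G \<phi> \<and>
     (\<forall>t0 x0 x. initial_value M W t0 x0 \<longrightarrow> mild_solution M W U F G t0 x0 x \<longrightarrow>
        ((\<lambda>t. norm2 M (\<lambda>\<omega>. x t \<omega> - \<phi> t \<omega>)) \<longlongrightarrow> 0) at_top)"

end

theory Submission
  imports Defs
begin

text \<open>Sums of possibly overlapping steps \<open>1\<^bsub>(a,b]\<^esub> \<xi>\<close> with \<open>\<xi>\<close> known at time \<open>a\<close> satisfy the Ito isometry, by
  independence of later increments; so every integral in the sense of the definition is bounded by
  the integral of its squared integrand, and left Riemann sums give existence for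
  adapted, bounded, mean-square continuous integrands. Since
  \<open>|a + b + c|\<^sup>2 \<le> 3 (|a|\<^sup>2 + |b|\<^sup>2 + |c|\<^sup>2)\<close>, the isometry and a weighted Cauchy-Schwarz inequality for the drift
  show that \<open>u(t) = E|X\<^sub>1(t) - X\<^sub>2(t)|\<^sup>2\<close> satisfies
  \<open>u(t) \<le> 3 \<N>\<^sup>2 exp(-\<nu>(t - t\<^sub>0)) u\<^sub>0 + \<kappa> \<integral> exp(-\<nu>(t - s)) u(s) ds\<close> with \<open>\<kappa> = 3 (1 + 1/\<nu>) \<N>\<^sup>2 \<L>\<^sup>2 < \<nu>\<close>, and Gronwall's
  inequality gives (i). The same estimate makes the Picard map a contraction with constant
  \<open>sqrt(\<kappa>/\<nu>)\<close> for the supremum over \<open>t \<ge> t\<^sub>0\<close> of the mean-square norm. The solution on the line is the limit of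
  the solutions started from 0 at time \<open>-n\<close>, which form a Cauchy sequence by (i).\<close>

section \<open>Increments and the past\<close>

text \<open>Two obstacles shape the proof. The kernel U(t - s) depends on the end point t, so the
  stochastic term is not a martingale in t. Its variation in time is therefore controlled by
  restarting: y(t) is compared with U(t - r) y(r) for r shortly before t, and the squared error is
  of order t - r. Moreover, a stochastic integral is fixed only up to a null set, separately for
  each t. A solution of the linear problem is thus first a family of unrelated random variables;
  mean-square continuity then provides a progressively measurable version, which is needed before it
  can enter the next integrand. The constant \<kappa> has three sources: 3 from the sum of three
  terms, the squares of \<open>\<N>\<close> and \<open>\<L>\<close>, and 1/\<nu> + 1, where 1/\<nu>
  is the mass of the kernel exp(-\<nu>(t - s)) spent by Cauchy-Schwarz in the drift and 1 is the
  isometry. Integrating that kernel once more against a constant gives \<kappa>/\<nu>, the square of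
  the contraction constant. Uniqueness is claimed among mild solutions whose second moment is only
  locally integrable in time, so Gronwall's inequality has to start from an integrable function and
  first make it bounded.\<close>

locale brownian_motion = prob_space M for M :: "'w measure" +
  fixes W :: "real \<Rightarrow> 'w \<Rightarrow> real"
  assumes brownian: "two_sided_brownian_motion M W"
begin

abbreviation Filt :: "real \<Rightarrow> 'w measure" where
  "Filt \<equiv> increment_filtration M W"

lemma measurable_W [measurable]: "W t \<in> borel_measurable M"
  using brownian by (simp add: two_sided_brownian_motion_def)

lemma space_Filt [simp]: "space (Filt t) = space M"
  by (simp add: increment_filtration_def space_measure_of_conv)

lemma sets_Filt:
  "sets (Filt t) = sigma_sets (space M)
     ({(\<lambda>\<omega>. W u \<omega> - W v \<omega>) -` B \<inter> space M | u v B. u \<le> t \<and> v \<le> t \<and> B \<in> sets borel} \<union> null_sets M)"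
  unfolding increment_filtration_def
  by (rule sets_measure_of) (use sets.sets_into_space in \<open>auto simp: null_sets_def\<close>)

lemma sets_Filt_subset: "sets (Filt t) \<subseteq> sets M"
  unfolding sets_Filt by (rule sets.sigma_sets_subset) auto

lemma sets_Filt_mono: "s \<le> t \<Longrightarrow> sets (Filt s) \<subseteq> sets (Filt t)"
  unfolding sets_Filt by (rule sigma_sets_mono') (fastforce intro: order_trans)

lemma measurable_Filt_mono: "f \<in> measurable (Filt s) N \<Longrightarrow> s \<le> t \<Longrightarrow> f \<in> measurable (Filt t) N"
  using sets_Filt_mono[of s t] by (auto simp: measurable_def)

lemma measurable_Filt_imp: "f \<in> measurable (Filt s) N \<Longrightarrow> f \<in> measurable M N"
  using sets_Filt_subset[of s] by (auto simp: measurable_def)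

lemma measurable_increment_Filt:
  assumes "u \<le> t" "v \<le> t"
  shows "(\<lambda>\<omega>. W u \<omega> - W v \<omega>) \<in> borel_measurable (Filt t)"
  using assms by (intro measurableI) (auto simp: sets_Filt intro!: sigma_sets.Basic)

text \<open>Sorting \<open>insert c S\<close> and appending \<open>d\<close> gives one increasing
  sequence of times. Increments between points of \<open>S\<close> are differences of sums of
  consecutive increments up to \<open>c\<close>, and \<open>W d - W c\<close> is the next
  consecutive increment, so the joint independence of consecutive increments separates the two
  blocks.\<close>

lemma finite_increments_indep:
  assumes "finite S" "S \<subseteq> {..c}" "c < d"
    and A: "A \<in> sigma_sets (space M)
      {(\<lambda>\<omega>. W u \<omega> - W v \<omega>) -` B \<inter> space M | u v B. u \<in> S \<and> v \<in> S \<and> B \<in> sets borel}"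
    and B: "B \<in> sets borel"
  shows "prob (A \<inter> ((\<lambda>\<omega>. W d \<omega> - W c \<omega>) -` B \<inter> space M)) =
    prob A * prob ((\<lambda>\<omega>. W d \<omega> - W c \<omega>) -` B \<inter> space M)"
proof -
  define S' where "S' = insert c S"
  define xs where "xs = sorted_list_of_set S'"
  define n where "n = length xs - 1"
  have fin: "finite S'" using assms by (simp add: S'_def)
  have set_xs: "set xs = S'" and srt: "sorted_wrt (<) xs"
    using fin by (auto simp: xs_def)
  have len: "length xs = Suc n"
    using set_xs by (cases xs) (auto simp: n_def S'_def)
  have lt: "xs ! i < xs ! j" if "i < j" "j \<le> n" for i j
    using srt that len by (simp add: sorted_wrt_iff_nth_less)
  have "c \<in> set xs" by (simp add: set_xs S'_def)
  then obtain j where j: "j \<le> n" "xs ! j = c"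
    unfolding in_set_conv_nth len less_Suc_eq_le by blast
  have "xs ! n \<in> S'"
    using nth_mem[of n xs] by (simp add: len set_xs)
  hence "xs ! n \<le> c"
    using assms(2) by (auto simp: S'_def)
  hence xn: "xs ! n = c"
    using j lt[of j n] by (cases "j = n") auto
  \<comment> \<open>The largest point \<open>c\<close> has index \<open>n\<close>; the formula
    continues the sequence with \<open>p (Suc n) = d\<close>.\<close>
  define p where "p i = (if i \<le> n then xs ! i else d + real (i - n - 1))" for i
  have p_less: "p i < p (Suc i)" if "i < Suc n" for i
  proof (cases "i = n")
    case True
    thus ?thesis using xn assms(3) by (simp add: p_def)
  next
    case False
    thus ?thesis using that lt[of i "Suc i"] by (simp add: p_def)
  qed
  have pn: "p n = c" "p (Suc n) = d" using xn by (auto simp: p_def)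
  define X where "X = (\<lambda>(i::nat) \<omega>. W (p (Suc i)) \<omega> - W (p i) \<omega>)"
  have "\<forall>(n::nat) p. (\<forall>i<n. p i < p (Suc i)) \<longrightarrow>
        indep_vars (\<lambda>_. borel) (\<lambda>i \<omega>. W (p (Suc i)) \<omega> - W (p i) \<omega>) {..<n}"
    using brownian by (simp add: two_sided_brownian_motion_def)
  hence ind: "indep_vars (\<lambda>_. borel) X {..<Suc n}"
    using p_less unfolding X_def by blast
  define R where "R = (\<lambda>\<omega>. restrict (\<lambda>i. X i \<omega>) {..<n})"
  define R' where "R' = (\<lambda>\<omega>. restrict (\<lambda>i. X i \<omega>) {n})"
  have iv: "indep_var (PiM {..<n} (\<lambda>_. borel)) R (PiM {n} (\<lambda>_. borel)) R'"
    unfolding R_def R'_def by (rule indep_var_restrict[OF ind]) auto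
  have R_sum: "W (p i) \<omega> - W (p 0) \<omega> = (\<Sum>j<i. R \<omega> j)" if "i \<le> n" for i \<omega>
    using that by (induction i) (auto simp: R_def X_def)
  have gen: "(\<lambda>\<omega>. W u \<omega> - W v \<omega>) -` B \<inter> space M \<in> {R -` A \<inter> space M |A. A \<in> sets (PiM {..<n} (\<lambda>_. borel))}"
    if uv: "u \<in> S" "v \<in> S" and "B \<in> sets borel" for u v and B :: "real set"
  proof -
    have "u \<in> set xs" "v \<in> set xs" using uv by (auto simp: set_xs S'_def)
    then obtain i k where "i < length xs" "k < length xs" "xs ! i = u" "xs ! k = v"
      unfolding in_set_conv_nth by auto
    hence ik: "i \<le> n" "k \<le> n" "u = xs ! i" "v = xs ! k" by (auto simp: len)
    have u: "u = p i" "v = p k" using ik by (auto simp: p_def)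
    let ?h = "\<lambda>r. (\<Sum>j<i. r j) - (\<Sum>j<k. r j) :: real"
    have eq: "W u \<omega> - W v \<omega> = ?h (R \<omega>)" for \<omega>
      using R_sum[OF ik(1), of \<omega>] R_sum[OF ik(2), of \<omega>] u by simp
    have h: "?h \<in> borel_measurable (PiM {..<n} (\<lambda>_. borel))"
      using ik by (intro borel_measurable_diff borel_measurable_sum measurable_component_singleton) auto
    have RM: "\<omega> \<in> space M \<Longrightarrow> R \<omega> \<in> space (PiM {..<n} (\<lambda>_. borel))" for \<omega>
      by (auto simp: R_def space_PiM)
    have "(\<lambda>\<omega>. W u \<omega> - W v \<omega>) -` B \<inter> space M = R -` (?h -` B \<inter> space (PiM {..<n} (\<lambda>_. borel))) \<inter> space M"
      using RM by (auto simp: eq)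
    moreover have "?h -` B \<inter> space (PiM {..<n} (\<lambda>_. borel)) \<in> sets (PiM {..<n} (\<lambda>_. borel))"
      using h \<open>B \<in> sets borel\<close> by (rule measurable_sets)
    ultimately show ?thesis by blast
  qed
  have "A \<in> sigma_sets (space M) {R -` A \<inter> space M |A. A \<in> sets (PiM {..<n} (\<lambda>_. borel))}"
    by (rule subsetD[OF sigma_sets_mono' A]) (use gen in blast)
  moreover have "(\<lambda>\<omega>. W d \<omega> - W c \<omega>) -` B \<inter> space M
      \<in> sigma_sets (space M) {R' -` A \<inter> space M |A. A \<in> sets (PiM {n} (\<lambda>_. borel))}"
  proof (rule sigma_sets.Basic)
    let ?g = "\<lambda>r. r n :: real"
    have eq: "W d \<omega> - W c \<omega> = ?g (R' \<omega>)" for \<omega>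
      using pn by (simp add: R'_def X_def)
    have h: "?g \<in> borel_measurable (PiM {n} (\<lambda>_. borel))"
      by (intro measurable_component_singleton) auto
    have RM: "\<omega> \<in> space M \<Longrightarrow> R' \<omega> \<in> space (PiM {n} (\<lambda>_. borel))" for \<omega>
      by (auto simp: R'_def space_PiM)
    have "(\<lambda>\<omega>. W d \<omega> - W c \<omega>) -` B \<inter> space M = R' -` (?g -` B \<inter> space (PiM {n} (\<lambda>_. borel))) \<inter> space M"
      using RM by (auto simp: eq)
    moreover have "?g -` B \<inter> space (PiM {n} (\<lambda>_. borel)) \<in> sets (PiM {n} (\<lambda>_. borel))"
      using h B by (rule measurable_sets)
    ultimately show "(\<lambda>\<omega>. W d \<omega> - W c \<omega>) -` B \<inter> space M \<in> {R' -` A \<inter> space M |A. A \<in> sets (PiM {n} (\<lambda>_. borel))}"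
      by blast
  qed
  ultimately show ?thesis
    using iv unfolding indep_var_eq indep_sets2_eq by blast
qed

text \<open>Brownian motion is defined through finitely many consecutive increments only; a
  pi-lambda argument extends independence to the whole past. Membership in \<open>P\<close> is
  tested up to null sets, so that the null sets augmenting the filtration belong to \<open>P\<close>
  as well.\<close>

lemma indep_set_Filt_increment:
  assumes "c < d"
  shows "indep_set (sets (Filt c))
    (sigma_sets (space M) {(\<lambda>\<omega>. W d \<omega> - W c \<omega>) -` B \<inter> space M | B. B \<in> sets borel})"
proof -
  define G where "G S = sigma_sets (space M)
      {(\<lambda>\<omega>. W u \<omega> - W v \<omega>) -` B \<inter> space M | u v B. u \<in> S \<and> v \<in> S \<and> B \<in> sets borel}" for S
  \<comment> \<open>Events known from finitely many increments form an \<open>\<inter>\<close>-stable generator, because two finite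
    sets of times have a finite union.\<close>
  define P where "P = {A \<in> events. \<exists>S C. finite S \<and> S \<subseteq> {..c} \<and> C \<in> G S \<and> (AE \<omega> in M. \<omega> \<in> A \<longleftrightarrow> \<omega> \<in> C)}"
  define Q where "Q = {(\<lambda>\<omega>. W d \<omega> - W c \<omega>) -` B \<inter> space M | B. B \<in> sets borel}"
  have G_events: "G S \<subseteq> events" for S
    unfolding G_def by (rule sets.sigma_sets_subset) auto
  have G_mono: "G S \<subseteq> G T" if "S \<subseteq> T" for S T
    unfolding G_def using that by (intro sigma_sets_mono') blast
  have G_Int: "A \<inter> B \<in> G S" if "A \<in> G S" "B \<in> G S" for A B S
  proof -
    interpret sigma_algebra "space M" "G S"
      unfolding G_def by (rule sigma_algebra_sigma_sets) auto
    show ?thesis using that by (rule Int)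
  qed
  have "indep_set P Q"
    unfolding indep_sets2_eq
  proof (intro conjI ballI)
    show "P \<subseteq> events" by (auto simp: P_def)
    show "Q \<subseteq> events" by (auto simp: Q_def)
    fix A B assume "A \<in> P" "B \<in> Q"
    then obtain S C B' where *: "finite S" "S \<subseteq> {..c}" "C \<in> G S" "AE \<omega> in M. \<omega> \<in> A \<longleftrightarrow> \<omega> \<in> C" "A \<in> events"
      "B = (\<lambda>\<omega>. W d \<omega> - W c \<omega>) -` B' \<inter> space M" "B' \<in> sets borel"
      by (auto simp: P_def Q_def)
    have Bev: "B \<in> events" using *(6,7) by simp
    have "prob (A \<inter> B) = prob (C \<inter> B)"
      using *(3,4,5) G_events[of S] Bev by (intro finite_measure_eq_AE) auto
    moreover have "prob A = prob C"
      using *(3,4,5) G_events[of S] by (intro finite_measure_eq_AE) auto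
    moreover have "prob (C \<inter> B) = prob C * prob B"
      unfolding *(6) using *(1,2,3,7) assms unfolding G_def by (intro finite_increments_indep)
    ultimately show "prob (A \<inter> B) = prob A * prob B" by simp
  qed
  moreover have "Int_stable P"
  proof (rule Int_stableI)
    fix A B assume "A \<in> P" "B \<in> P"
    then obtain S C T D where *: "finite S" "S \<subseteq> {..c}" "C \<in> G S" "AE \<omega> in M. \<omega> \<in> A \<longleftrightarrow> \<omega> \<in> C" "A \<in> events"
      "finite T" "T \<subseteq> {..c}" "D \<in> G T" "AE \<omega> in M. \<omega> \<in> B \<longleftrightarrow> \<omega> \<in> D" "B \<in> events"
      by (auto simp: P_def)
    have "C \<inter> D \<in> G (S \<union> T)"
      using *(3,8) G_mono[of S "S \<union> T"] G_mono[of T "S \<union> T"] by (intro G_Int) auto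
    moreover have "AE \<omega> in M. \<omega> \<in> A \<inter> B \<longleftrightarrow> \<omega> \<in> C \<inter> D"
      using *(4,9) by eventually_elim auto
    ultimately show "A \<inter> B \<in> P"
      using * unfolding P_def by (auto intro!: exI[of _ "S \<union> T"] exI[of _ "C \<inter> D"])
  qed
  moreover have "Int_stable Q"
  proof (rule Int_stableI)
    fix A B assume "A \<in> Q" "B \<in> Q"
    then obtain A' B' where "A = (\<lambda>\<omega>. W d \<omega> - W c \<omega>) -` A' \<inter> space M" "A' \<in> sets borel"
      "B = (\<lambda>\<omega>. W d \<omega> - W c \<omega>) -` B' \<inter> space M" "B' \<in> sets borel"
      by (auto simp: Q_def)
    thus "A \<inter> B \<in> Q" unfolding Q_def by (intro CollectI exI[of _ "A' \<inter> B'"]) auto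
  qed
  ultimately have ind: "indep_set (sigma_sets (space M) P) (sigma_sets (space M) Q)"
    by (rule indep_set_sigma_sets)
  have "sets (Filt c) \<subseteq> sigma_sets (space M) P"
    unfolding sets_Filt
  proof (rule sigma_sets_mono', safe)
    fix u v and B :: "real set"
    assume uv: "u \<le> c" "v \<le> c" and B: "B \<in> sets borel"
    let ?A = "(\<lambda>\<omega>. W u \<omega> - W v \<omega>) -` B \<inter> space M"
    have "?A \<in> G {u,v}" unfolding G_def using B by (intro sigma_sets.Basic) blast
    moreover have "?A \<in> events" using B by simp
    ultimately show "?A \<in> P"
      unfolding P_def using uv by (intro CollectI conjI exI[of _ "{u,v}"] exI[of _ ?A]) auto
  next
    fix A assume A: "A \<in> null_sets M"
    have "{} \<in> G {}" unfolding G_def by (rule sigma_sets.Empty)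
    moreover have "AE \<omega> in M. \<omega> \<in> A \<longleftrightarrow> \<omega> \<in> {}"
      using AE_not_in[OF A] by simp
    ultimately show "A \<in> P"
      unfolding P_def using A by (intro CollectI conjI exI[of _ "{}"]) auto
  qed
  thus ?thesis
    using ind unfolding indep_sets2_eq Q_def by blast
qed

lemma indep_var_Filt_increment:
  assumes "c < d" and Z: "Z \<in> borel_measurable (Filt c)"
  shows "indep_var borel Z borel (\<lambda>\<omega>. W d \<omega> - W c \<omega>)"
  unfolding indep_var_eq
proof (intro conjI)
  show "random_variable borel Z" using Z by (rule measurable_Filt_imp)
  have sa: "sigma_sets (space M) {Z -` A \<inter> space M |A. A \<in> sets borel} \<subseteq> sets (Filt c)"
  proof -
    have "{Z -` A \<inter> space M |A. A \<in> sets borel} \<subseteq> sets (Filt c)"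
      using measurable_sets[OF Z] by auto
    from sets.sigma_sets_subset[OF this] show ?thesis by simp
  qed
  show "indep_set (sigma_sets (space M) {Z -` A \<inter> space M |A. A \<in> sets borel})
     (sigma_sets (space M) {(\<lambda>\<omega>. W d \<omega> - W c \<omega>) -` A \<inter> space M |A. A \<in> sets borel})"
    using indep_set_Filt_increment[OF assms(1)] sa unfolding indep_sets2_eq by blast
qed simp

lemma increment_moments:
  assumes "c < d"
  shows "integrable M (\<lambda>\<omega>. W d \<omega> - W c \<omega>)" "(\<integral>\<omega>. W d \<omega> - W c \<omega> \<partial>M) = 0"
    "integrable M (\<lambda>\<omega>. (W d \<omega> - W c \<omega>)\<^sup>2)" "(\<integral>\<omega>. (W d \<omega> - W c \<omega>)\<^sup>2 \<partial>M) = d - c"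
proof -
  have D: "distributed M lborel (\<lambda>\<omega>. W d \<omega> - W c \<omega>) (normal_density 0 (sqrt (d - c)))"
    using brownian assms by (simp add: two_sided_brownian_motion_def)
  have pos: "0 < sqrt (d - c)" using assms by simp
  show "integrable M (\<lambda>\<omega>. W d \<omega> - W c \<omega>)"
    using distributed_integrable[OF D, of "\<lambda>x. x"] integrable_normal_moment[OF pos, of 0 1] by simp
  show "(\<integral>\<omega>. W d \<omega> - W c \<omega> \<partial>M) = 0"
    using distributed_integral[OF D, of "\<lambda>x. x"] integral_normal_moment_nz_1[OF pos, of 0] by simp
  show "integrable M (\<lambda>\<omega>. (W d \<omega> - W c \<omega>)\<^sup>2)"
    using distributed_integrable[OF D, of "\<lambda>x. x\<^sup>2"] integrable_normal_moment[OF pos, of 0 2] by simp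
  show "(\<integral>\<omega>. (W d \<omega> - W c \<omega>)\<^sup>2 \<partial>M) = d - c"
    using distributed_integral[OF D, of "\<lambda>x. x\<^sup>2"] integral_normal_moment_even[OF pos, of 0 1] assms
    by (simp add: fact_numeral numeral_2_eq_2)
qed

text \<open>Independence factorises the expectations. The case \<open>c = d\<close> stands apart
  because the normal law of an increment is prescribed only for distinct times; there every product
  vanishes.\<close>

lemma expectation_mult_increment:
  assumes "c \<le> d" and Z: "Z \<in> borel_measurable (Filt c)" "integrable M Z"
  shows "integrable M (\<lambda>\<omega>. Z \<omega> * (W d \<omega> - W c \<omega>))"
    "(\<integral>\<omega>. Z \<omega> * (W d \<omega> - W c \<omega>) \<partial>M) = 0"
    "integrable M (\<lambda>\<omega>. Z \<omega> * (W d \<omega> - W c \<omega>)\<^sup>2)"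
    "(\<integral>\<omega>. Z \<omega> * (W d \<omega> - W c \<omega>)\<^sup>2 \<partial>M) = (d - c) * (\<integral>\<omega>. Z \<omega> \<partial>M)"
proof -
  consider "c = d" | "c < d" using assms(1) by linarith
  hence "integrable M (\<lambda>\<omega>. Z \<omega> * (W d \<omega> - W c \<omega>)) \<and> (\<integral>\<omega>. Z \<omega> * (W d \<omega> - W c \<omega>) \<partial>M) = 0 \<and>
    integrable M (\<lambda>\<omega>. Z \<omega> * (W d \<omega> - W c \<omega>)\<^sup>2) \<and>
    (\<integral>\<omega>. Z \<omega> * (W d \<omega> - W c \<omega>)\<^sup>2 \<partial>M) = (d - c) * (\<integral>\<omega>. Z \<omega> \<partial>M)"
  proof cases
    case 1
    thus ?thesis by simp
  next
    case 2
    note m = increment_moments[OF 2]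
    have i1: "indep_var borel Z borel (\<lambda>\<omega>. W d \<omega> - W c \<omega>)"
      by (rule indep_var_Filt_increment[OF 2 Z(1)])
    have i2: "indep_var borel Z borel (\<lambda>\<omega>. (W d \<omega> - W c \<omega>)\<^sup>2)"
      using indep_var_compose[OF i1, of "\<lambda>x. x" borel "\<lambda>x. x\<^sup>2" borel] by (simp add: o_def)
    show ?thesis
      using indep_var_integrable[OF i1 Z(2) m(1)] indep_var_lebesgue_integral[OF i1 Z(2) m(1)]
        indep_var_integrable[OF i2 Z(2) m(3)] indep_var_lebesgue_integral[OF i2 Z(2) m(3)] m
      by simp
  qed
  thus "integrable M (\<lambda>\<omega>. Z \<omega> * (W d \<omega> - W c \<omega>))"
    "(\<integral>\<omega>. Z \<omega> * (W d \<omega> - W c \<omega>) \<partial>M) = 0"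
    "integrable M (\<lambda>\<omega>. Z \<omega> * (W d \<omega> - W c \<omega>)\<^sup>2)"
    "(\<integral>\<omega>. Z \<omega> * (W d \<omega> - W c \<omega>)\<^sup>2 \<partial>M) = (d - c) * (\<integral>\<omega>. Z \<omega> \<partial>M)"
    by auto
qed

end

section \<open>Square means\<close>

text \<open>The squared norm is kept as an extended nonnegative integral over an arbitrary measure:
  estimates then hold without integrability hypotheses, and one notion serves random variables on
  \<open>M\<close> and processes on \<open>lborel \<Otimes>\<^sub>M M\<close>.\<close>

definition nl2 :: "'a measure \<Rightarrow> ('a \<Rightarrow> 'b::real_normed_vector) \<Rightarrow> ennreal" where
  "nl2 M f = (\<integral>\<^sup>+x. ennreal ((norm (f x))\<^sup>2) \<partial>M)"

abbreviation nl2d :: "'a measure \<Rightarrow> ('a \<Rightarrow> 'b::real_normed_vector) \<Rightarrow> ('a \<Rightarrow> 'b) \<Rightarrow> ennreal" where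
  "nl2d M f g \<equiv> nl2 M (\<lambda>x. f x - g x)"

abbreviation dist2 :: "'w measure \<Rightarrow> ('w \<Rightarrow> 'h::{real_inner, banach, second_countable_topology}) \<Rightarrow> ('w \<Rightarrow> 'h) \<Rightarrow> real" where
  "dist2 M x y \<equiv> norm2 M (\<lambda>\<omega>. x \<omega> - y \<omega>)"

text \<open>Young's inequality 2ab \<le> e a^2 + b^2/e. The free weight matters: letting
  \<open>e\<close> tend to 0 carries estimates to limits with constant 1, and a suitable choice of
  \<open>e\<close> yields Minkowski's inequality.\<close>

lemma norm_add_sq_le:
  fixes x y :: "'b::real_normed_vector"
  assumes "e > 0"
  shows "(norm (x + y))\<^sup>2 \<le> (1 + e) * (norm x)\<^sup>2 + (1 + 1 / e) * (norm y)\<^sup>2"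
proof -
  have "(norm (x + y))\<^sup>2 \<le> (norm x + norm y)\<^sup>2"
    by (intro power_mono norm_triangle_ineq) simp
  moreover have "0 \<le> (e * norm x - norm y)\<^sup>2 / e" using assms by simp
  hence "2 * (norm x * norm y) \<le> e * (norm x)\<^sup>2 + (norm y)\<^sup>2 / e"
    using assms by (simp add: power2_eq_square field_simps)
  ultimately show ?thesis by (simp add: power2_eq_square algebra_simps)
qed

lemma nl2_cong_AE: "AE x in M. f x = g x \<Longrightarrow> nl2 M f = nl2 M g"
  unfolding nl2_def by (intro nn_integral_cong_AE) auto

lemma nl2_minus_commute: "nl2 M (\<lambda>x. f x - g x) = nl2 M (\<lambda>x. g x - f x)"
  unfolding nl2_def by (simp add: norm_minus_commute)

lemma nl2_zero [simp]: "nl2 M (\<lambda>x. 0) = 0"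
  by (simp add: nl2_def)

lemma nl2_add_eps:
  fixes f g :: "'a \<Rightarrow> 'b::{real_normed_vector, second_countable_topology}"
  assumes [measurable]: "f \<in> borel_measurable M" "g \<in> borel_measurable M" and "e > 0"
  shows "nl2 M (\<lambda>x. f x + g x) \<le> ennreal (1 + e) * nl2 M f + ennreal (1 + 1 / e) * nl2 M g"
proof -
  have "nl2 M (\<lambda>x. f x + g x) \<le>
      (\<integral>\<^sup>+x. ennreal (1 + e) * ennreal ((norm (f x))\<^sup>2) + ennreal (1 + 1 / e) * ennreal ((norm (g x))\<^sup>2) \<partial>M)"
    unfolding nl2_def using assms(3)
    by (intro nn_integral_mono) (simp flip: ennreal_mult ennreal_plus add: norm_add_sq_le)
  also have "\<dots> = ennreal (1 + e) * nl2 M f + ennreal (1 + 1 / e) * nl2 M g"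
    unfolding nl2_def by (simp add: nn_integral_add nn_integral_cmult)
  finally show ?thesis .
qed

lemma nl2_triangle:
  fixes f g h :: "'a \<Rightarrow> 'b::{real_normed_vector, second_countable_topology}"
  assumes "f \<in> borel_measurable M" "g \<in> borel_measurable M" "h \<in> borel_measurable M"
  shows "nl2 M (\<lambda>x. f x - h x) \<le> 2 * nl2 M (\<lambda>x. f x - g x) + 2 * nl2 M (\<lambda>x. g x - h x)"
  using nl2_add_eps[of "\<lambda>x. f x - g x" M "\<lambda>x. g x - h x" 1] assms by simp

text \<open>The sum of the three squared differences of the norms is nonnegative. The factor 3 of
  the theorem originates here.\<close>

lemma nl2_add3:
  fixes f g h :: "'a \<Rightarrow> 'b::{real_normed_vector, second_countable_topology}"
  assumes [measurable]: "f \<in> borel_measurable M" "g \<in> borel_measurable M" "h \<in> borel_measurable M"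
  shows "nl2 M (\<lambda>x. f x + g x + h x) \<le> 3 * (nl2 M f + nl2 M g + nl2 M h)"
proof -
  have sq: "(norm (x + y + z))\<^sup>2 \<le> 3 * ((norm x)\<^sup>2 + (norm y)\<^sup>2 + (norm z)\<^sup>2)" for x y z :: 'b
  proof -
    have "(norm (x + y + z))\<^sup>2 \<le> (norm x + norm y + norm z)\<^sup>2"
      by (intro power_mono) (auto intro: order_trans[OF norm_triangle_ineq] add_mono)
    moreover have "0 \<le> (norm x - norm y)\<^sup>2 + (norm x - norm z)\<^sup>2 + (norm y - norm z)\<^sup>2" by simp
    ultimately show ?thesis by (simp add: power2_eq_square algebra_simps)
  qed
  have "nl2 M (\<lambda>x. f x + g x + h x) \<le>
     (\<integral>\<^sup>+x. 3 * (ennreal ((norm (f x))\<^sup>2) + ennreal ((norm (g x))\<^sup>2) + ennreal ((norm (h x))\<^sup>2)) \<partial>M)"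
    unfolding nl2_def
  proof (intro nn_integral_mono)
    fix x
    have "ennreal ((norm (f x + g x + h x))\<^sup>2) \<le> ennreal (3 * ((norm (f x))\<^sup>2 + (norm (g x))\<^sup>2 + (norm (h x))\<^sup>2))"
      using sq by (intro ennreal_leI)
    also have "\<dots> = 3 * (ennreal ((norm (f x))\<^sup>2) + ennreal ((norm (g x))\<^sup>2) + ennreal ((norm (h x))\<^sup>2))"
      by (subst ennreal_mult) auto
    finally show "ennreal ((norm (f x + g x + h x))\<^sup>2) \<le>
      3 * (ennreal ((norm (f x))\<^sup>2) + ennreal ((norm (g x))\<^sup>2) + ennreal ((norm (h x))\<^sup>2))" .
  qed
  also have "\<dots> = 3 * (nl2 M f + nl2 M g + nl2 M h)"
    unfolding nl2_def by (simp add: nn_integral_add nn_integral_cmult)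
  finally show ?thesis .
qed

lemma nl2_eq_0_iff:
  fixes f :: "'a \<Rightarrow> 'b::{real_normed_vector, second_countable_topology}"
  assumes [measurable]: "f \<in> borel_measurable M"
  shows "nl2 M f = 0 \<longleftrightarrow> (AE x in M. f x = 0)"
proof -
  have "nl2 M f = 0 \<longleftrightarrow> (AE x in M. ennreal ((norm (f x))\<^sup>2) = 0)"
    unfolding nl2_def by (rule nn_integral_0_iff_AE) measurable
  thus ?thesis by (simp add: ennreal_eq_0_iff)
qed

lemma nl2_blinfun_le:
  fixes f :: "'a \<Rightarrow> 'b::real_normed_vector" and T :: "'b \<Rightarrow>\<^sub>L 'c::real_normed_vector"
  assumes "f \<in> borel_measurable M"
  shows "nl2 M (\<lambda>x. T (f x)) \<le> ennreal ((norm T)\<^sup>2) * nl2 M f"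
proof -
  have "nl2 M (\<lambda>x. T (f x)) \<le> (\<integral>\<^sup>+x. ennreal ((norm T)\<^sup>2) * ennreal ((norm (f x))\<^sup>2) \<partial>M)"
    unfolding nl2_def
  proof (intro nn_integral_mono)
    fix x
    have "(norm (T (f x)))\<^sup>2 \<le> (norm T * norm (f x))\<^sup>2"
      by (intro power_mono norm_blinfun) simp
    thus "ennreal ((norm (T (f x)))\<^sup>2) \<le> ennreal ((norm T)\<^sup>2) * ennreal ((norm (f x))\<^sup>2)"
      by (simp flip: ennreal_mult add: power_mult_distrib)
  qed
  also have "\<dots> = ennreal ((norm T)\<^sup>2) * nl2 M f"
    unfolding nl2_def using assms by (intro nn_integral_cmult) measurable
  finally show ?thesis .
qed

lemma ennreal_le_of_le_mult:
  fixes a b :: ennreal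
  assumes "\<And>e::real. e > 0 \<Longrightarrow> a \<le> ennreal ((1 + e)\<^sup>2) * b"
  shows "a \<le> b"
proof (cases b)
  case (real r)
  have "((\<lambda>e::real. ennreal ((1 + e)\<^sup>2 * r)) \<longlongrightarrow> ennreal ((1 + 0)\<^sup>2 * r)) (at_right 0)"
    by (intro tendsto_intros)
  moreover have "\<forall>\<^sub>F e in at_right (0::real). a \<le> ennreal ((1 + e)\<^sup>2 * r)"
    using eventually_at_right_less[of "0::real"]
  proof eventually_elim
    case (elim e)
    thus ?case using assms[of e] real by (simp add: ennreal_mult)
  qed
  ultimately have "a \<le> ennreal ((1 + 0)\<^sup>2 * r)"
    by (intro tendsto_lowerbound) auto
  thus ?thesis using real by simp
qed simp

text \<open>Young's inequality with factor 1 + e is applied to both approximations; k tends to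
  infinity for fixed \<open>e\<close>, and only then \<open>e\<close> tends to 0. In this way
  constant 1 survives, which a triangle inequality with factor 2 would spoil.\<close>

lemma nl2_limit_le:
  fixes S :: "nat \<Rightarrow> 'a \<Rightarrow> 'b::{real_normed_vector, second_countable_topology}"
    and J :: "nat \<Rightarrow> 'c \<Rightarrow> 'b"
  assumes S: "\<And>k. S k \<in> borel_measurable P" "f \<in> borel_measurable P" "(\<lambda>k. nl2 P (\<lambda>x. S k x - f x)) \<longlonglongrightarrow> 0"
    and J: "\<And>k. J k \<in> borel_measurable M" "I \<in> borel_measurable M" "(\<lambda>k. nl2 M (\<lambda>x. J k x - I x)) \<longlonglongrightarrow> 0"
    and le: "\<And>k. nl2 M (J k) \<le> nl2 P (S k)"
  shows "nl2 M I \<le> nl2 P f"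
proof (rule ennreal_le_of_le_mult)
  fix e :: real assume e: "e > 0"
  let ?a = "ennreal (1 + e)" and ?b = "ennreal (1 + 1 / e)"
  have fin: "?a \<noteq> top" "?b \<noteq> top" by auto
  have bound: "nl2 M I \<le> ?a * (?a * nl2 P f + ?b * nl2 P (\<lambda>x. S k x - f x)) + ?b * nl2 M (\<lambda>x. J k x - I x)" for k
  proof -
    have "nl2 M I \<le> ?a * nl2 M (J k) + ?b * nl2 M (\<lambda>x. J k x - I x)"
      using nl2_add_eps[of "J k" M "\<lambda>x. I x - J k x" e] J e
      by (simp add: nl2_minus_commute[of M "J k"] borel_measurable_diff)
    moreover have "nl2 P (S k) \<le> ?a * nl2 P f + ?b * nl2 P (\<lambda>x. S k x - f x)"
      using nl2_add_eps[of f P "\<lambda>x. S k x - f x" e] S e by (simp add: borel_measurable_diff)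
    ultimately show ?thesis
      using le[of k] by (meson add_right_mono dual_order.trans mult_left_mono zero_le)
  qed
  have "(\<lambda>k. ?a * (?a * nl2 P f + ?b * nl2 P (\<lambda>x. S k x - f x)) + ?b * nl2 M (\<lambda>x. J k x - I x))
      \<longlonglongrightarrow> ?a * (?a * nl2 P f + ?b * 0) + ?b * 0"
    using S(3) J(3) fin by (intro tendsto_intros ennreal_tendsto_cmult) (auto simp: less_top)
  hence "nl2 M I \<le> ?a * (?a * nl2 P f + ?b * 0) + ?b * 0"
    using bound by (intro tendsto_lowerbound[OF _ always_eventually]) auto
  thus "nl2 M I \<le> ennreal ((1 + e)\<^sup>2) * nl2 P f"
    using e by (simp add: power2_eq_square ennreal_mult mult.assoc)
qed

lemma square_integrable_iff:
  "square_integrable M x \<longleftrightarrow> x \<in> borel_measurable M \<and> nl2 M x < \<infinity>"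
proof -
  have "x \<in> borel_measurable M \<Longrightarrow> integrable M (\<lambda>\<omega>. (norm (x \<omega>))\<^sup>2) \<longleftrightarrow> nl2 M x < \<infinity>"
    unfolding nl2_def by (subst integrable_iff_bounded) auto
  thus ?thesis by (auto simp: square_integrable_def)
qed

lemma norm2_nonneg [simp]: "norm2 M x \<ge> 0"
  by (simp add: norm2_def)

lemma nl2_eq_norm2:
  assumes "square_integrable M x"
  shows "nl2 M x = ennreal ((norm2 M x)\<^sup>2)"
  using assms unfolding nl2_def norm2_def square_integrable_def
  by (subst nn_integral_eq_integral) (auto intro!: arg_cong[of _ _ ennreal] simp: integral_nonneg_AE)

lemma norm2_sq: "(norm2 M x)\<^sup>2 = (\<integral>\<omega>. (norm (x \<omega>))\<^sup>2 \<partial>M)"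
  unfolding norm2_def by (simp add: integral_nonneg_AE)

text \<open>A bound on \<open>norm2\<close> alone carries no information, since a Bochner integral
  that does not exist has value 0; the extended integral yields integrability and the bound
  together.\<close>

lemma nl2_le_imp_norm2_le:
  assumes "x \<in> borel_measurable M" "nl2 M x \<le> ennreal (c\<^sup>2)" "c \<ge> 0"
  shows "square_integrable M x" "norm2 M x \<le> c"
proof -
  show s: "square_integrable M x"
    using assms by (auto simp: square_integrable_iff intro: le_less_trans)
  show "norm2 M x \<le> c"
    using assms nl2_eq_norm2[OF s] by (simp add: power2_le_iff_abs_le)
qed

lemma square_integrable_measurable: "square_integrable M x \<Longrightarrow> x \<in> borel_measurable M"
  by (simp add: square_integrable_def)

lemma square_integrable_cong_AE:
  assumes "square_integrable M x" "AE \<omega> in M. x \<omega> = y \<omega>" "y \<in> borel_measurable M"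
  shows "square_integrable M y"
  using assms nl2_cong_AE[OF assms(2)] by (simp add: square_integrable_iff)

lemma norm2_cong_AE:
  assumes "AE \<omega> in M. x \<omega> = y \<omega>" "x \<in> borel_measurable M" "y \<in> borel_measurable M"
  shows "norm2 M x = norm2 M y"
  unfolding norm2_def using assms(1) assms(2,3)[measurable]
  by (intro arg_cong[of _ _ sqrt] integral_cong_AE) auto

lemma square_integrable_zero [simp]: "square_integrable M (\<lambda>\<omega>. 0)"
  by (simp add: square_integrable_iff)

lemma norm2_zero [simp]: "norm2 M (\<lambda>\<omega>. 0) = 0"
  by (simp add: norm2_def)

lemma square_integrable_add:
  assumes "square_integrable M x" "square_integrable M y"
  shows "square_integrable M (\<lambda>\<omega>. x \<omega> + y \<omega>)"
  using assms nl2_add_eps[of x M y 1] unfolding square_integrable_iff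
  by (auto intro: le_less_trans simp: ennreal_mult_less_top)

lemma square_integrable_scaleR:
  assumes "square_integrable M x"
  shows "square_integrable M (\<lambda>\<omega>. c *\<^sub>R x \<omega>)"
  using assms by (auto simp: square_integrable_def power_mult_distrib)

lemma square_integrable_diff:
  assumes "square_integrable M x" "square_integrable M y"
  shows "square_integrable M (\<lambda>\<omega>. x \<omega> - y \<omega>)"
  using square_integrable_add[OF assms(1) square_integrable_scaleR[OF assms(2), of "-1"]] by simp

lemma borel_measurable_blinfun_const [measurable]:
  "f \<in> borel_measurable M \<Longrightarrow> (\<lambda>x. blinfun_apply T (f x)) \<in> borel_measurable M"
  by (erule measurable_compose[OF _ borel_measurable_continuous_onI]) (intro continuous_intros)

lemma square_integrable_blinfun:
  assumes "square_integrable M x"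
  shows "square_integrable M (\<lambda>\<omega>. blinfun_apply T (x \<omega>))"
proof -
  have "x \<in> borel_measurable M" using assms by (simp add: square_integrable_def)
  moreover have "(\<lambda>\<omega>. blinfun_apply T (x \<omega>)) \<in> borel_measurable M"
    using \<open>x \<in> borel_measurable M\<close> by (rule borel_measurable_blinfun_const)
  ultimately show ?thesis
    using assms nl2_blinfun_le[of x M T] unfolding square_integrable_iff
    by (auto intro: le_less_trans simp: ennreal_mult_less_top)
qed

text \<open>Minkowski's inequality from Young's: for the weight b/a the right-hand side (1 + b/a)
  a^2 + (1 + a/b) b^2 is the square of a + b.\<close>

lemma norm2_triangle:
  assumes "square_integrable M x" "square_integrable M y"
  shows "norm2 M (\<lambda>\<omega>. x \<omega> + y \<omega>) \<le> norm2 M x + norm2 M y"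
proof (rule field_le_epsilon)
  fix e :: real assume e: "e > 0"
  \<comment> \<open>The added \<open>e / 2\<close> keeps both numbers positive, so that the weight
    \<open>b / a\<close> makes sense even for vanishing norms.\<close>
  define a where "a = norm2 M x + e / 2"
  define b where "b = norm2 M y + e / 2"
  have ab: "a > 0" "b > 0" using e by (auto simp: a_def b_def add_nonneg_pos)
  have "ennreal ((norm2 M (\<lambda>\<omega>. x \<omega> + y \<omega>))\<^sup>2) \<le> ennreal (1 + b / a) * ennreal ((norm2 M x)\<^sup>2) + ennreal (1 + 1 / (b / a)) * ennreal ((norm2 M y)\<^sup>2)"
    using nl2_add_eps[of x M y "b / a"] ab assms
    by (simp add: square_integrable_measurable nl2_eq_norm2 square_integrable_add)
  also have "\<dots> = ennreal ((1 + b / a) * (norm2 M x)\<^sup>2 + (1 + a / b) * (norm2 M y)\<^sup>2)"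
    using ab by (simp add: ennreal_mult ennreal_plus)
  finally have "(norm2 M (\<lambda>\<omega>. x \<omega> + y \<omega>))\<^sup>2 \<le> (1 + b / a) * (norm2 M x)\<^sup>2 + (1 + a / b) * (norm2 M y)\<^sup>2"
    using ab by (subst (asm) ennreal_le_iff) auto
  also have "\<dots> \<le> (1 + b / a) * a\<^sup>2 + (1 + a / b) * b\<^sup>2"
    using ab e by (intro add_mono mult_left_mono power_mono) (auto simp: a_def b_def)
  also have "\<dots> = (a + b)\<^sup>2"
    using ab by (simp add: field_simps power2_eq_square)
  finally have "norm2 M (\<lambda>\<omega>. x \<omega> + y \<omega>) \<le> a + b"
    using ab by (simp add: power2_le_iff_abs_le)
  thus "norm2 M (\<lambda>\<omega>. x \<omega> + y \<omega>) \<le> norm2 M x + norm2 M y + e" by (simp add: a_def b_def)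
qed

lemma norm2_minus_commute: "dist2 M x y = dist2 M y x"
  by (simp add: norm2_def norm_minus_commute)

lemma norm2_diff_triangle:
  assumes "square_integrable M x" "square_integrable M y" "square_integrable M z"
  shows "dist2 M x z \<le> dist2 M x y + dist2 M y z"
  using norm2_triangle[OF square_integrable_diff[OF assms(1,2)] square_integrable_diff[OF assms(2,3)]]
  by simp

lemma norm2_eq_0_imp_AE:
  assumes "square_integrable M (\<lambda>\<omega>. x \<omega> - y \<omega>)" "dist2 M x y = 0"
  shows "AE \<omega> in M. x \<omega> = y \<omega>"
  using nl2_eq_norm2[OF assms(1)] nl2_eq_0_iff[of "\<lambda>\<omega>. x \<omega> - y \<omega>" M] assms
  by (simp add: square_integrable_measurable)

lemma integrable_inner:
  assumes "square_integrable M x" "square_integrable M y"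
  shows "integrable M (\<lambda>\<omega>. x \<omega> \<bullet> y \<omega>)"
proof (rule Bochner_Integration.integrable_bound)
  show "integrable M (\<lambda>\<omega>. (norm (x \<omega>))\<^sup>2 + (norm (y \<omega>))\<^sup>2)"
    using assms by (simp add: square_integrable_def)
  show "(\<lambda>\<omega>. x \<omega> \<bullet> y \<omega>) \<in> borel_measurable M"
    using assms by (simp add: square_integrable_def borel_measurable_inner)
  have "\<bar>x \<omega> \<bullet> y \<omega>\<bar> \<le> (norm (x \<omega>))\<^sup>2 + (norm (y \<omega>))\<^sup>2" for \<omega>
  proof -
    have "\<bar>x \<omega> \<bullet> y \<omega>\<bar> \<le> norm (x \<omega>) * norm (y \<omega>)" by (rule Cauchy_Schwarz_ineq2)
    moreover have "0 \<le> (norm (x \<omega>) - norm (y \<omega>))\<^sup>2" by simp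
    hence "norm (x \<omega>) * norm (y \<omega>) * 2 \<le> (norm (x \<omega>))\<^sup>2 + (norm (y \<omega>))\<^sup>2"
      by (simp add: power2_eq_square algebra_simps)
    moreover have "0 \<le> norm (x \<omega>) * norm (y \<omega>)" by simp
    ultimately show ?thesis by linarith
  qed
  thus "AE \<omega> in M. norm (x \<omega> \<bullet> y \<omega>) \<le> norm ((norm (x \<omega>))\<^sup>2 + (norm (y \<omega>))\<^sup>2)"
    by (intro AE_I2) simp
qed

section \<open>Mean-square limits of geometrically convergent sequences\<close>

context prob_space
begin

text \<open>Nonnegativity of the variance of the norm compares its first and second moments.\<close>

lemma expectation_norm_le_norm2:
  assumes "square_integrable M x"
  shows "integrable M (\<lambda>\<omega>. norm (x \<omega>))" "(\<integral>\<omega>. norm (x \<omega>) \<partial>M) \<le> norm2 M x"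
proof -
  have i2: "integrable M (\<lambda>\<omega>. (norm (x \<omega>))\<^sup>2)" using assms by (simp add: square_integrable_def)
  show i1: "integrable M (\<lambda>\<omega>. norm (x \<omega>))"
    by (rule square_integrable_imp_integrable[OF _ i2]) (use square_integrable_measurable[OF assms] in measurable)
  have "0 \<le> variance (\<lambda>\<omega>. norm (x \<omega>))" by (rule variance_positive)
  hence "(\<integral>\<omega>. norm (x \<omega>) \<partial>M)\<^sup>2 \<le> (\<integral>\<omega>. (norm (x \<omega>))\<^sup>2 \<partial>M)"
    using variance_eq[OF i1 i2] by simp
  thus "(\<integral>\<omega>. norm (x \<omega>) \<partial>M) \<le> norm2 M x"
    unfolding norm2_def by (rule real_le_rsqrt)
qed

text \<open>As in the Riesz-Fischer theorem: a geometric rate makes the sum of the expected norms of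
  the increments finite, so the increments are almost surely absolutely summable.\<close>

lemma L2_geometric_AE_convergent:
  assumes X: "\<And>n. square_integrable M (X n)"
    and le: "\<And>n. dist2 M (X (Suc n)) (X n) \<le> C * q ^ n" and q: "0 \<le> q" "q < 1"
  shows "AE \<omega> in M. convergent (\<lambda>n. X n \<omega>)"
proof -
  define D where "D n \<omega> = X (Suc n) \<omega> - X n \<omega>" for n \<omega>
  have D: "square_integrable M (D n)" for n
    unfolding D_def using X by (intro square_integrable_diff)
  note [measurable] = square_integrable_measurable[OF D]
  have "(\<integral>\<^sup>+\<omega>. (\<Sum>n. ennreal (norm (D n \<omega>))) \<partial>M) = (\<Sum>n. \<integral>\<^sup>+\<omega>. ennreal (norm (D n \<omega>)) \<partial>M)"
    by (rule nn_integral_suminf) measurable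
  also have "\<dots> \<le> (\<Sum>n. ennreal (C * q ^ n))"
  proof (rule suminf_le)
    fix n
    have "(\<integral>\<^sup>+\<omega>. ennreal (norm (D n \<omega>)) \<partial>M) = ennreal (\<integral>\<omega>. norm (D n \<omega>) \<partial>M)"
      by (rule nn_integral_eq_integral) (auto intro: expectation_norm_le_norm2 D)
    also have "\<dots> \<le> ennreal (C * q ^ n)"
      using expectation_norm_le_norm2(2)[OF D[of n]] le[of n, folded D_def] by (intro ennreal_leI) linarith
    finally show "(\<integral>\<^sup>+\<omega>. ennreal (norm (D n \<omega>)) \<partial>M) \<le> ennreal (C * q ^ n)" .
  qed auto
  also have "\<dots> < \<infinity>"
  proof -
    have C: "C \<ge> 0" using order_trans[OF norm2_nonneg le[of 0]] by simp
    have "summable (\<lambda>n. C * q ^ n)" using q by (intro summable_mult summable_geometric) auto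
    thus ?thesis using C q by (subst suminf_ennreal2) auto
  qed
  finally have "AE \<omega> in M. (\<Sum>n. ennreal (norm (D n \<omega>))) \<noteq> \<infinity>"
    by (intro nn_integral_PInf_AE) auto
  thus ?thesis
  proof eventually_elim
    case (elim \<omega>)
    have "summable (\<lambda>n. norm (D n \<omega>))"
      using elim by (intro summable_suminf_not_top) auto
    hence "summable (\<lambda>n. D n \<omega>)" by (rule summable_norm_cancel)
    hence "convergent (\<lambda>n. \<Sum>i<n. D i \<omega>)" by (simp add: summable_iff_convergent)
    moreover have "(\<Sum>i<n. D i \<omega>) = X n \<omega> - X 0 \<omega>" for n
      unfolding D_def by (rule sum_lessThan_telescope)
    ultimately have "convergent (\<lambda>n. X 0 \<omega> + (X n \<omega> - X 0 \<omega>))"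
      by (intro convergent_add convergent_const) simp
    thus ?case by simp
  qed
qed

text \<open>The limit is taken pointwise by \<open>lim\<close>, with one unspecified value on the
  null set of divergence. Such a limit is measurable for every sigma-algebra that measures all
  \<open>X n\<close>; this is what later preserves adaptedness and progressive measurability.
  Fatou's lemma gives the error bound.\<close>

lemma L2_geometric_lim:
  assumes X: "\<And>n. square_integrable M (X n)"
    and le: "\<And>n. dist2 M (X (Suc n)) (X n) \<le> C * q ^ n" and q: "0 \<le> q" "q < 1"
  shows "square_integrable M (\<lambda>\<omega>. lim (\<lambda>n. X n \<omega>))"
    "norm2 M (\<lambda>\<omega>. X n \<omega> - lim (\<lambda>n. X n \<omega>)) \<le> C * q ^ n / (1 - q)"
proof -
  have C: "C \<ge> 0" using order_trans[OF norm2_nonneg le[of 0]] by simp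
  note [measurable] = square_integrable_measurable[OF X]
  let ?L = "\<lambda>\<omega>. lim (\<lambda>n. X n \<omega>)"
  have [measurable]: "?L \<in> borel_measurable M" by (rule borel_measurable_lim_metric) measurable
  \<comment> \<open>Keeping the difference of the two powers lets the induction on \<open>k\<close>
    close; discarding \<open>q ^ (n + k)\<close> afterwards makes the bound uniform in
    \<open>k\<close>.\<close>
  have step: "dist2 M (X n) (X (n + k)) \<le> C * (q ^ n - q ^ (n + k)) / (1 - q)" for n k
  proof (induction k)
    case (Suc k)
    have "dist2 M (X n) (X (n + Suc k)) \<le>
        dist2 M (X n) (X (n + k)) + dist2 M (X (n + k)) (X (n + Suc k))"
      by (intro norm2_diff_triangle X)
    also have "\<dots> \<le> C * (q ^ n - q ^ (n + k)) / (1 - q) + C * q ^ (n + k)"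
      using Suc le[of "n + k"] norm2_minus_commute[of M "X (n+k)" "X (n + Suc k)"] by simp
    also have "\<dots> = C * (q ^ n - q ^ (n + Suc k)) / (1 - q)"
      using q by (simp add: field_simps)
    finally show ?case .
  qed simp
  have bound: "nl2d M (X n) ?L \<le> ennreal ((C * q ^ n / (1 - q))\<^sup>2)" for n
  proof -
    have "nl2d M (X n) ?L = (\<integral>\<^sup>+\<omega>. liminf (\<lambda>k. ennreal ((norm (X n \<omega> - X (n + k) \<omega>))\<^sup>2)) \<partial>M)"
      unfolding nl2_def
    proof (rule nn_integral_cong_AE)
      show "AE \<omega> in M. ennreal ((norm (X n \<omega> - ?L \<omega>))\<^sup>2) = liminf (\<lambda>k. ennreal ((norm (X n \<omega> - X (n + k) \<omega>))\<^sup>2))"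
        using L2_geometric_AE_convergent[OF X le q]
      proof eventually_elim
        case (elim \<omega>)
        hence "(\<lambda>k. X k \<omega>) \<longlonglongrightarrow> ?L \<omega>" by (simp add: convergent_LIMSEQ_iff)
        hence "(\<lambda>k. X (k + n) \<omega>) \<longlonglongrightarrow> ?L \<omega>" by (rule LIMSEQ_ignore_initial_segment)
        hence "(\<lambda>k. ennreal ((norm (X n \<omega> - X (n + k) \<omega>))\<^sup>2)) \<longlonglongrightarrow> ennreal ((norm (X n \<omega> - ?L \<omega>))\<^sup>2)"
          by (intro tendsto_intros) (simp add: add.commute)
        thus ?case by (intro lim_imp_Liminf[symmetric]) auto
      qed
    qed
    also have "\<dots> \<le> liminf (\<lambda>k. nl2d M (X n) (X (n + k)))"
      unfolding nl2_def by (rule nn_integral_liminf) measurable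
    also have "\<dots> \<le> liminf (\<lambda>k. ennreal ((C * q ^ n / (1 - q))\<^sup>2))"
    proof (intro Liminf_mono always_eventually allI)
      fix k
      have "dist2 M (X n) (X (n + k)) \<le> C * q ^ n / (1 - q)"
        using step[of n k] C q
        by (elim order_trans) (intro divide_right_mono mult_left_mono, auto)
      thus "nl2d M (X n) (X (n + k)) \<le> ennreal ((C * q ^ n / (1 - q))\<^sup>2)"
        by (subst nl2_eq_norm2) (auto intro!: square_integrable_diff X ennreal_leI power_mono)
    qed
    also have "\<dots> = ennreal ((C * q ^ n / (1 - q))\<^sup>2)"
      by (intro lim_imp_Liminf) auto
    finally show ?thesis .
  qed
  have nn: "C * q ^ n / (1 - q) \<ge> 0" for n using C q by simp
  have "square_integrable M (\<lambda>\<omega>. X 0 \<omega> - ?L \<omega>)"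
    using bound[of 0] nn[of 0] by (intro nl2_le_imp_norm2_le(1)[of _ _ "C * q ^ 0 / (1 - q)"]) auto
  from square_integrable_diff[OF X[of 0] this] show "square_integrable M ?L" by simp
  show "dist2 M (X n) ?L \<le> C * q ^ n / (1 - q)"
    using bound[of n] nn[of n] by (intro nl2_le_imp_norm2_le(2)) auto
qed

text \<open>The pointwise limit exists almost surely and is at the same time the mean-square limit,
  hence agrees with \<open>Y\<close>.\<close>

lemma L2_geometric_AE_limit:
  assumes X: "\<And>n. square_integrable M (X n)" "square_integrable M Y"
    and le: "\<And>n. dist2 M (X n) Y \<le> C * q ^ n" and q: "0 \<le> q" "q < 1"
  shows "AE \<omega> in M. (\<lambda>n. X n \<omega>) \<longlonglongrightarrow> Y \<omega>"
proof -
  have C: "C \<ge> 0" using order_trans[OF norm2_nonneg le[of 0]] by simp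
  let ?L = "\<lambda>\<omega>. lim (\<lambda>n. X n \<omega>)"
  have le2: "dist2 M (X (Suc n)) (X n) \<le> (2 * C) * q ^ n" for n
  proof -
    have "dist2 M (X (Suc n)) (X n) \<le> C * q ^ Suc n + C * q ^ n"
      using norm2_diff_triangle[OF X(1)[of "Suc n"] X(2) X(1)[of n]] le[of n] le[of "Suc n"]
        norm2_minus_commute[of M "X n" Y] by simp
    moreover have "C * q ^ Suc n \<le> C * q ^ n"
      using C q by (intro mult_left_mono power_decreasing) auto
    ultimately show ?thesis by simp
  qed
  note L = L2_geometric_lim[OF X(1) le2 q]
  have "dist2 M ?L Y \<le> 0"
  proof (rule tendsto_lowerbound[OF _ always_eventually sequentially_bot])
    show "(\<lambda>n. (2 * C) * q ^ n / (1 - q) + C * q ^ n) \<longlonglongrightarrow> 0"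
      using q by (auto intro!: tendsto_eq_intros LIMSEQ_realpow_zero)
    show "\<forall>n. dist2 M ?L Y \<le> (2 * C) * q ^ n / (1 - q) + C * q ^ n"
    proof
      fix n
      show "dist2 M ?L Y \<le> (2 * C) * q ^ n / (1 - q) + C * q ^ n"
        using norm2_diff_triangle[OF L(1) X(1)[of n] X(2)] L(2)[of n] le[of n]
          norm2_minus_commute[of M "?L" "X n"] by simp
    qed
  qed
  hence "AE \<omega> in M. ?L \<omega> = Y \<omega>"
    using L(1) X(2) by (intro norm2_eq_0_imp_AE square_integrable_diff) (auto intro: antisym)
  moreover have "AE \<omega> in M. convergent (\<lambda>n. X n \<omega>)"
    by (rule L2_geometric_AE_convergent[OF X(1) le2 q])
  ultimately show ?thesis
    by eventually_elim (simp add: convergent_LIMSEQ_iff)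
qed

end

section \<open>The Ito isometry\<close>

text \<open>Cutting off by an indicator moves from a restricted time axis to the full product with
  \<open>lborel\<close>, where Fubini's theorem and the product measurability rules apply.\<close>

lemma measurable_process_on_iff:
  fixes x :: "real \<Rightarrow> 'w \<Rightarrow> 'h::real_normed_vector"
  shows "measurable_process_on M a b x \<longleftrightarrow>
    (\<lambda>(s, \<omega>). indicator {a..b} s *\<^sub>R x s \<omega>) \<in> borel_measurable (lborel \<Otimes>\<^sub>M M)"
proof
  assume "measurable_process_on M a b x"
  hence x: "(\<lambda>(s, \<omega>). x s \<omega>) \<in> borel_measurable (restrict_space lborel {a..b} \<Otimes>\<^sub>M M)"
    by (simp add: measurable_process_on_def)
  let ?X = "{a..b} \<times> space M"
  have X: "?X \<inter> space (lborel \<Otimes>\<^sub>M M) \<in> sets (lborel \<Otimes>\<^sub>M M)"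
    by (intro sets.Int pair_measureI sets.top) auto
  have "(\<lambda>p. p) \<in> measurable (restrict_space (lborel \<Otimes>\<^sub>M M) ?X) (restrict_space lborel {a..b} \<Otimes>\<^sub>M M)"
  proof (rule measurable_pair)
    show "fst \<circ> (\<lambda>p. p) \<in> measurable (restrict_space (lborel \<Otimes>\<^sub>M M) ?X) (restrict_space lborel {a..b})"
      unfolding comp_def
      by (intro measurable_restrict_space2 measurable_restrict_space1 measurable_fst)
         (auto simp: space_restrict_space)
    show "snd \<circ> (\<lambda>p. p) \<in> measurable (restrict_space (lborel \<Otimes>\<^sub>M M) ?X) M"
      unfolding comp_def by (intro measurable_restrict_space1 measurable_snd)
  qed
  from measurable_compose[OF this x]
  have "(\<lambda>(s, \<omega>). x s \<omega>) \<in> borel_measurable (restrict_space (lborel \<Otimes>\<^sub>M M) ?X)" .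
  hence "(\<lambda>p. indicator ?X p *\<^sub>R (case p of (s, \<omega>) \<Rightarrow> x s \<omega>)) \<in> borel_measurable (lborel \<Otimes>\<^sub>M M)"
    by (subst (asm) borel_measurable_restrict_space_iff[OF X])
  thus "(\<lambda>(s, \<omega>). indicator {a..b} s *\<^sub>R x s \<omega>) \<in> borel_measurable (lborel \<Otimes>\<^sub>M M)"
    by (rule measurable_cong[THEN iffD1, rotated]) (auto simp: space_pair_measure indicator_def)
next
  assume x: "(\<lambda>(s, \<omega>). indicator {a..b} s *\<^sub>R x s \<omega>) \<in> borel_measurable (lborel \<Otimes>\<^sub>M M)"
  have "(\<lambda>p. p) \<in> measurable (restrict_space lborel {a..b} \<Otimes>\<^sub>M M) (lborel \<Otimes>\<^sub>M M)"
    by (rule measurable_pair) (auto simp: comp_def intro!: measurable_compose[OF measurable_fst] measurable_restrict_space1)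
  from measurable_compose[OF this x]
  have "(\<lambda>(s, \<omega>). indicator {a..b} s *\<^sub>R x s \<omega>) \<in> borel_measurable (restrict_space lborel {a..b} \<Otimes>\<^sub>M M)" .
  thus "measurable_process_on M a b x"
    unfolding measurable_process_on_def
    by (rule measurable_cong[THEN iffD1, rotated]) (auto simp: space_pair_measure space_restrict_space)
qed

section \<open>Covariances of weighted increments, step processes and their closure\<close>

context brownian_motion
begin

lemma square_integrable_increment_scaleR:
  assumes "a \<le> b" "\<xi> \<in> borel_measurable (Filt a)" "square_integrable M \<xi>"
  shows "square_integrable M (\<lambda>\<omega>. (W b \<omega> - W a \<omega>) *\<^sub>R \<xi> \<omega>)"
proof -
  have "integrable M (\<lambda>\<omega>. (norm (\<xi> \<omega>))\<^sup>2 * (W b \<omega> - W a \<omega>)\<^sup>2)"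
    using assms by (intro expectation_mult_increment(3)) (auto simp: square_integrable_def)
  moreover have [measurable]: "\<xi> \<in> borel_measurable M"
    using assms(3) by (rule square_integrable_measurable)
  ultimately show ?thesis
    by (simp add: square_integrable_def power_mult_distrib mult.commute)
qed

text \<open>Since a \<le> c, everything that happens up to \<open>c\<close> is
  \<open>Filt c\<close>-measurable. If the intervals overlap, they share (c, m] with m = min b d.
  The square of the increment over this piece contributes its length; every other product contains
  an increment that comes after all remaining factors and has mean zero.\<close>

lemma expectation_inner_increments_aux:
  assumes "a \<le> b" "c \<le> d" "a \<le> c"
    and \<xi>: "\<xi> \<in> borel_measurable (Filt a)" "square_integrable M \<xi>"
    and \<eta>: "\<eta> \<in> borel_measurable (Filt c)" "square_integrable M \<eta>"
  shows "(\<integral>\<omega>. ((W b \<omega> - W a \<omega>) *\<^sub>R \<xi> \<omega>) \<bullet> ((W d \<omega> - W c \<omega>) *\<^sub>R \<eta> \<omega>) \<partial>M) =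
    max 0 (min b d - max a c) * (\<integral>\<omega>. \<xi> \<omega> \<bullet> \<eta> \<omega> \<partial>M)"
proof -
  have \<xi>c: "\<xi> \<in> borel_measurable (Filt c)" using measurable_Filt_mono[OF \<xi>(1) \<open>a \<le> c\<close>] .
  have past: "(\<integral>\<omega>. (((W e \<omega> - W a \<omega>) *\<^sub>R \<xi> \<omega>) \<bullet> \<eta> \<omega>) * (W d \<omega> - W c \<omega>) \<partial>M) = 0"
    "integrable M (\<lambda>\<omega>. (((W e \<omega> - W a \<omega>) *\<^sub>R \<xi> \<omega>) \<bullet> \<eta> \<omega>) * (W d \<omega> - W c \<omega>))"
    if "a \<le> e" "e \<le> c" for e
  proof -
    have Y: "(\<lambda>\<omega>. ((W e \<omega> - W a \<omega>) *\<^sub>R \<xi> \<omega>) \<bullet> \<eta> \<omega>) \<in> borel_measurable (Filt c)"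
      using measurable_increment_Filt[of e c a] \<xi>c \<eta>(1) that \<open>a \<le> c\<close>
      by (intro borel_measurable_inner borel_measurable_scaleR)
    have Yi: "integrable M (\<lambda>\<omega>. ((W e \<omega> - W a \<omega>) *\<^sub>R \<xi> \<omega>) \<bullet> \<eta> \<omega>)"
      using that \<xi> \<eta> by (intro integrable_inner square_integrable_increment_scaleR)
    show "(\<integral>\<omega>. (((W e \<omega> - W a \<omega>) *\<^sub>R \<xi> \<omega>) \<bullet> \<eta> \<omega>) * (W d \<omega> - W c \<omega>) \<partial>M) = 0"
      "integrable M (\<lambda>\<omega>. (((W e \<omega> - W a \<omega>) *\<^sub>R \<xi> \<omega>) \<bullet> \<eta> \<omega>) * (W d \<omega> - W c \<omega>))"
      using expectation_mult_increment(1,2)[OF \<open>c \<le> d\<close> Y Yi] by auto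
  qed
  show ?thesis
  proof (cases "b \<le> c")
    case True
    thus ?thesis using past(1)[of b] assms(1-3) by (simp add: mult_ac max_def)
  next
    case False
    define m where "m = min b d"
    have m: "c \<le> m" "m \<le> b" "m \<le> d" "m = b \<or> m = d" using False assms(2) by (auto simp: m_def)
    define Z where "Z \<omega> = \<xi> \<omega> \<bullet> \<eta> \<omega>" for \<omega>
    have Z: "Z \<in> borel_measurable (Filt c)" "integrable M Z"
      unfolding Z_def using \<xi>c \<eta> \<xi>(2) by (auto intro: borel_measurable_inner integrable_inner)
    have Zm: "(\<lambda>\<omega>. Z \<omega> * (W m \<omega> - W c \<omega>)) \<in> borel_measurable (Filt m)"
      "integrable M (\<lambda>\<omega>. Z \<omega> * (W m \<omega> - W c \<omega>))"
      using measurable_Filt_mono[OF Z(1) m(1)] measurable_increment_Filt[of m m c] m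
        expectation_mult_increment(1)[OF m(1) Z] by auto
    note i1 = past[OF \<open>a \<le> c\<close> order.refl]
    note i2 = expectation_mult_increment(3,4)[OF m(1) Z]
    note i3 = expectation_mult_increment(1,2)[OF m(2) Zm]
    note i4 = expectation_mult_increment(1,2)[OF m(3) Zm]
    \<comment> \<open>The first increment is split at \<open>c\<close> and \<open>m\<close>, the
      second at \<open>m\<close>. The product of the increments beyond \<open>m\<close> is missing
      because \<open>m\<close> equals \<open>b\<close> or \<open>d\<close>.\<close>
    have "((W b \<omega> - W a \<omega>) *\<^sub>R \<xi> \<omega>) \<bullet> ((W d \<omega> - W c \<omega>) *\<^sub>R \<eta> \<omega>) =
      (((W c \<omega> - W a \<omega>) *\<^sub>R \<xi> \<omega>) \<bullet> \<eta> \<omega>) * (W d \<omega> - W c \<omega>) + Z \<omega> * (W m \<omega> - W c \<omega>)\<^sup>2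
      + Z \<omega> * (W m \<omega> - W c \<omega>) * (W b \<omega> - W m \<omega>) + Z \<omega> * (W m \<omega> - W c \<omega>) * (W d \<omega> - W m \<omega>)" for \<omega>
      using m(4) by (auto simp: Z_def power2_eq_square algebra_simps)
    hence "(\<integral>\<omega>. ((W b \<omega> - W a \<omega>) *\<^sub>R \<xi> \<omega>) \<bullet> ((W d \<omega> - W c \<omega>) *\<^sub>R \<eta> \<omega>) \<partial>M) = (m - c) * (\<integral>\<omega>. Z \<omega> \<partial>M)"
      using i1 i2 i3 i4 by (simp add: Bochner_Integration.integral_add Bochner_Integration.integrable_add)
    thus ?thesis using m False assms(3) by (simp add: Z_def m_def max_def)
  qed
qed

lemma expectation_inner_increments:
  assumes "a \<le> b" "c \<le> d"
    and \<xi>: "\<xi> \<in> borel_measurable (Filt a)" "square_integrable M \<xi>"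
    and \<eta>: "\<eta> \<in> borel_measurable (Filt c)" "square_integrable M \<eta>"
  shows "(\<integral>\<omega>. ((W b \<omega> - W a \<omega>) *\<^sub>R \<xi> \<omega>) \<bullet> ((W d \<omega> - W c \<omega>) *\<^sub>R \<eta> \<omega>) \<partial>M) =
    max 0 (min b d - max a c) * (\<integral>\<omega>. \<xi> \<omega> \<bullet> \<eta> \<omega> \<partial>M)"
proof (cases "a \<le> c")
  case True
  thus ?thesis using assms by (intro expectation_inner_increments_aux)
next
  case False
  thus ?thesis
    using expectation_inner_increments_aux[OF assms(2,1) _ \<eta> \<xi>]
    by (simp add: inner_commute min.commute max.commute mult_ac)
qed

text \<open>Unlike simple processes with their partitions, sums of arbitrary, possibly overlapping steps are
  closed under subtraction without passing to a common refinement.\<close>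

inductive elem_pair ::
  "(real \<times> 'w \<Rightarrow> 'h::{real_inner, banach, second_countable_topology}) \<Rightarrow> ('w \<Rightarrow> 'h) \<Rightarrow> bool" where
  zero: "elem_pair (\<lambda>_. 0) (\<lambda>_. 0)"
| step: "elem_pair S J \<Longrightarrow> a \<le> b \<Longrightarrow> \<xi> \<in> borel_measurable (Filt a) \<Longrightarrow> square_integrable M \<xi> \<Longrightarrow>
    elem_pair (\<lambda>p. S p + indicator {a<..b} (fst p) *\<^sub>R \<xi> (snd p)) (\<lambda>\<omega>. J \<omega> + (W b \<omega> - W a \<omega>) *\<^sub>R \<xi> \<omega>)"

lemma elem_pair_add:
  assumes "elem_pair S J" "elem_pair S' J'"
  shows "elem_pair (\<lambda>p. S p + S' p) (\<lambda>\<omega>. J \<omega> + J' \<omega>)"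
  using assms(2)
proof induction
  case zero
  thus ?case using assms(1) by simp
next
  case (step S' J' a b \<xi>)
  thus ?case using elem_pair.step[OF step.IH, of a b \<xi>] by (simp add: add.assoc)
qed

text \<open>A linear map acts on each step separately. Taking \<open>- id_blinfun\<close> gives
  subtraction; taking U(t - r) is what restarting the equation at time r requires.\<close>

lemma elem_pair_blinfun:
  assumes "elem_pair S J"
  shows "elem_pair (\<lambda>p. blinfun_apply T (S p)) (\<lambda>\<omega>. blinfun_apply T (J \<omega>))"
  using assms
proof induction
  case zero
  thus ?case by (simp add: elem_pair.zero)
next
  case (step S J a b \<xi>)
  thus ?case
    using elem_pair.step[OF step.IH, of a b "\<lambda>\<omega>. blinfun_apply T (\<xi> \<omega>)"]
    by (simp add: blinfun.bilinear_simps square_integrable_blinfun)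
qed

lemma elem_pair_minus: "elem_pair S J \<Longrightarrow> elem_pair (\<lambda>p. - S p) (\<lambda>\<omega>. - J \<omega>)"
  using elem_pair_blinfun[of S J "- id_blinfun"] by (simp add: blinfun.bilinear_simps)

lemma elem_pair_diff:
  assumes "elem_pair S J" "elem_pair S' J'"
  shows "elem_pair (\<lambda>p. S p - S' p) (\<lambda>\<omega>. J \<omega> - J' \<omega>)"
  using elem_pair_add[OF assms(1) elem_pair_minus[OF assms(2)]] by simp

lemma elem_pair_measurable:
  assumes "elem_pair S J"
  shows "S \<in> borel_measurable (lborel \<Otimes>\<^sub>M M)" "J \<in> borel_measurable M"
  using assms
proof induction
  case (step S J a b \<xi>)
  note [measurable] = step.IH measurable_Filt_imp[OF step.hyps(3)]
  { case 1 show ?case by measurable }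
  { case 2 show ?case by measurable }
qed auto

lemma elem_pair_square_integrable:
  assumes "elem_pair S J"
  shows "square_integrable M (\<lambda>\<omega>. S (s, \<omega>))" "square_integrable M J"
  using assms
proof induction
  case (step S J a b \<xi>)
  { case 1 show ?case using step by (auto intro: square_integrable_add square_integrable_scaleR) }
  { case 2 show ?case using step by (auto intro: square_integrable_add square_integrable_increment_scaleR) }
qed auto

lemma integral_indicator_Int:
  fixes a b c d :: real
  shows "integrable lborel (\<lambda>s. indicator {a<..b} s * (indicator {c<..d} s * z) :: real)"
    "(\<integral>s. indicator {a<..b} s * (indicator {c<..d} s * z) \<partial>lborel) = max 0 (min b d - max a c) * (z::real)"
proof -
  have *: "indicator {a<..b} s * (indicator {c<..d} s * z) = indicator {max a c<..min b d} s *\<^sub>R z" for s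
    by (auto simp: indicator_def)
  have e: "emeasure lborel {max a c<..min b d} < \<infinity>"
    by (cases "max a c \<le> min b d") auto
  show "integrable lborel (\<lambda>s. indicator {a<..b} s * (indicator {c<..d} s * z) :: real)"
    unfolding * using e by (intro integrable_scaleR_left impI) auto
  have "(\<integral>s. indicator {max a c<..min b d} s *\<^sub>R z \<partial>lborel) = measure lborel {max a c<..min b d} * z"
    using e by (subst integral_scaleR_left) auto
  also have "measure lborel {max a c<..min b d} = max 0 (min b d - max a c)"
    by (cases "max a c \<le> min b d") auto
  finally show "(\<integral>s. indicator {a<..b} s * (indicator {c<..d} s * z) \<partial>lborel) = max 0 (min b d - max a c) * z"
    unfolding * .
qed

text \<open>Testing against a single step is linear in \<open>S\<close>, so induction reduces to the
  covariance of two steps. This supplies the mixed term when the isometry is extended by one step.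
  Integrability in time is carried along to make the outer integral additive.\<close>

lemma elem_pair_cross:
  assumes "elem_pair S J" and st: "c \<le> d" "\<eta> \<in> borel_measurable (Filt c)" "square_integrable M \<eta>"
  shows "integrable lborel (\<lambda>s. \<integral>\<omega>. S (s, \<omega>) \<bullet> (indicator {c<..d} s *\<^sub>R \<eta> \<omega>) \<partial>M) \<and>
    (\<integral>\<omega>. J \<omega> \<bullet> ((W d \<omega> - W c \<omega>) *\<^sub>R \<eta> \<omega>) \<partial>M) =
    (\<integral>s. (\<integral>\<omega>. S (s, \<omega>) \<bullet> (indicator {c<..d} s *\<^sub>R \<eta> \<omega>) \<partial>M) \<partial>lborel)"
  using assms(1)
proof induction
  case (step S J a b \<xi>)
  note sq = elem_pair_square_integrable[OF step.hyps(1)]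
  have st': "square_integrable M (\<lambda>\<omega>. (W d \<omega> - W c \<omega>) *\<^sub>R \<eta> \<omega>)"
    "square_integrable M (\<lambda>\<omega>. (W b \<omega> - W a \<omega>) *\<^sub>R \<xi> \<omega>)"
    using st step.hyps by (auto intro: square_integrable_increment_scaleR)
  have eq: "(\<integral>\<omega>. (S (s, \<omega>) + indicator {a<..b} s *\<^sub>R \<xi> \<omega>) \<bullet> (indicator {c<..d} s *\<^sub>R \<eta> \<omega>) \<partial>M) =
     (\<integral>\<omega>. S (s, \<omega>) \<bullet> (indicator {c<..d} s *\<^sub>R \<eta> \<omega>) \<partial>M) +
     indicator {a<..b} s * (indicator {c<..d} s * (\<integral>\<omega>. \<xi> \<omega> \<bullet> \<eta> \<omega> \<partial>M))" for s
  proof -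
    have "(\<integral>\<omega>. (S (s, \<omega>) + indicator {a<..b} s *\<^sub>R \<xi> \<omega>) \<bullet> (indicator {c<..d} s *\<^sub>R \<eta> \<omega>) \<partial>M) =
      (\<integral>\<omega>. S (s, \<omega>) \<bullet> (indicator {c<..d} s *\<^sub>R \<eta> \<omega>) \<partial>M) +
      (\<integral>\<omega>. (indicator {a<..b} s *\<^sub>R \<xi> \<omega>) \<bullet> (indicator {c<..d} s *\<^sub>R \<eta> \<omega>) \<partial>M)"
      unfolding inner_add_left
      by (intro Bochner_Integration.integral_add integrable_inner square_integrable_scaleR sq step st)
    thus ?thesis by (simp add: mult.left_commute)
  qed
  have eq': "(\<integral>\<omega>. (J \<omega> + (W b \<omega> - W a \<omega>) *\<^sub>R \<xi> \<omega>) \<bullet> ((W d \<omega> - W c \<omega>) *\<^sub>R \<eta> \<omega>) \<partial>M) =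
     (\<integral>\<omega>. J \<omega> \<bullet> ((W d \<omega> - W c \<omega>) *\<^sub>R \<eta> \<omega>) \<partial>M) + max 0 (min b d - max a c) * (\<integral>\<omega>. \<xi> \<omega> \<bullet> \<eta> \<omega> \<partial>M)"
    unfolding inner_add_left expectation_inner_increments[OF step.hyps(2) st(1) step.hyps(3,4) st(2,3), symmetric]
    by (intro Bochner_Integration.integral_add integrable_inner sq st')
  show ?case
    unfolding fst_conv snd_conv eq eq' using step.IH integral_indicator_Int by simp
qed simp

lemma elem_pair_isometry_real:
  fixes S :: "real \<times> 'w \<Rightarrow> 'h::{real_inner, banach, second_countable_topology}"
  assumes "elem_pair S J"
  shows "integrable lborel (\<lambda>s. \<integral>\<omega>. (norm (S (s, \<omega>)))\<^sup>2 \<partial>M) \<and>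
    (\<integral>\<omega>. (norm (J \<omega>))\<^sup>2 \<partial>M) = (\<integral>s. (\<integral>\<omega>. (norm (S (s, \<omega>)))\<^sup>2 \<partial>M) \<partial>lborel)"
  using assms
proof induction
  case (step S J a b \<xi>)
  note sq = elem_pair_square_integrable[OF step.hyps(1)]
  have st': "square_integrable M (\<lambda>\<omega>. (W b \<omega> - W a \<omega>) *\<^sub>R \<xi> \<omega>)"
    using step.hyps by (auto intro: square_integrable_increment_scaleR)
  have expand: "(\<integral>\<omega>. (norm (x \<omega> + y \<omega>))\<^sup>2 \<partial>M) =
     (\<integral>\<omega>. (norm (x \<omega>))\<^sup>2 \<partial>M) + 2 * (\<integral>\<omega>. x \<omega> \<bullet> y \<omega> \<partial>M) + (\<integral>\<omega>. y \<omega> \<bullet> y \<omega> \<partial>M)"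
    if xy: "square_integrable M x" "square_integrable M y" for x y :: "'w \<Rightarrow> 'h"
  proof -
    have *: "(norm (x \<omega> + y \<omega>))\<^sup>2 = (norm (x \<omega>))\<^sup>2 + 2 * (x \<omega> \<bullet> y \<omega>) + y \<omega> \<bullet> y \<omega>" for \<omega>
      by (simp add: power2_norm_eq_inner inner_add inner_commute)
    show ?thesis
      unfolding * using xy integrable_inner[OF xy] integrable_inner[OF xy(2,2)]
      by (simp add: square_integrable_def)
  qed
  have s1: "(\<integral>\<omega>. (norm (S (s, \<omega>) + indicator {a<..b} s *\<^sub>R \<xi> \<omega>))\<^sup>2 \<partial>M) =
     (\<integral>\<omega>. (norm (S (s, \<omega>)))\<^sup>2 \<partial>M) + 2 * (\<integral>\<omega>. S (s, \<omega>) \<bullet> (indicator {a<..b} s *\<^sub>R \<xi> \<omega>) \<partial>M)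
       + indicator {a<..b} s * (indicator {a<..b} s * (\<integral>\<omega>. \<xi> \<omega> \<bullet> \<xi> \<omega> \<partial>M))" for s
    by (subst expand) (auto intro!: sq square_integrable_scaleR step)
  have s2: "(\<integral>\<omega>. (norm (J \<omega> + (W b \<omega> - W a \<omega>) *\<^sub>R \<xi> \<omega>))\<^sup>2 \<partial>M) =
     (\<integral>\<omega>. (norm (J \<omega>))\<^sup>2 \<partial>M) + 2 * (\<integral>\<omega>. J \<omega> \<bullet> ((W b \<omega> - W a \<omega>) *\<^sub>R \<xi> \<omega>) \<partial>M)
       + max 0 (min b b - max a a) * (\<integral>\<omega>. \<xi> \<omega> \<bullet> \<xi> \<omega> \<partial>M)"
    unfolding expand[OF sq(2) st']
      expectation_inner_increments[OF step.hyps(2,2) step.hyps(3,4) step.hyps(3,4)] ..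
  show ?case
    unfolding fst_conv snd_conv s1 s2
    using step.IH elem_pair_cross[OF step.hyps] integral_indicator_Int[of a b a b] by simp
qed simp

lemma elem_pair_isometry:
  assumes "elem_pair S J"
  shows "nl2 M J = nl2 (lborel \<Otimes>\<^sub>M M) S"
proof -
  note [measurable] = elem_pair_measurable[OF assms]
  note sq = elem_pair_square_integrable[OF assms]
  note iso = elem_pair_isometry_real[OF assms]
  have "nl2 (lborel \<Otimes>\<^sub>M M) S = (\<integral>\<^sup>+s. (\<integral>\<^sup>+\<omega>. ennreal ((norm (S (s, \<omega>)))\<^sup>2) \<partial>M) \<partial>lborel)"
    unfolding nl2_def by (rule nn_integral_fst[symmetric]) measurable
  also have "\<dots> = (\<integral>\<^sup>+s. ennreal (\<integral>\<omega>. (norm (S (s, \<omega>)))\<^sup>2 \<partial>M) \<partial>lborel)"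
    by (intro nn_integral_cong nn_integral_eq_integral) (use sq in \<open>auto simp: square_integrable_def\<close>)
  also have "\<dots> = ennreal (\<integral>\<omega>. (norm (J \<omega>))\<^sup>2 \<partial>M)"
    using iso by (subst nn_integral_eq_integral) (auto intro: integral_nonneg_AE)
  also have "\<dots> = nl2 M J"
    using sq(2) by (simp add: nl2_eq_norm2 norm2_sq)
  finally show ?thesis ..
qed

text \<open>The closure of the step pairs, with time running over the whole real line; an interval
  is encoded by cutting off the integrand. Whereas \<open>has_ito_integral\<close> ties its
  approximations to partitions of one interval, this relation is linear at once, and integrals over
  different intervals can be subtracted.\<close>

definition ito_lim ::
  "(real \<times> 'w \<Rightarrow> 'h::{real_inner, banach, second_countable_topology}) \<Rightarrow> ('w \<Rightarrow> 'h) \<Rightarrow> bool" where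
  "ito_lim f I \<longleftrightarrow> f \<in> borel_measurable (lborel \<Otimes>\<^sub>M M) \<and> I \<in> borel_measurable M \<and>
     (\<exists>S J. (\<forall>k::nat. elem_pair (S k) (J k)) \<and>
        (\<lambda>k. nl2 (lborel \<Otimes>\<^sub>M M) (\<lambda>p. S k p - f p)) \<longlonglongrightarrow> 0 \<and>
        (\<lambda>k. nl2d M (J k) I) \<longlonglongrightarrow> 0)"

lemma ito_lim_bound:
  assumes "ito_lim f I"
  shows "nl2 M I \<le> nl2 (lborel \<Otimes>\<^sub>M M) f"
proof -
  from assms obtain S J where *: "\<And>k::nat. elem_pair (S k) (J k)"
    "(\<lambda>k. nl2 (lborel \<Otimes>\<^sub>M M) (\<lambda>p. S k p - f p)) \<longlonglongrightarrow> 0" "(\<lambda>k. nl2d M (J k) I) \<longlonglongrightarrow> 0"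
    "f \<in> borel_measurable (lborel \<Otimes>\<^sub>M M)" "I \<in> borel_measurable M"
    by (auto simp: ito_lim_def)
  show ?thesis
    by (rule nl2_limit_le[OF elem_pair_measurable(1)[OF *(1)] *(4,2)
        elem_pair_measurable(2)[OF *(1)] *(5,3) eq_refl[OF elem_pair_isometry[OF *(1)]]])
qed

lemma nl2_diff_diff_tendsto_0:
  fixes f f' :: "'a \<Rightarrow> 'b::{real_normed_vector, second_countable_topology}"
  assumes "\<And>k. S k \<in> borel_measurable P" "\<And>k. S' k \<in> borel_measurable P"
    "f \<in> borel_measurable P" "f' \<in> borel_measurable P"
    and "(\<lambda>k. nl2 P (\<lambda>p. S k p - f p)) \<longlonglongrightarrow> 0" "(\<lambda>k. nl2 P (\<lambda>p. S' k p - f' p)) \<longlonglongrightarrow> 0"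
  shows "(\<lambda>k::nat. nl2 P (\<lambda>p. (S k p - S' k p) - (f p - f' p))) \<longlonglongrightarrow> 0"
proof (rule tendsto_sandwich[OF _ _ tendsto_const])
  show "\<forall>\<^sub>F k in sequentially. nl2 P (\<lambda>p. (S k p - S' k p) - (f p - f' p)) \<le>
      2 * nl2 P (\<lambda>p. S k p - f p) + 2 * nl2 P (\<lambda>p. S' k p - f' p)"
  proof (intro always_eventually allI)
    fix k
    have "nl2 P (\<lambda>p. (S k p - f p) + (f' p - S' k p)) \<le> 2 * nl2 P (\<lambda>p. S k p - f p) + 2 * nl2 P (\<lambda>p. f' p - S' k p)"
      using nl2_add_eps[of "\<lambda>p. S k p - f p" P "\<lambda>p. f' p - S' k p" 1] assms(1-4) by simp
    moreover have "(\<lambda>p. (S k p - S' k p) - (f p - f' p)) = (\<lambda>p. (S k p - f p) + (f' p - S' k p))" by auto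
    ultimately show "nl2 P (\<lambda>p. (S k p - S' k p) - (f p - f' p)) \<le>
      2 * nl2 P (\<lambda>p. S k p - f p) + 2 * nl2 P (\<lambda>p. S' k p - f' p)"
      by (simp add: nl2_minus_commute[of P f'])
  qed
  have "(\<lambda>k. 2 * nl2 P (\<lambda>p. S k p - f p) + 2 * nl2 P (\<lambda>p. S' k p - f' p)) \<longlonglongrightarrow> 2 * 0 + 2 * 0"
    using assms(5,6) by (intro tendsto_intros ennreal_tendsto_cmult) auto
  thus "(\<lambda>k. 2 * nl2 P (\<lambda>p. S k p - f p) + 2 * nl2 P (\<lambda>p. S' k p - f' p)) \<longlonglongrightarrow> 0" by simp
qed auto

lemma ito_lim_diff:
  assumes "ito_lim f I" "ito_lim f' I'"
  shows "ito_lim (\<lambda>p. f p - f' p) (\<lambda>\<omega>. I \<omega> - I' \<omega>)"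
proof -
  from assms(1) obtain S J where 1: "\<And>k::nat. elem_pair (S k) (J k)"
    "(\<lambda>k. nl2 (lborel \<Otimes>\<^sub>M M) (\<lambda>p. S k p - f p)) \<longlonglongrightarrow> 0" "(\<lambda>k. nl2d M (J k) I) \<longlonglongrightarrow> 0"
    "f \<in> borel_measurable (lborel \<Otimes>\<^sub>M M)" "I \<in> borel_measurable M"
    by (auto simp: ito_lim_def)
  from assms(2) obtain S' J' where 2: "\<And>k::nat. elem_pair (S' k) (J' k)"
    "(\<lambda>k. nl2 (lborel \<Otimes>\<^sub>M M) (\<lambda>p. S' k p - f' p)) \<longlonglongrightarrow> 0" "(\<lambda>k. nl2d M (J' k) I') \<longlonglongrightarrow> 0"
    "f' \<in> borel_measurable (lborel \<Otimes>\<^sub>M M)" "I' \<in> borel_measurable M"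
    by (auto simp: ito_lim_def)
  show ?thesis
    unfolding ito_lim_def
  proof (intro conjI exI allI)
    show "elem_pair (\<lambda>p. S k p - S' k p) (\<lambda>\<omega>. J k \<omega> - J' k \<omega>)" for k
      by (intro elem_pair_diff 1 2)
    show "(\<lambda>k. nl2 (lborel \<Otimes>\<^sub>M M) (\<lambda>p. (S k p - S' k p) - (f p - f' p))) \<longlonglongrightarrow> 0"
      using 1 2 elem_pair_measurable by (intro nl2_diff_diff_tendsto_0) blast+
    show "(\<lambda>k. nl2 M (\<lambda>\<omega>. (J k \<omega> - J' k \<omega>) - (I \<omega> - I' \<omega>))) \<longlonglongrightarrow> 0"
      using 1 2 elem_pair_measurable by (intro nl2_diff_diff_tendsto_0) blast+
  qed (use 1 2 in auto)
qed

lemma nl2_blinfun_tendsto_0: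
  assumes "\<And>k. S k \<in> borel_measurable P" "f \<in> borel_measurable P" "(\<lambda>k. nl2 P (\<lambda>p. S k p - f p)) \<longlonglongrightarrow> 0"
  shows "(\<lambda>k::nat. nl2 P (\<lambda>p. blinfun_apply T (S k p) - blinfun_apply T
     (f p :: 'b::{real_normed_vector, second_countable_topology}))) \<longlonglongrightarrow> 0"
proof (rule tendsto_sandwich[OF _ _ tendsto_const])
  show "\<forall>\<^sub>F k in sequentially. nl2 P (\<lambda>p. blinfun_apply T (S k p) - blinfun_apply T (f p))
      \<le> ennreal ((norm T)\<^sup>2) * nl2 P (\<lambda>p. S k p - f p)"
    using nl2_blinfun_le[of "\<lambda>p. S _ p - f p" P T] assms(1,2)
    by (intro always_eventually allI) (simp add: blinfun.diff_right)
  have "(\<lambda>k. ennreal ((norm T)\<^sup>2) * nl2 P (\<lambda>p. S k p - f p)) \<longlonglongrightarrow> ennreal ((norm T)\<^sup>2) * 0"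
    using assms(3) by (intro ennreal_tendsto_cmult) auto
  thus "(\<lambda>k. ennreal ((norm T)\<^sup>2) * nl2 P (\<lambda>p. S k p - f p)) \<longlonglongrightarrow> 0" by simp
qed auto

lemma ito_lim_blinfun:
  assumes "ito_lim f I"
  shows "ito_lim (\<lambda>p. blinfun_apply T (f p)) (\<lambda>\<omega>. blinfun_apply T (I \<omega>))"
proof -
  from assms(1) obtain S J where 1: "\<And>k::nat. elem_pair (S k) (J k)"
    "(\<lambda>k. nl2 (lborel \<Otimes>\<^sub>M M) (\<lambda>p. S k p - f p)) \<longlonglongrightarrow> 0" "(\<lambda>k. nl2d M (J k) I) \<longlonglongrightarrow> 0"
    "f \<in> borel_measurable (lborel \<Otimes>\<^sub>M M)" "I \<in> borel_measurable M"
    by (auto simp: ito_lim_def)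
  show ?thesis
    unfolding ito_lim_def
    by (intro conjI exI[of _ "\<lambda>k p. blinfun_apply T (S k p)"] exI[of _ "\<lambda>k \<omega>. blinfun_apply T (J k \<omega>)"] allI
        elem_pair_blinfun nl2_blinfun_tendsto_0 borel_measurable_blinfun_const)
       (use 1 elem_pair_measurable in blast)+
qed

text \<open>The difference is an integral of the zero integrand, hence vanishes by the bound.
  Identities between stochastic integrals thus reduce to identities between integrands.\<close>

lemma ito_lim_unique:
  assumes "ito_lim f I" "ito_lim f I'"
  shows "AE \<omega> in M. I \<omega> = I' \<omega>"
proof -
  have "nl2d M I I' = 0"
    using ito_lim_bound[OF ito_lim_diff[OF assms]] by simp
  thus ?thesis
    using assms by (subst (asm) nl2_eq_0_iff) (auto simp: ito_lim_def)
qed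

lemma simple_data_bounds:
  assumes "simple_data M W a b n p \<xi>" "i \<le> n"
  shows "a \<le> p i" "p i \<le> b"
proof -
  have le: "p j \<le> p k" if "j \<le> k" "k \<le> n" for j k
    using that
  proof (induction k rule: dec_induct)
    case (step k)
    thus ?case using assms(1) by (auto simp: simple_data_def intro: order_trans)
  qed simp
  show "a \<le> p i" "p i \<le> b"
    using le[of 0 i] le[of i n] assms by (auto simp: simple_data_def)
qed

lemma simple_data_elem_pair:
  assumes "simple_data M W a b n p \<xi>"
  shows "elem_pair (\<lambda>(s, \<omega>). simple_process n p \<xi> s \<omega>) (simple_integral W n p \<xi>)"
proof -
  have "elem_pair (\<lambda>(s, \<omega>). simple_process m p \<xi> s \<omega>) (simple_integral W m p \<xi>)" if "m \<le> n" for m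
    using that
  proof (induction m)
    case 0
    thus ?case by (simp add: simple_process_def simple_integral_def split_def elem_pair.zero)
  next
    case (Suc m)
    thus ?case
      using elem_pair.step[of _ _ "p m" "p (Suc m)" "\<xi> m"] assms
      by (auto simp: simple_process_def simple_integral_def split_def simple_data_def)
  qed
  thus ?thesis by simp
qed

lemma simple_process_outside:
  assumes "simple_data M W a b n p \<xi>" "s \<notin> {a<..b}"
  shows "simple_process n p \<xi> s \<omega> = 0"
  unfolding simple_process_def
proof (intro sum.neutral ballI)
  fix i assume "i \<in> {..<n}"
  hence "a \<le> p i" "p (Suc i) \<le> b"
    using simple_data_bounds[OF assms(1)] by auto
  thus "indicator {p i<..p (Suc i)} s *\<^sub>R \<xi> i \<omega> = 0" using assms(2) by (auto simp: indicator_def)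
qed

lemma measurable_process_on_indicator:
  fixes f :: "real \<Rightarrow> 'w \<Rightarrow> 'h::{real_normed_vector, second_countable_topology}"
  assumes "measurable_process_on N a b f"
  shows "(\<lambda>(s, \<omega>). indicator {a<..b} s *\<^sub>R f s \<omega>) \<in> borel_measurable (lborel \<Otimes>\<^sub>M N)"
proof -
  have [measurable]: "(\<lambda>(s, \<omega>). indicator {a..b} s *\<^sub>R f s \<omega>) \<in> borel_measurable (lborel \<Otimes>\<^sub>M N)"
    using assms by (simp add: measurable_process_on_iff)
  have "(\<lambda>p. indicator {a<..b} (fst p) *\<^sub>R (case p of (s, \<omega>) \<Rightarrow> indicator {a..b} s *\<^sub>R f s \<omega>))
      \<in> borel_measurable (lborel \<Otimes>\<^sub>M N)"
    by measurable
  also have "(\<lambda>p. indicator {a<..b} (fst p) *\<^sub>R (case p of (s, \<omega>) \<Rightarrow> indicator {a..b} s *\<^sub>R f s \<omega>)) =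
      (\<lambda>(s, \<omega>). indicator {a<..b} s *\<^sub>R f s \<omega>)"
    by (auto simp: indicator_def fun_eq_iff)
  finally show ?thesis .
qed

text \<open>Simple processes live on (a, b], so the integrand is cut off there. Outside (a, b] both
  vanish, and the error on the whole line is at most the error over the closed interval in the
  definition.\<close>

lemma has_ito_integral_imp_ito_lim:
  assumes "has_ito_integral M W a b f I"
  shows "ito_lim (\<lambda>(s, \<omega>). indicator {a<..b} s *\<^sub>R f s \<omega>) I"
proof -
  from assms obtain n p \<xi> where *: "\<And>k::nat. simple_data M W a b (n k) (p k) (\<xi> k)"
    "(\<lambda>k. \<integral>\<^sup>+s\<in>{a..b}. (\<integral>\<^sup>+\<omega>. ennreal ((norm (simple_process (n k) (p k) (\<xi> k) s \<omega> - f s \<omega>))\<^sup>2) \<partial>M) \<partial>lborel)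
          \<longlonglongrightarrow> 0"
    "(\<lambda>k. \<integral>\<^sup>+\<omega>. ennreal ((norm (simple_integral W (n k) (p k) (\<xi> k) \<omega> - I \<omega>))\<^sup>2) \<partial>M) \<longlonglongrightarrow> 0"
    by (auto simp: has_ito_integral_def)
  let ?f = "\<lambda>(s, \<omega>). indicator {a<..b} s *\<^sub>R f s \<omega>"
  let ?S = "\<lambda>k (s, \<omega>). simple_process (n k) (p k) (\<xi> k) s \<omega>"
  have meas [measurable]: "?f \<in> borel_measurable (lborel \<Otimes>\<^sub>M M)" "I \<in> borel_measurable M"
    using assms by (auto simp: has_ito_integral_def intro!: measurable_process_on_indicator)
  have el: "elem_pair (?S k) (simple_integral W (n k) (p k) (\<xi> k))" for k
    using *(1) by (rule simple_data_elem_pair)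
  note [measurable] = elem_pair_measurable(1)[OF el]
  have "(\<lambda>k. nl2 (lborel \<Otimes>\<^sub>M M) (\<lambda>q. ?S k q - ?f q)) \<longlonglongrightarrow> 0"
  proof (rule tendsto_sandwich[OF _ _ tendsto_const *(2)])
    show "\<forall>\<^sub>F k in sequentially. nl2 (lborel \<Otimes>\<^sub>M M) (\<lambda>q. ?S k q - ?f q) \<le>
       (\<integral>\<^sup>+s\<in>{a..b}. (\<integral>\<^sup>+\<omega>. ennreal ((norm (simple_process (n k) (p k) (\<xi> k) s \<omega> - f s \<omega>))\<^sup>2) \<partial>M) \<partial>lborel)"
    proof (intro always_eventually allI)
      fix k
      have "nl2 (lborel \<Otimes>\<^sub>M M) (\<lambda>q. ?S k q - ?f q) =
         (\<integral>\<^sup>+s. (\<integral>\<^sup>+\<omega>. ennreal ((norm (?S k (s, \<omega>) - ?f (s, \<omega>)))\<^sup>2) \<partial>M) \<partial>lborel)"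
        unfolding nl2_def by (rule nn_integral_fst[symmetric]) measurable
      also have "\<dots> \<le> (\<integral>\<^sup>+s\<in>{a..b}. (\<integral>\<^sup>+\<omega>. ennreal ((norm (simple_process (n k) (p k) (\<xi> k) s \<omega> - f s \<omega>))\<^sup>2) \<partial>M) \<partial>lborel)"
      proof (rule nn_integral_mono)
        fix s
        show "(\<integral>\<^sup>+\<omega>. ennreal ((norm (?S k (s, \<omega>) - ?f (s, \<omega>)))\<^sup>2) \<partial>M) \<le>
           (\<integral>\<^sup>+\<omega>. ennreal ((norm (simple_process (n k) (p k) (\<xi> k) s \<omega> - f s \<omega>))\<^sup>2) \<partial>M) * indicator {a..b} s"
          by (cases "s \<in> {a<..b}") (use simple_process_outside[OF *(1)] in auto)
      qed
      finally show "nl2 (lborel \<Otimes>\<^sub>M M) (\<lambda>q. ?S k q - ?f q) \<le>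
       (\<integral>\<^sup>+s\<in>{a..b}. (\<integral>\<^sup>+\<omega>. ennreal ((norm (simple_process (n k) (p k) (\<xi> k) s \<omega> - f s \<omega>))\<^sup>2) \<partial>M) \<partial>lborel)" .
    qed
  qed auto
  thus ?thesis
    unfolding ito_lim_def
    by (intro conjI meas exI[of _ ?S] exI[of _ "\<lambda>k. simple_integral W (n k) (p k) (\<xi> k)"] allI el)
       (use *(3) in \<open>simp_all add: nl2_def\<close>)
qed

end

section \<open>Mean-square continuous processes\<close>

text \<open>Continuity for the pseudometric \<open>dist2\<close> on representatives, relative to
  \<open>T\<close> so that an initial time is included as an end point.\<close>

definition l2cont :: "'w measure \<Rightarrow> real set \<Rightarrow> (real \<Rightarrow> 'w \<Rightarrow> 'h::{real_inner, banach, second_countable_topology}) \<Rightarrow> bool" where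
  "l2cont M T x \<longleftrightarrow> (\<forall>t\<in>T. \<forall>e>0. \<exists>d>0. \<forall>s\<in>T. \<bar>s - t\<bar> < d \<longrightarrow> dist2 M (x s) (x t) < e)"

lemma l2cont_subset: "l2cont M T x \<Longrightarrow> T' \<subseteq> T \<Longrightarrow> l2cont M T' x"
  unfolding l2cont_def by (meson subsetD)

lemma measurable_process_on_mono:
  assumes x: "measurable_process_on N a b x" and N: "sets N \<subseteq> sets N'" "space N = space N'"
    and ab: "a \<le> a'" "b' \<le> b"
  shows "measurable_process_on N' a' b' x"
proof -
  have "(\<lambda>p. p) \<in> measurable (restrict_space lborel {a'..b'} \<Otimes>\<^sub>M N') (restrict_space lborel {a..b} \<Otimes>\<^sub>M N)"
  proof (rule measurable_pair)
    have "(\<lambda>s. s) \<in> measurable (restrict_space lborel {a'..b'}) (restrict_space lborel {a..b})"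
      using ab by (intro measurable_restrict_space3) auto
    thus "fst \<circ> (\<lambda>p. p) \<in> measurable (restrict_space lborel {a'..b'} \<Otimes>\<^sub>M N') (restrict_space lborel {a..b})"
      unfolding comp_def by (rule measurable_compose[OF measurable_fst])
    have "(\<lambda>\<omega>. \<omega>) \<in> measurable N' N"
      using N by (intro measurableI) (auto dest: sets.sets_into_space)
    thus "snd \<circ> (\<lambda>p. p) \<in> measurable (restrict_space lborel {a'..b'} \<Otimes>\<^sub>M N') N"
      unfolding comp_def by (rule measurable_compose[OF measurable_snd])
  qed
  from measurable_compose[OF this x[unfolded measurable_process_on_def]]
  show ?thesis by (simp add: measurable_process_on_def)
qed

lemma measurable_process_on_section:
  assumes x: "measurable_process_on N a b x" and s: "s \<in> {a..b}"
  shows "x s \<in> borel_measurable N"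
proof -
  have "(\<lambda>\<omega>. (s, \<omega>)) \<in> measurable N (restrict_space lborel {a..b} \<Otimes>\<^sub>M N)"
    using s by (intro measurable_Pair1') (auto simp: space_restrict_space)
  from measurable_compose[OF this x[unfolded measurable_process_on_def]] show ?thesis by simp
qed

lemma measurable_process_on_compose:
  fixes x :: "real \<Rightarrow> 'w \<Rightarrow> 'h::{real_normed_vector, second_countable_topology}"
    and \<Phi> :: "real \<Rightarrow> 'h \<Rightarrow> 'g::topological_space"
  assumes x: "measurable_process_on N a b x"
    and \<Phi>: "continuous_on ({a..b} \<times> UNIV) (\<lambda>(s, y). \<Phi> s y)"
  shows "measurable_process_on N a b (\<lambda>s \<omega>. \<Phi> s (x s \<omega>))"
proof -
  let ?R = "restrict_space lborel {a..b} \<Otimes>\<^sub>M N"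
  have "fst \<in> measurable ?R borel"
    by (rule measurable_compose[OF measurable_fst]) (auto intro: measurable_restrict_space1)
  hence "(\<lambda>p. (fst p, (\<lambda>(s, \<omega>). x s \<omega>) p)) \<in> measurable ?R (borel \<Otimes>\<^sub>M borel)"
    using x unfolding measurable_process_on_def by (rule measurable_Pair)
  hence "(\<lambda>p. (fst p, (\<lambda>(s, \<omega>). x s \<omega>) p)) \<in> measurable ?R (restrict_space borel ({a..b} \<times> UNIV))"
    unfolding borel_prod
    by (intro measurable_restrict_space2) (auto simp: space_pair_measure space_restrict_space)
  from measurable_compose[OF this borel_measurable_continuous_on_restrict[OF \<Phi>]]
  show ?thesis by (simp add: measurable_process_on_def split_def)
qed

context prob_space
begin

text \<open>Otherwise some sequence of times tending to \<open>t\<close> would keep its distance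
  from \<open>Y t\<close> at least \<open>e\<close>, against dominated convergence with majorant 4
  R^2.\<close>

lemma l2_dominated_cont:
  fixes Y :: "real \<Rightarrow> 'a \<Rightarrow> 'h::{real_inner, banach, second_countable_topology}"
  assumes meas: "\<And>s. s \<in> T \<Longrightarrow> Y s \<in> borel_measurable M" and t: "t \<in> T"
    and cont: "\<And>\<omega>. \<omega> \<in> space M \<Longrightarrow> continuous (at t within T) (\<lambda>s. Y s \<omega>)"
    and bound: "\<And>s \<omega>. s \<in> T \<Longrightarrow> \<omega> \<in> space M \<Longrightarrow> norm (Y s \<omega>) \<le> R \<omega>"
    and R: "integrable M (\<lambda>\<omega>. (R \<omega>)\<^sup>2)" and e: "e > 0"
  shows "\<exists>d>0. \<forall>s\<in>T. \<bar>s - t\<bar> < d \<longrightarrow> dist2 M (Y s) (Y t) < e"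
proof (rule ccontr)
  assume "\<not> ?thesis"
  hence none: "\<And>d. d > 0 \<Longrightarrow> \<exists>s\<in>T. \<bar>s - t\<bar> < d \<and> \<not> dist2 M (Y s) (Y t) < e"
    by blast
  have "\<forall>k::nat. \<exists>s. s \<in> T \<and> \<bar>s - t\<bar> < 1 / (real k + 1) \<and> \<not> dist2 M (Y s) (Y t) < e"
  proof
    fix k :: nat
    have "1 / (real k + 1) > 0" by simp
    from none[OF this] show "\<exists>s. s \<in> T \<and> \<bar>s - t\<bar> < 1 / (real k + 1) \<and> \<not> dist2 M (Y s) (Y t) < e"
      by blast
  qed
  from choice[OF this] obtain s where s: "\<And>k. s k \<in> T" "\<And>k::nat. \<bar>s k - t\<bar> < 1 / (real k + 1)"
    "\<And>k. \<not> dist2 M (Y (s k)) (Y t) < e" by blast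
  have "(\<lambda>k. s k - t) \<longlonglongrightarrow> 0"
  proof (rule Lim_null_comparison)
    show "\<forall>\<^sub>F k in sequentially. norm (s k - t) \<le> 1 / (real k + 1)"
      using s(2) by (intro always_eventually allI) (auto intro: less_imp_le)
    show "(\<lambda>k. 1 / (real k + 1)) \<longlonglongrightarrow> 0" using LIMSEQ_inverse_real_of_nat
      by (simp add: inverse_eq_divide add.commute)
  qed
  hence lim: "s \<longlonglongrightarrow> t" by (rule LIM_zero_cancel)
  note [measurable] = meas[OF s(1)] meas[OF t]
  have "(\<lambda>k. \<integral>\<omega>. (norm (Y (s k) \<omega> - Y t \<omega>))\<^sup>2 \<partial>M) \<longlonglongrightarrow> (\<integral>\<omega>. 0 \<partial>M)"
  proof (rule integral_dominated_convergence[where w = "\<lambda>\<omega>. 4 * (R \<omega>)\<^sup>2"])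
    show "integrable M (\<lambda>\<omega>. 4 * (R \<omega>)\<^sup>2)" using R by simp
    show "AE \<omega> in M. (\<lambda>k. (norm (Y (s k) \<omega> - Y t \<omega>))\<^sup>2) \<longlonglongrightarrow> 0"
    proof (rule AE_I2)
      fix \<omega> assume "\<omega> \<in> space M"
      hence "(\<lambda>k. Y (s k) \<omega>) \<longlonglongrightarrow> Y t \<omega>"
        using s(1) lim by (intro continuous_within_tendsto_compose'[OF cont]) auto
      hence "(\<lambda>k. (norm (Y (s k) \<omega> - Y t \<omega>))\<^sup>2) \<longlonglongrightarrow> (norm (Y t \<omega> - Y t \<omega>))\<^sup>2"
        by (intro tendsto_intros)
      thus "(\<lambda>k. (norm (Y (s k) \<omega> - Y t \<omega>))\<^sup>2) \<longlonglongrightarrow> 0" by simp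
    qed
    show "AE \<omega> in M. norm ((norm (Y (s k) \<omega> - Y t \<omega>))\<^sup>2) \<le> 4 * (R \<omega>)\<^sup>2" for k
    proof (rule AE_I2)
      fix \<omega> assume \<omega>: "\<omega> \<in> space M"
      have "norm (Y (s k) \<omega> - Y t \<omega>) \<le> norm (Y (s k) \<omega>) + norm (Y t \<omega>)" by (rule norm_triangle_ineq4)
      also have "\<dots> \<le> 2 * R \<omega>" using bound[OF s(1)[of k] \<omega>] bound[OF t \<omega>] by simp
      finally have "(norm (Y (s k) \<omega> - Y t \<omega>))\<^sup>2 \<le> (2 * R \<omega>)\<^sup>2" by (intro power_mono) auto
      thus "norm ((norm (Y (s k) \<omega> - Y t \<omega>))\<^sup>2) \<le> 4 * (R \<omega>)\<^sup>2" by (simp add: power_mult_distrib)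
    qed
  qed measurable
  hence "(\<lambda>k. dist2 M (Y (s k)) (Y t)) \<longlonglongrightarrow> sqrt 0"
    unfolding norm2_def by (intro tendsto_intros) simp
  hence "\<forall>\<^sub>F k in sequentially. dist2 M (Y (s k)) (Y t) < e"
    using e by (intro order_tendstoD) simp_all
  thus False using s(3) by (auto dest: eventually_happens)
qed

lemma square_integrable_Lipschitz:
  fixes x :: "'a \<Rightarrow> 'h::{real_inner, banach, second_countable_topology}"
    and \<Phi> :: "'h \<Rightarrow> 'g::{real_inner, banach, second_countable_topology}"
  assumes x: "square_integrable M x" and \<Phi>: "continuous_on UNIV \<Phi>" "\<And>y. norm (\<Phi> y) \<le> C + K * norm y"
    and "C \<ge> 0" "K \<ge> 0"
  shows "square_integrable M (\<lambda>\<omega>. \<Phi> (x \<omega>))" "norm2 M (\<lambda>\<omega>. \<Phi> (x \<omega>)) \<le> C + K * norm2 M x"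
    "integrable M (\<lambda>\<omega>. (C + K * norm (x \<omega>))\<^sup>2)"
proof -
  have n: "square_integrable M (\<lambda>\<omega>. norm (x \<omega>))"
    using square_integrable_measurable[OF x] x by (simp add: square_integrable_def)
  have s: "square_integrable M (\<lambda>\<omega>. C)" "square_integrable M (\<lambda>\<omega>. K * norm (x \<omega>))"
    using square_integrable_scaleR[OF n, of K] by (auto simp: square_integrable_def)
  have R: "square_integrable M (\<lambda>\<omega>. C + K * norm (x \<omega>))"
    by (intro square_integrable_add s)
  thus i: "integrable M (\<lambda>\<omega>. (C + K * norm (x \<omega>))\<^sup>2)" by (simp add: square_integrable_def)
  have m [measurable]: "(\<lambda>\<omega>. \<Phi> (x \<omega>)) \<in> borel_measurable M"
    using square_integrable_measurable[OF x] borel_measurable_continuous_onI[OF \<Phi>(1)]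
    by (rule measurable_compose)
  have le: "(norm (\<Phi> (x \<omega>)))\<^sup>2 \<le> (C + K * norm (x \<omega>))\<^sup>2" for \<omega>
    using \<Phi>(2) by (intro power_mono) auto
  have "integrable M (\<lambda>\<omega>. (norm (\<Phi> (x \<omega>)))\<^sup>2)"
    using le by (intro Bochner_Integration.integrable_bound[OF i] AE_I2) auto
  with m show "square_integrable M (\<lambda>\<omega>. \<Phi> (x \<omega>))" by (simp add: square_integrable_def)
  have "norm2 M (\<lambda>\<omega>. \<Phi> (x \<omega>)) \<le> norm2 M (\<lambda>\<omega>. C + K * norm (x \<omega>))"
    unfolding norm2_def real_sqrt_le_iff using le i \<open>integrable M (\<lambda>\<omega>. (norm (\<Phi> (x \<omega>)))\<^sup>2)\<close>
    by (intro integral_mono) auto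
  also have "\<dots> \<le> norm2 M (\<lambda>\<omega>. C) + norm2 M (\<lambda>\<omega>. K * norm (x \<omega>))"
    by (intro norm2_triangle s)
  also have "\<dots> = C + K * norm2 M x"
    using assms(4,5) by (simp add: norm2_def power_mult_distrib real_sqrt_mult prob_space)
  finally show "norm2 M (\<lambda>\<omega>. \<Phi> (x \<omega>)) \<le> C + K * norm2 M x" .
qed

lemma norm2_Lipschitz:
  fixes x y :: "'a \<Rightarrow> 'h::{real_inner, banach, second_countable_topology}"
    and \<Phi> \<Psi> :: "'a \<Rightarrow> 'g::{real_inner, banach, second_countable_topology}"
  assumes "square_integrable M (\<lambda>\<omega>. x \<omega> - y \<omega>)" "\<And>\<omega>. norm (\<Phi> \<omega> - \<Psi> \<omega>) \<le> K * norm (x \<omega> - y \<omega>)"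
    "K \<ge> 0" and sq: "square_integrable M (\<lambda>\<omega>. \<Phi> \<omega> - \<Psi> \<omega>)"
  shows "dist2 M \<Phi> \<Psi> \<le> K * dist2 M x y"
proof -
  have "dist2 M \<Phi> \<Psi> \<le> sqrt (\<integral>\<omega>. K\<^sup>2 * (norm (x \<omega> - y \<omega>))\<^sup>2 \<partial>M)"
    unfolding norm2_def real_sqrt_le_iff
  proof (rule integral_mono)
    show "(norm (\<Phi> \<omega> - \<Psi> \<omega>))\<^sup>2 \<le> K\<^sup>2 * (norm (x \<omega> - y \<omega>))\<^sup>2" for \<omega>
      using power_mono[OF assms(2), of \<omega> 2] by (simp add: power_mult_distrib)
  qed (use assms in \<open>auto simp: square_integrable_def\<close>)
  also have "\<dots> = K * dist2 M x y"
    using \<open>K \<ge> 0\<close> by (simp add: norm2_def real_sqrt_mult)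
  finally show ?thesis .
qed

text \<open>The difference is split at \<open>\<Phi> s (x t \<omega>)\<close>: the change of
  argument is Lipschitz uniformly in s, and the change of time is handled by dominated convergence
  with the linear growth bound. The lemma serves F and G as well as the maps sending y to U(t - s)
  y.\<close>

lemma l2cont_compose:
  fixes x :: "real \<Rightarrow> 'a \<Rightarrow> 'h::{real_inner, banach, second_countable_topology}"
    and \<Phi> :: "real \<Rightarrow> 'h \<Rightarrow> 'g::{real_inner, banach, second_countable_topology}"
  assumes \<Phi>: "continuous_on (T \<times> UNIV) (\<lambda>(s, y). \<Phi> s y)"
    and lip: "\<And>s y z. s \<in> T \<Longrightarrow> norm (\<Phi> s y - \<Phi> s z) \<le> K * norm (y - z)"
    and bd: "\<And>s. s \<in> T \<Longrightarrow> norm (\<Phi> s 0) \<le> C" and "K \<ge> 0" "C \<ge> 0"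
    and x: "\<And>s. s \<in> T \<Longrightarrow> square_integrable M (x s)" "l2cont M T x"
  shows "l2cont M T (\<lambda>s \<omega>. \<Phi> s (x s \<omega>))"
    "\<And>s. s \<in> T \<Longrightarrow> square_integrable M (\<lambda>\<omega>. \<Phi> s (x s \<omega>))"
    "\<And>s. s \<in> T \<Longrightarrow> norm2 M (\<lambda>\<omega>. \<Phi> s (x s \<omega>)) \<le> C + K * norm2 M (x s)"
proof -
  have growth: "norm (\<Phi> s y) \<le> C + K * norm y" if "s \<in> T" for s y
  proof -
    have "norm (\<Phi> s y) \<le> norm (\<Phi> s y - \<Phi> s 0) + norm (\<Phi> s 0)"
      using norm_triangle_ineq[of "\<Phi> s y - \<Phi> s 0" "\<Phi> s 0"] by simp
    thus ?thesis using lip[OF that, of y 0] bd[OF that] by simp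
  qed
  have cont1: "continuous_on UNIV (\<Phi> s)" if "s \<in> T" for s
    using continuous_on_compose2[OF \<Phi> continuous_on_Pair[OF continuous_on_const[of _ s] continuous_on_id[of UNIV]]] that
    by auto
  have cont2: "continuous_on T (\<lambda>s. \<Phi> s y)" for y
    using continuous_on_compose2[OF \<Phi> continuous_on_Pair[OF continuous_on_id[of T] continuous_on_const[of _ y]]]
    by auto
  note sq = square_integrable_Lipschitz[OF x(1) cont1 growth \<open>C \<ge> 0\<close> \<open>K \<ge> 0\<close>]
  have sq': "square_integrable M (\<lambda>\<omega>. \<Phi> s (x t \<omega>))" if "s \<in> T" "t \<in> T" for s t
    using sq(1)[of t s] that by simp
  show "square_integrable M (\<lambda>\<omega>. \<Phi> s (x s \<omega>))" "norm2 M (\<lambda>\<omega>. \<Phi> s (x s \<omega>)) \<le> C + K * norm2 M (x s)" if "s \<in> T" for s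
    using sq(1,2)[of s s] that by auto
  show "l2cont M T (\<lambda>s \<omega>. \<Phi> s (x s \<omega>))"
    unfolding l2cont_def
  proof (intro ballI allI impI)
    fix t :: real and e :: real assume t: "t \<in> T" and e: "e > 0"
    have "\<exists>d>0. \<forall>s\<in>T. \<bar>s - t\<bar> < d \<longrightarrow> norm2 M (\<lambda>\<omega>. \<Phi> s (x t \<omega>) - \<Phi> t (x t \<omega>)) < e / 2"
    proof (rule l2_dominated_cont[where R = "\<lambda>\<omega>. C + K * norm (x t \<omega>)"])
      show "(\<lambda>\<omega>. \<Phi> s (x t \<omega>)) \<in> borel_measurable M" if "s \<in> T" for s
        using sq'[OF that t] by (rule square_integrable_measurable)
      show "continuous (at t within T) (\<lambda>s. \<Phi> s (x t \<omega>))" for \<omega>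
        using cont2 t by (simp add: continuous_on_eq_continuous_within)
      show "integrable M (\<lambda>\<omega>. (C + K * norm (x t \<omega>))\<^sup>2)" using sq(3) t by blast
    qed (use t e growth in auto)
    then obtain d1 where d1: "d1 > 0" "\<And>s. s \<in> T \<Longrightarrow> \<bar>s - t\<bar> < d1 \<Longrightarrow> norm2 M (\<lambda>\<omega>. \<Phi> s (x t \<omega>) - \<Phi> t (x t \<omega>)) < e / 2"
      by blast
    \<comment> \<open>\<open>K + 1\<close> in place of \<open>K\<close> avoids division by
      zero.\<close>
    have "e / (2 * (K + 1)) > 0" using e \<open>K \<ge> 0\<close> by simp
    then obtain d2 where d2: "d2 > 0" "\<And>s. s \<in> T \<Longrightarrow> \<bar>s - t\<bar> < d2 \<Longrightarrow> dist2 M (x s) (x t) < e / (2 * (K + 1))"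
      using x(2) t unfolding l2cont_def by blast
    show "\<exists>d>0. \<forall>s\<in>T. \<bar>s - t\<bar> < d \<longrightarrow> norm2 M (\<lambda>\<omega>. \<Phi> s (x s \<omega>) - \<Phi> t (x t \<omega>)) < e"
    proof (intro exI[of _ "min d1 d2"] conjI ballI impI)
      fix s assume s: "s \<in> T" "\<bar>s - t\<bar> < min d1 d2"
      have "norm2 M (\<lambda>\<omega>. \<Phi> s (x s \<omega>) - \<Phi> t (x t \<omega>)) \<le>
         norm2 M (\<lambda>\<omega>. \<Phi> s (x s \<omega>) - \<Phi> s (x t \<omega>)) + norm2 M (\<lambda>\<omega>. \<Phi> s (x t \<omega>) - \<Phi> t (x t \<omega>))"
        using s t by (intro norm2_diff_triangle sq')
      also have "norm2 M (\<lambda>\<omega>. \<Phi> s (x s \<omega>) - \<Phi> s (x t \<omega>)) \<le> K * dist2 M (x s) (x t)"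
        using s t lip \<open>K \<ge> 0\<close> by (intro norm2_Lipschitz square_integrable_diff x sq') auto
      also have "\<dots> \<le> (K + 1) * (e / (2 * (K + 1)))"
        using d2(2)[of s] s \<open>K \<ge> 0\<close> by (intro mult_mono) auto
      also have "\<dots> = e / 2" using \<open>K \<ge> 0\<close> by (simp add: field_simps)
      finally show "norm2 M (\<lambda>\<omega>. \<Phi> s (x s \<omega>) - \<Phi> t (x t \<omega>)) < e"
        using d1(2)[of s] s by simp
    qed (use d1 d2 in auto)
  qed
qed

text \<open>Uniform continuity on a compact square is applied to the real function \<open>D\<close>.
  It vanishes on the diagonal, and comparing (s, t) with (t, t) gives a modulus of continuity for
  \<open>x\<close>.\<close>

lemma l2cont_uniform:
  fixes x :: "real \<Rightarrow> 'a \<Rightarrow> 'h::{real_inner, banach, second_countable_topology}"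
  assumes "l2cont M {a..b} x" and sq: "\<And>s. s \<in> {a..b} \<Longrightarrow> square_integrable M (x s)" and e: "e > 0"
  shows "\<exists>d>0. \<forall>s\<in>{a..b}. \<forall>t\<in>{a..b}. \<bar>s - t\<bar> < d \<longrightarrow> dist2 M (x s) (x t) < e"
proof -
  define D where "D = (\<lambda>p. dist2 M (x (fst p)) (x (snd p)))"
  have D_diff: "\<bar>D (s, t) - D (s', t')\<bar> \<le> D (s, s') + D (t, t')"
    if "s \<in> {a..b}" "t \<in> {a..b}" "s' \<in> {a..b}" "t' \<in> {a..b}" for s t s' t'
  proof -
    have "D (s, t) \<le> D (s, s') + D (s', t)" "D (s', t) \<le> D (s', t') + D (t', t)"
      "D (s', t') \<le> D (s', s) + D (s, t')" "D (s, t') \<le> D (s, t) + D (t, t')"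
      unfolding D_def fst_conv snd_conv using that by (intro norm2_diff_triangle sq; simp)+
    moreover have "D (t', t) = D (t, t')" "D (s', s) = D (s, s')"
      by (auto simp: D_def intro: norm2_minus_commute)
    ultimately show ?thesis by linarith
  qed
  have "continuous_on ({a..b} \<times> {a..b}) D"
    unfolding continuous_on_iff
  proof (intro ballI allI impI)
    fix p :: "real \<times> real" and e :: real assume p: "p \<in> {a..b} \<times> {a..b}" and e: "e > 0"
    obtain s t where st: "p = (s, t)" "s \<in> {a..b}" "t \<in> {a..b}" using p by auto
    have near: "\<exists>d>0. \<forall>s'\<in>{a..b}. \<bar>s' - s\<bar> < d \<longrightarrow> D (s', s) < e / 2" if "s \<in> {a..b}" for s
      using assms(1) that half_gt_zero[OF e] unfolding l2cont_def D_def fst_conv snd_conv by blast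
    obtain d1 where d1: "d1 > 0" "\<And>s'. s' \<in> {a..b} \<Longrightarrow> \<bar>s' - s\<bar> < d1 \<Longrightarrow> D (s', s) < e / 2"
      using near[OF st(2)] by blast
    obtain d2 where d2: "d2 > 0" "\<And>t'. t' \<in> {a..b} \<Longrightarrow> \<bar>t' - t\<bar> < d2 \<Longrightarrow> D (t', t) < e / 2"
      using near[OF st(3)] by blast
    note d = d1(1) d2(1) d1(2) d2(2)
    show "\<exists>d>0. \<forall>p'\<in>{a..b} \<times> {a..b}. dist p' p < d \<longrightarrow> dist (D p') (D p) < e"
    proof (intro exI[of _ "min d1 d2"] conjI ballI impI)
      fix p' assume p': "p' \<in> {a..b} \<times> {a..b}" "dist p' p < min d1 d2"
      obtain s' t' where st': "p' = (s', t')" "s' \<in> {a..b}" "t' \<in> {a..b}" using p' by auto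
      have "\<bar>s' - s\<bar> < d1" "\<bar>t' - t\<bar> < d2"
        using p'(2) dist_fst_le[of p' p] dist_snd_le[of p' p] st st' by (auto simp: dist_real_def)
      thus "dist (D p') (D p) < e"
        using D_diff[OF st'(2,3) st(2,3)] d(3)[OF st'(2)] d(4)[OF st'(3)] st st' by (simp add: dist_real_def)
    qed (use d in auto)
  qed
  hence "uniformly_continuous_on ({a..b} \<times> {a..b}) D"
    by (intro compact_uniformly_continuous compact_Times compact_Icc)
  then obtain d where d: "d > 0"
    "\<And>p p'. p \<in> {a..b} \<times> {a..b} \<Longrightarrow> p' \<in> {a..b} \<times> {a..b} \<Longrightarrow> dist p' p < d \<Longrightarrow> dist (D p') (D p) < e"
    using e unfolding uniformly_continuous_on_def by blast
  show ?thesis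
  proof (intro exI[of _ d] conjI ballI impI d)
    fix s t assume st: "s \<in> {a..b}" "t \<in> {a..b}" "\<bar>s - t\<bar> < d"
    have "dist (s, t) (t, t) < d" using st by (simp add: dist_Pair_Pair dist_real_def)
    hence "dist (D (s, t)) (D (t, t)) < e" using st by (intro d) auto
    thus "dist2 M (x s) (x t) < e" by (simp add: D_def dist_real_def)
  qed
qed

end

context brownian_motion
begin

section \<open>Existence of stochastic integrals, progressively measurable versions and the space of
  processes\<close>

lemma simple_process_eq:
  assumes mono: "\<And>i j. i \<le> j \<Longrightarrow> j \<le> n \<Longrightarrow> p i \<le> p j" and i: "i < n" "p i < s" "s \<le> p (Suc i)"
  shows "simple_process n p \<xi> s \<omega> = \<xi> i \<omega>"
proof -
  have "indicator {p j<..p (Suc j)} s *\<^sub>R \<xi> j \<omega> = 0" if "j \<in> {..<n} - {i}" for j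
  proof (cases "j < i")
    case True
    hence "p (Suc j) \<le> p i" using i by (intro mono) auto
    thus ?thesis using i by (auto simp: indicator_def)
  next
    case False
    hence "p (Suc i) \<le> p j" using that by (intro mono) auto
    thus ?thesis using i by (auto simp: indicator_def)
  qed
  hence "(\<Sum>j\<in>{..<n} - {i}. indicator {p j<..p (Suc j)} s *\<^sub>R \<xi> j \<omega>) = 0"
    by (intro sum.neutral ballI)
  hence "simple_process n p \<xi> s \<omega> = indicator {p i<..p (Suc i)} s *\<^sub>R \<xi> i \<omega>"
    unfolding simple_process_def using i(1) by (subst sum.remove[of _ i]) auto
  thus ?thesis using i by simp
qed

text \<open>For fixed s the sampling times tend to s, so the error vanishes pointwise in s by
  mean-square continuity, and the bound \<open>C\<close> permits dominated convergence in s. The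
  isometry transfers the Cauchy property to the integrals. Along a subsequence with geometric rate
  their pointwise limit exists almost surely, and being a pointwise limit it is known at time
  b.\<close>

lemma ito_exists:
  fixes f :: "real \<Rightarrow> 'w \<Rightarrow> 'h::{real_inner, banach, second_countable_topology}"
  assumes ab: "a \<le> b" and f: "measurable_process_on M a b f"
    and adapted: "\<And>s. s \<in> {a..b} \<Longrightarrow> f s \<in> borel_measurable (Filt s)"
    and sq: "\<And>s. s \<in> {a..b} \<Longrightarrow> square_integrable M (f s)"
    and bd: "\<And>s. s \<in> {a..b} \<Longrightarrow> norm2 M (f s) \<le> C" and cont: "l2cont M {a..b} f"
  shows "\<exists>I. has_ito_integral M W a b f I \<and> I \<in> borel_measurable (Filt b)"
proof -
  define p where "p k i = a + real i * ((b - a) / real (Suc k))" for k i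
  define S where "S k = (\<lambda>(s, \<omega>). simple_process (Suc k) (p k) (\<lambda>i. f (p k i)) s \<omega>)" for k
  define J where "J k = simple_integral W (Suc k) (p k) (\<lambda>i. f (p k i))" for k
  define g where "g = (\<lambda>(s, \<omega>). indicator {a<..b} s *\<^sub>R f s \<omega>)"
  have p_mono: "p k i \<le> p k j" if "i \<le> j" for k i j
    using that ab unfolding p_def by (intro add_left_mono mult_right_mono) auto
  have p0: "p k 0 = a" and pn: "p k (Suc k) = b" for k by (auto simp: p_def)
  have p_in: "p k i \<in> {a..b}" if "i \<le> Suc k" for k i
    using p_mono[of 0 i k] p_mono[OF that, of k] by (simp add: p0 pn)
  have simple: "simple_data M W a b (Suc k) (p k) (\<lambda>i. f (p k i))" for k
    unfolding simple_data_def using p0 pn p_mono[of _ "Suc _"] p_in adapted sq by simp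
  have el: "elem_pair (S k) (J k)" for k
    unfolding S_def J_def using simple by (rule simple_data_elem_pair)
  note [measurable] = elem_pair_measurable(1)[OF el] elem_pair_measurable(2)[OF el]
  have g_meas [measurable]: "g \<in> borel_measurable (lborel \<Otimes>\<^sub>M M)"
    unfolding g_def using f by (rule measurable_process_on_indicator)
  \<comment> \<open>Every s in (a, b] lies in exactly one piece of the partition, and the left end
    of that piece is the sampling time; at s = a the simple process is 0.\<close>
  have pick: "\<exists>d\<in>{a..b}. \<bar>d - s\<bar> \<le> (b - a) / real (Suc k) \<and> (\<forall>\<omega>. S k (s, \<omega>) = f d \<omega>)"
    if s: "s \<in> {a<..b}" for s k
  proof -
    define h where "h = (b - a) / real (Suc k)"
    have h: "h > 0" using s unfolding h_def by (intro divide_pos_pos) auto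
    obtain i where i: "i < Suc k" "p k i < s" "s \<le> p k (Suc i)"
    proof -
      define n where "n = (LEAST n. s \<le> p k n)"
      have n: "s \<le> p k n" unfolding n_def by (rule LeastI[of _ "Suc k"]) (use s pn in auto)
      have "n \<le> Suc k" unfolding n_def by (rule Least_le) (use s pn in auto)
      moreover have "n \<noteq> 0" using n p0[of k] s by (intro notI) auto
      then obtain i where i: "n = Suc i" using not0_implies_Suc by blast
      moreover have "\<not> s \<le> p k i" using not_less_Least[of i "\<lambda>n. s \<le> p k n"] i by (simp add: n_def)
      ultimately show ?thesis using n by (intro that[of i]) auto
    qed
    have "p k (Suc i) = a + (real i + 1) * h" "p k i = a + real i * h" by (simp_all add: p_def h_def)
    hence "p k (Suc i) - p k i = h" by (simp add: algebra_simps)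
    hence "\<bar>p k i - s\<bar> \<le> h" using i by linarith
    moreover have "S k (s, \<omega>) = f (p k i) \<omega>" for \<omega>
      unfolding S_def split using p_mono i by (intro simple_process_eq) auto
    ultimately show ?thesis using p_in[of i k] i unfolding h_def by (intro bexI[of _ "p k i"]) auto
  qed
  define h where "h k s = (\<integral>\<^sup>+\<omega>. ennreal ((norm (simple_process (Suc k) (p k) (\<lambda>i. f (p k i)) s \<omega> - f s \<omega>))\<^sup>2) \<partial>M)" for k s
  have h_eq: "h k s * indicator {a<..b} s = (\<integral>\<^sup>+\<omega>. ennreal ((norm (S k (s, \<omega>) - g (s, \<omega>)))\<^sup>2) \<partial>M)" for k s
    using simple_process_outside[OF simple] by (cases "s \<in> {a<..b}") (auto simp: h_def S_def g_def)
  have h_meas: "(\<lambda>s. h k s * indicator {a<..b} s) \<in> borel_measurable lborel" for k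
    unfolding h_eq by measurable
  have lim: "(\<lambda>k. \<integral>\<^sup>+s. h k s * indicator {a<..b} s \<partial>lborel) \<longlonglongrightarrow> (\<integral>\<^sup>+s. 0 \<partial>(lborel :: real measure))"
  proof (rule nn_integral_dominated_convergence[where w = "\<lambda>s. ennreal ((2 * C)\<^sup>2) * indicator {a<..b} s"])
    show "(\<integral>\<^sup>+s. ennreal ((2 * C)\<^sup>2) * indicator {a<..b} s \<partial>lborel) < \<infinity>"
      using ab by (simp add: nn_integral_cmult_indicator ennreal_mult_less_top)
    have h_norm2: "h k s = ennreal ((dist2 M (f d) (f s))\<^sup>2)"
      if "s \<in> {a<..b}" "d \<in> {a..b}" "\<forall>\<omega>. S k (s, \<omega>) = f d \<omega>" for k s d
    proof -
      have "h k s = nl2d M (f d) (f s)" using that by (simp add: h_def nl2_def S_def)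
      also have "\<dots> = ennreal ((dist2 M (f d) (f s))\<^sup>2)"
        using that by (intro nl2_eq_norm2 square_integrable_diff sq) auto
      finally show ?thesis .
    qed
    show "AE s in lborel. h k s * indicator {a<..b} s \<le> ennreal ((2 * C)\<^sup>2) * indicator {a<..b} s" for k
    proof (rule AE_I2)
      fix s :: real
      show "h k s * indicator {a<..b} s \<le> ennreal ((2 * C)\<^sup>2) * indicator {a<..b} s"
      proof (cases "s \<in> {a<..b}")
        case True
        obtain d where d: "d \<in> {a..b}" "\<forall>\<omega>. S k (s, \<omega>) = f d \<omega>" using pick[OF True] by blast
        have "dist2 M (f d) (f s) \<le> norm2 M (\<lambda>\<omega>. f d \<omega> - 0) + norm2 M (\<lambda>\<omega>. 0 - f s \<omega>)"
          using True d by (intro norm2_diff_triangle sq) auto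
        also have "\<dots> \<le> 2 * C" using bd[of d] bd[of s] True d norm2_minus_commute[of M "\<lambda>_. 0" "f s"] by simp
        finally have "(dist2 M (f d) (f s))\<^sup>2 \<le> (2 * C)\<^sup>2" by (intro power_mono) auto
        thus ?thesis using True unfolding h_norm2[OF True d] by (auto intro!: ennreal_leI)
      qed simp
    qed
    show "AE s in lborel. (\<lambda>k. h k s * indicator {a<..b} s) \<longlonglongrightarrow> 0"
    proof (rule AE_I2)
      fix s :: real
      show "(\<lambda>k. h k s * indicator {a<..b} s) \<longlonglongrightarrow> 0"
      proof (cases "s \<in> {a<..b}")
        case True
        obtain d where d: "\<And>k. d k \<in> {a..b}" "\<And>k. \<bar>d k - s\<bar> \<le> (b - a) / real (Suc k)" "\<And>k. \<forall>\<omega>. S k (s, \<omega>) = f (d k) \<omega>"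
          using pick[OF True] by metis
        have "(\<lambda>k. dist2 M (f (d k)) (f s)) \<longlonglongrightarrow> 0"
        proof (rule LIMSEQ_I)
          fix e :: real assume "e > 0"
          moreover have "s \<in> {a..b}" using True by simp
          ultimately obtain \<delta> where \<delta>: "\<delta> > 0" "\<And>r. r \<in> {a..b} \<Longrightarrow> \<bar>r - s\<bar> < \<delta> \<Longrightarrow> dist2 M (f r) (f s) < e"
            using cont unfolding l2cont_def by blast
          have "(\<lambda>k. (b - a) * (1 / real (Suc k))) \<longlonglongrightarrow> (b - a) * 0"
            by (intro tendsto_intros LIMSEQ_Suc lim_1_over_n)
          hence "\<forall>\<^sub>F k in sequentially. (b - a) / real (Suc k) < \<delta>"
            using \<delta>(1) by (intro order_tendstoD) auto
          then obtain N where N: "\<And>k. k \<ge> N \<Longrightarrow> (b - a) / real (Suc k) < \<delta>"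
            by (auto simp: eventually_sequentially)
          show "\<exists>N. \<forall>k\<ge>N. norm (dist2 M (f (d k)) (f s) - 0) < e"
          proof (intro exI[of _ N] allI impI)
            fix k assume "k \<ge> N"
            hence "\<bar>d k - s\<bar> < \<delta>" using N[of k] d(2)[of k] by linarith
            thus "norm (dist2 M (f (d k)) (f s) - 0) < e" using \<delta>(2)[OF d(1)] by simp
          qed
        qed
        hence "(\<lambda>k. ennreal ((dist2 M (f (d k)) (f s))\<^sup>2)) \<longlonglongrightarrow> ennreal (0\<^sup>2)"
          by (intro tendsto_intros)
        thus ?thesis using True by (simp add: h_norm2[OF True d(1,3)])
      qed simp
    qed
  qed (use h_meas in measurable)
  have nl2_eq: "nl2 (lborel \<Otimes>\<^sub>M M) (\<lambda>q. S k q - g q) = (\<integral>\<^sup>+s. h k s * indicator {a<..b} s \<partial>lborel)" for k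
    unfolding nl2_def h_eq by (rule nn_integral_fst[symmetric]) measurable
  have lim0: "(\<lambda>k. nl2 (lborel \<Otimes>\<^sub>M M) (\<lambda>q. S k q - g q)) \<longlonglongrightarrow> 0"
    unfolding nl2_eq using lim by simp
  \<comment> \<open>The subsequence is selected by errors below (1/2)^j in norm, hence below the
    square of this for \<open>nl2\<close>.\<close>
  have "\<exists>k. nl2 (lborel \<Otimes>\<^sub>M M) (\<lambda>q. S k q - g q) < ennreal (((1 / 2) ^ j)\<^sup>2)" for j
  proof -
    have "\<forall>\<^sub>F k in sequentially. nl2 (lborel \<Otimes>\<^sub>M M) (\<lambda>q. S k q - g q) < ennreal (((1 / 2) ^ j)\<^sup>2)"
      using lim0 by (rule order_tendstoD) simp
    thus ?thesis by (auto dest: eventually_happens)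
  qed
  then obtain r where r: "\<And>j. nl2 (lborel \<Otimes>\<^sub>M M) (\<lambda>q. S (r j) q - g q) < ennreal (((1 / 2) ^ j)\<^sup>2)"
    by metis
  define I where "I \<omega> = lim (\<lambda>j. J (r j) \<omega>)" for \<omega>
  have J_sq: "square_integrable M (J k)" for k using elem_pair_square_integrable(2)[OF el] .
  have J_le: "dist2 M (J (r (Suc j))) (J (r j)) \<le> 2 * (1 / 2) ^ j" for j
  proof (rule nl2_le_imp_norm2_le(2))
    have "nl2d M (J (r (Suc j))) (J (r j)) = nl2 (lborel \<Otimes>\<^sub>M M) (\<lambda>q. S (r (Suc j)) q - S (r j) q)"
      by (intro elem_pair_isometry elem_pair_diff el)
    also have "\<dots> \<le> 2 * nl2 (lborel \<Otimes>\<^sub>M M) (\<lambda>q. S (r (Suc j)) q - g q) + 2 * nl2 (lborel \<Otimes>\<^sub>M M) (\<lambda>q. g q - S (r j) q)"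
      by (rule nl2_triangle) measurable
    also have "\<dots> \<le> 2 * ennreal (((1 / 2) ^ j)\<^sup>2) + 2 * ennreal (((1 / 2) ^ j)\<^sup>2)"
    proof (intro add_mono mult_left_mono)
      show "nl2 (lborel \<Otimes>\<^sub>M M) (\<lambda>q. g q - S (r j) q) \<le> ennreal (((1 / 2) ^ j)\<^sup>2)"
        using r[of j] by (subst nl2_minus_commute) (rule less_imp_le)
      have "nl2 (lborel \<Otimes>\<^sub>M M) (\<lambda>q. S (r (Suc j)) q - g q) \<le> ennreal (((1 / 2) ^ Suc j)\<^sup>2)"
        using r[of "Suc j"] by (rule less_imp_le)
      also have "\<dots> \<le> ennreal (((1 / 2) ^ j)\<^sup>2)"
        by (intro ennreal_leI power_mono power_decreasing) auto
      finally show "nl2 (lborel \<Otimes>\<^sub>M M) (\<lambda>q. S (r (Suc j)) q - g q) \<le> ennreal (((1 / 2) ^ j)\<^sup>2)" .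
    qed auto
    also have "\<dots> = ennreal ((2 * (1 / 2) ^ j)\<^sup>2)"
      by (simp add: power_mult_distrib flip: ennreal_plus ennreal_mult ennreal_numeral)
    finally show "nl2d M (J (r (Suc j))) (J (r j)) \<le> ennreal ((2 * (1 / 2) ^ j)\<^sup>2)" .
  qed (auto intro!: borel_measurable_diff square_integrable_measurable J_sq)
  \<comment> \<open>The tail constant is 2 / (1 - 1/2) = 4.\<close>
  note L = L2_geometric_lim[of "\<lambda>j. J (r j)" 2 "1 / 2", OF J_sq J_le, folded I_def, simplified]
  have I_meas: "I \<in> borel_measurable (Filt b)"
    unfolding I_def
  proof (rule borel_measurable_lim_metric)
    fix j
    show "J (r j) \<in> borel_measurable (Filt b)"
      unfolding J_def simple_integral_def
    proof (intro borel_measurable_sum borel_measurable_scaleR)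
      fix i assume i: "i \<in> {..<Suc (r j)}"
      have le: "p (r j) i \<le> b" "p (r j) (Suc i) \<le> b" using p_in[of i "r j"] p_in[of "Suc i" "r j"] i by auto
      show "(\<lambda>\<omega>. W (p (r j) (Suc i)) \<omega> - W (p (r j) i) \<omega>) \<in> borel_measurable (Filt b)"
        using le by (intro measurable_increment_Filt)
      show "f (p (r j) i) \<in> borel_measurable (Filt b)"
        using measurable_Filt_mono[OF adapted le(1)] p_in[of i "r j"] i by auto
    qed
  qed
  have "has_ito_integral M W a b f I"
    unfolding has_ito_integral_def
  proof (intro conjI exI allI)
    show "measurable_process_on M a b f" by fact
    show "I \<in> borel_measurable M" using I_meas by (rule measurable_Filt_imp)
    show "simple_data M W a b (Suc (r j)) (p (r j)) (\<lambda>i. f (p (r j) i))" for j by (rule simple)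
    \<comment> \<open>The closed and the half-open interval differ by the null set {a}.\<close>
    have AE_eq: "AE s in lborel. h k s * indicator {a<..b} s = h k s * indicator {a..b} s" for k
      using AE_lborel_singleton[of a] by eventually_elim (auto simp: indicator_def)
    have eq: "(\<integral>\<^sup>+s\<in>{a..b}. h k s \<partial>lborel) = nl2 (lborel \<Otimes>\<^sub>M M) (\<lambda>q. S k q - g q)" for k
      unfolding nl2_eq by (rule nn_integral_cong_AE) (use AE_eq in \<open>auto simp: eq_commute\<close>)
    have "(\<lambda>j. nl2 (lborel \<Otimes>\<^sub>M M) (\<lambda>q. S (r j) q - g q)) \<longlonglongrightarrow> 0"
    proof (rule tendsto_sandwich[OF _ _ tendsto_const])
      have "(\<lambda>j. ennreal (((1 / 2) ^ j)\<^sup>2)) \<longlonglongrightarrow> ennreal (0\<^sup>2)"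
        by (intro tendsto_intros LIMSEQ_realpow_zero) auto
      thus "(\<lambda>j. ennreal (((1 / 2) ^ j)\<^sup>2)) \<longlonglongrightarrow> 0" by simp
    qed (use r in \<open>auto intro!: always_eventually less_imp_le\<close>)
    thus "(\<lambda>j. \<integral>\<^sup>+s\<in>{a..b}. (\<integral>\<^sup>+\<omega>. ennreal ((norm (simple_process (Suc (r j)) (p (r j)) (\<lambda>i. f (p (r j) i)) s \<omega> - f s \<omega>))\<^sup>2) \<partial>M) \<partial>lborel)
          \<longlonglongrightarrow> 0"
      unfolding eq[symmetric] by (simp add: h_def)
    have "(\<lambda>j. nl2d M (J (r j)) I) \<longlonglongrightarrow> 0"
    proof (rule tendsto_sandwich[OF _ _ tendsto_const])
      have "(\<lambda>j. ennreal ((4 * (1 / 2) ^ j)\<^sup>2)) \<longlonglongrightarrow> ennreal ((4 * 0)\<^sup>2)"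
        by (intro tendsto_intros LIMSEQ_realpow_zero) auto
      thus "(\<lambda>j. ennreal ((4 * (1 / 2) ^ j)\<^sup>2)) \<longlonglongrightarrow> 0" by simp
      show "\<forall>\<^sub>F j in sequentially. nl2d M (J (r j)) I \<le> ennreal ((4 * (1 / 2) ^ j)\<^sup>2)"
      proof (intro always_eventually allI)
        fix j
        have "nl2d M (J (r j)) I = ennreal ((dist2 M (J (r j)) I)\<^sup>2)"
          by (intro nl2_eq_norm2 square_integrable_diff J_sq L(1))
        also have "\<dots> \<le> ennreal ((4 * (1 / 2) ^ j)\<^sup>2)"
          using L(2)[of j] by (intro ennreal_leI power_mono) (auto simp: power_divide)
        finally show "nl2d M (J (r j)) I \<le> ennreal ((4 * (1 / 2) ^ j)\<^sup>2)" .
      qed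
    qed auto
    thus "(\<lambda>j. \<integral>\<^sup>+\<omega>. ennreal ((norm (simple_integral W (Suc (r j)) (p (r j)) (\<lambda>i. f (p (r j) i)) \<omega> - I \<omega>))\<^sup>2) \<partial>M)
          \<longlonglongrightarrow> 0"
      by (simp add: J_def nl2_def)
  qed
  with I_meas show ?thesis by blast
qed

text \<open>The \<open>y t\<close> may have been chosen one by one, so joint measurability can fail.
  Rounding time down to a grid gives processes with countably many time values that never look
  ahead. Meshes \<open>\<delta> n\<close> taken from uniform continuity on [t0, t0 + n] make the
  error smaller than (1/2)^n, so the pointwise limits exist and equal \<open>y t\<close> almost
  surely for each t.\<close>

lemma measurable_modification:
  fixes y :: "real \<Rightarrow> 'w \<Rightarrow> 'h::{real_inner, banach, second_countable_topology}"
  assumes adapted: "\<And>t. t \<ge> t0 \<Longrightarrow> y t \<in> borel_measurable (Filt t)"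
    and sq: "\<And>t. t \<ge> t0 \<Longrightarrow> square_integrable M (y t)" and cont: "l2cont M {t0..} y"
  shows "\<exists>x. (\<forall>t\<ge>t0. AE \<omega> in M. x t \<omega> = y t \<omega>) \<and> (\<forall>t\<ge>t0. measurable_process_on (Filt t) t0 t x)"
proof -
  have "\<exists>d>0. \<forall>s\<in>{t0..t0 + real n}. \<forall>t\<in>{t0..t0 + real n}. \<bar>s - t\<bar> < d \<longrightarrow>
      dist2 M (y s) (y t) < (1 / 2) ^ n" for n
    by (intro l2cont_uniform l2cont_subset[OF cont] sq) auto
  then obtain \<delta> where \<delta>: "\<And>n. \<delta> n > 0"
    "\<And>n s t. s \<in> {t0..t0 + real n} \<Longrightarrow> t \<in> {t0..t0 + real n} \<Longrightarrow> \<bar>s - t\<bar> < \<delta> n \<Longrightarrow>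
      dist2 M (y s) (y t) < (1 / 2) ^ n" by metis
  define d where "d n s = t0 + \<delta> n * real_of_int \<lfloor>(s - t0) / \<delta> n\<rfloor>" for n s
  have d: "t0 \<le> d n s" "d n s \<le> s" "\<bar>d n s - s\<bar> < \<delta> n" if "t0 \<le> s" for n s
  proof -
    have f: "0 \<le> \<lfloor>(s - t0) / \<delta> n\<rfloor>" using that \<delta>(1)[of n] by simp
    thus "t0 \<le> d n s" using \<delta>(1)[of n] by (simp add: d_def)
    have "\<delta> n * real_of_int \<lfloor>(s - t0) / \<delta> n\<rfloor> \<le> \<delta> n * ((s - t0) / \<delta> n)"
      using \<delta>(1)[of n] by (intro mult_left_mono) auto
    also have "\<dots> = s - t0" using \<delta>(1)[of n] by simp
    finally show le: "d n s \<le> s" by (simp add: d_def)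
    have "(s - t0) / \<delta> n < real_of_int \<lfloor>(s - t0) / \<delta> n\<rfloor> + 1" by linarith
    hence "s - t0 < \<delta> n * (real_of_int \<lfloor>(s - t0) / \<delta> n\<rfloor> + 1)" using \<delta>(1)[of n] by (simp add: field_simps)
    thus "\<bar>d n s - s\<bar> < \<delta> n" using le by (simp add: d_def algebra_simps)
  qed
  define x where "x s \<omega> = lim (\<lambda>n. y (d n s) \<omega>)" for s \<omega>
  have "AE \<omega> in M. x t \<omega> = y t \<omega>" if t: "t \<ge> t0" for t
  proof -
    \<comment> \<open>The error bound at stage n holds only once t \<le> t0 + n, hence the shift by
      \<open>N\<close>; it does not affect the limit.\<close>
    obtain N :: nat where N: "t - t0 \<le> real N" using real_arch_simple by blast
    have "AE \<omega> in M. (\<lambda>n. y (d (n + N) t) \<omega>) \<longlonglongrightarrow> y t \<omega>"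
    proof (rule L2_geometric_AE_limit[where C = 1 and q = "1 / 2"])
      fix n
      have "dist2 M (y (d (n + N) t)) (y t) < (1 / 2) ^ (n + N)"
        using d[OF t, of "n + N"] N t by (intro \<delta>(2)) auto
      also have "\<dots> \<le> (1 / 2) ^ n" by (intro power_decreasing) auto
      finally show "dist2 M (y (d (n + N) t)) (y t) \<le> 1 * (1 / 2) ^ n" by simp
    qed (use d[OF t] t sq in auto)
    thus ?thesis
    proof eventually_elim
      case (elim \<omega>)
      hence "(\<lambda>n. y (d n t) \<omega>) \<longlonglongrightarrow> y t \<omega>" by (rule LIMSEQ_offset)
      thus ?case unfolding x_def by (rule limI)
    qed
  qed
  moreover have "measurable_process_on (Filt t) t0 t x" if t: "t \<ge> t0" for t
  proof -
    let ?R = "restrict_space lborel {t0..t} \<Otimes>\<^sub>M Filt t"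
    have meas: "(\<lambda>(s, \<omega>). y (d n s) \<omega>) \<in> borel_measurable ?R" for n
    proof -
      \<comment> \<open>Clamping to [t0, t] makes the value at each of the countably many grid
        points \<open>Filt t\<close>-measurable, also for grid points outside the interval.\<close>
      let ?c = "\<lambda>i::int. max t0 (min t (t0 + \<delta> n * real_of_int i))"
      have f: "(\<lambda>p. y (?c i) (snd p)) \<in> borel_measurable ?R" for i
        using t by (intro measurable_compose[OF measurable_snd] measurable_Filt_mono[OF adapted]) auto
      have fst: "fst \<in> borel_measurable ?R"
        by (rule measurable_compose[OF measurable_fst]) (auto intro: measurable_restrict_space1)
      have g: "(\<lambda>p. \<lfloor>(fst p - t0) / \<delta> n\<rfloor>) \<in> measurable ?R (count_space UNIV)"
        by (rule measurable_compose[OF _ measurable_real_floor]) (intro borel_measurable_divide borel_measurable_diff fst borel_measurable_const)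
      have "(\<lambda>p. y (?c \<lfloor>(fst p - t0) / \<delta> n\<rfloor>) (snd p)) \<in> borel_measurable ?R"
        by (rule measurable_compose_countable[OF f g])
      also have "?this \<longleftrightarrow> (\<lambda>(s, \<omega>). y (d n s) \<omega>) \<in> borel_measurable ?R"
      proof (rule measurable_cong)
        fix p assume "p \<in> space ?R"
        hence p: "fst p \<in> {t0..t}" by (auto simp: space_pair_measure space_restrict_space)
        have "?c \<lfloor>(fst p - t0) / \<delta> n\<rfloor> = d n (fst p)"
          using d(1,2)[of "fst p" n] p unfolding d_def by (simp add: min_def max_def)
        thus "y (?c \<lfloor>(fst p - t0) / \<delta> n\<rfloor>) (snd p) = (case p of (s, \<omega>) \<Rightarrow> y (d n s) \<omega>)"
          by (simp add: split_def)
      qed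
      finally show ?thesis .
    qed
    show ?thesis
      unfolding measurable_process_on_def x_def split_def
      using borel_measurable_lim_metric[of "\<lambda>n p. y (d n (fst p)) (snd p)" ?R] meas
      by (simp add: split_def)
  qed
  ultimately show ?thesis by blast
qed

text \<open>The space in which the Picard iteration runs. Measurability on [t0, t] with respect to
  \<open>Filt t\<close> is progressive measurability, which makes pathwise drift integrals adapted.
  The bound is global in time, so that suprema over the half-line are finite.\<close>

definition l2proc :: "real \<Rightarrow> (real \<Rightarrow> 'w \<Rightarrow> 'h::{real_inner, banach, second_countable_topology}) \<Rightarrow> bool" where
  "l2proc t0 x \<longleftrightarrow> (\<forall>t\<ge>t0. measurable_process_on (Filt t) t0 t x) \<and>
    (\<forall>t\<ge>t0. square_integrable M (x t)) \<and> (\<exists>C. \<forall>t\<ge>t0. norm2 M (x t) \<le> C) \<and> l2cont M {t0..} x"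

lemma l2procD:
  assumes "l2proc t0 x"
  shows "t \<ge> t0 \<Longrightarrow> measurable_process_on (Filt t) t0 t x" "t \<ge> t0 \<Longrightarrow> square_integrable M (x t)"
    "\<exists>C. \<forall>t\<ge>t0. norm2 M (x t) \<le> C" "l2cont M {t0..} x"
    "t \<ge> t0 \<Longrightarrow> x t \<in> borel_measurable (Filt t)" "t \<ge> t0 \<Longrightarrow> measurable_process_on M t0 t x"
  using assms
  by (auto simp: l2proc_def intro: measurable_process_on_section
      measurable_process_on_mono[OF _ sets_Filt_subset])

lemma measurable_process_on_subinterval:
  "measurable_process_on N a b x \<Longrightarrow> a \<le> a' \<Longrightarrow> b' \<le> b \<Longrightarrow> measurable_process_on N a' b' x"
  by (rule measurable_process_on_mono) auto

lemma l2proc_later: "l2proc t0 x \<Longrightarrow> t0 \<le> r \<Longrightarrow> l2proc r x"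
  unfolding l2proc_def
  using l2cont_subset[of M "{t0..}" x "{r..}"]
  by (meson atLeast_subset_iff measurable_process_on_subinterval order.trans order.refl)

lemma l2proc_zero: "l2proc t0 (\<lambda>_ _. 0)"
  unfolding l2proc_def by (auto simp: measurable_process_on_def l2cont_def)

text \<open>Completeness along geometric sequences: pointwise limits keep progressive measurability,
  the uniform error bound transfers boundedness, and an e/3 argument transfers continuity.\<close>

lemma l2proc_lim:
  fixes x :: "nat \<Rightarrow> real \<Rightarrow> 'w \<Rightarrow> 'h::{real_inner, banach, second_countable_topology}"
  assumes x: "\<And>n. l2proc t0 (x n)"
    and le: "\<And>n t. t \<ge> t0 \<Longrightarrow> dist2 M (x (Suc n) t) (x n t) \<le> C * q ^ n" and q: "0 \<le> q" "q < 1"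
  shows "l2proc t0 (\<lambda>t \<omega>. lim (\<lambda>n. x n t \<omega>))"
    "t \<ge> t0 \<Longrightarrow> norm2 M (\<lambda>\<omega>. x n t \<omega> - lim (\<lambda>n. x n t \<omega>)) \<le> C * q ^ n / (1 - q)"
proof -
  let ?L = "\<lambda>t \<omega>. lim (\<lambda>n. x n t \<omega>)"
  have sq: "square_integrable M (x n t)" if "t \<ge> t0" for n t using l2procD(2)[OF x that] .
  have L: "square_integrable M (?L t)" "dist2 M (x n t) (?L t) \<le> C * q ^ n / (1 - q)"
    if "t \<ge> t0" for n t
    using L2_geometric_lim[of "\<lambda>n. x n t", OF sq[OF that] le[OF that] q] by auto
  show "t \<ge> t0 \<Longrightarrow> dist2 M (x n t) (?L t) \<le> C * q ^ n / (1 - q)" by (rule L(2))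
  show "l2proc t0 ?L"
    unfolding l2proc_def
  proof (intro conjI allI impI)
    fix t assume t: "t \<ge> t0"
    let ?R = "restrict_space lborel {t0..t} \<Otimes>\<^sub>M Filt t"
    show "measurable_process_on (Filt t) t0 t ?L"
      using borel_measurable_lim_metric[of "\<lambda>n p. x n (fst p) (snd p)" ?R] l2procD(1)[OF x t]
      by (simp add: measurable_process_on_def split_def)
    show "square_integrable M (?L t)" using t by (rule L(1))
  next
    obtain C0 where C0: "\<And>t. t \<ge> t0 \<Longrightarrow> norm2 M (x 0 t) \<le> C0" using l2procD(3)[OF x[of 0]] by blast
    have "norm2 M (?L t) \<le> C / (1 - q) + C0" if t: "t \<ge> t0" for t
    proof -
      have "norm2 M (\<lambda>\<omega>. ?L t \<omega> - 0) \<le> dist2 M (?L t) (x 0 t) + norm2 M (\<lambda>\<omega>. x 0 t \<omega> - 0)"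
        using t by (intro norm2_diff_triangle L sq) auto
      thus ?thesis using L(2)[OF t, of 0] C0[OF t] norm2_minus_commute[of M "?L t" "x 0 t"] by simp
    qed
    thus "\<exists>C. \<forall>t\<ge>t0. norm2 M (?L t) \<le> C" by blast
  next
    show "l2cont M {t0..} ?L"
      unfolding l2cont_def
    proof (intro ballI allI impI)
      fix t e :: real assume t: "t \<in> {t0..}" and e: "e > 0"
      have "(\<lambda>n. C * q ^ n / (1 - q)) \<longlonglongrightarrow> C * 0 / (1 - q)"
        using q by (intro tendsto_intros LIMSEQ_realpow_zero) auto
      hence "\<forall>\<^sub>F n in sequentially. C * q ^ n / (1 - q) < e / 3"
        using e by (intro order_tendstoD) auto
      then obtain n where n: "C * q ^ n / (1 - q) < e / 3" by (auto dest: eventually_happens)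
      have "e / 3 > 0" using e by simp
      then obtain d where d: "d > 0" "\<And>s. s \<ge> t0 \<Longrightarrow> \<bar>s - t\<bar> < d \<Longrightarrow> dist2 M (x n s) (x n t) < e / 3"
        using l2procD(4)[OF x[of n]] t unfolding l2cont_def by (metis atLeast_iff)
      show "\<exists>d>0. \<forall>s\<in>{t0..}. \<bar>s - t\<bar> < d \<longrightarrow> dist2 M (?L s) (?L t) < e"
      proof (intro exI[of _ d] conjI ballI impI d(1))
        fix s assume s: "s \<in> {t0..}" "\<bar>s - t\<bar> < d"
        have "dist2 M (?L s) (?L t) \<le> dist2 M (?L s) (x n s) + dist2 M (x n s) (?L t)"
          using s t by (intro norm2_diff_triangle L sq) auto
        also have "dist2 M (x n s) (?L t) \<le> dist2 M (x n s) (x n t) + dist2 M (x n t) (?L t)"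
          using s t by (intro norm2_diff_triangle L sq) auto
        finally show "dist2 M (?L s) (?L t) < e"
          using L(2)[of s n] L(2)[of t n] d(2)[of s] s t n norm2_minus_commute[of M "?L s" "x n s"] by simp
      qed
    qed
  qed
qed

end

section \<open>The linear mild equation\<close>

text \<open>The inequality 2 w h \<le> c w + w h^2 / c is integrated and the parameter c is chosen
  afterwards as the quotient of the left integral by \<open>B\<close>. Extended integrals make this
  valid without prior integrability.\<close>

lemma nn_integral_weighted_Cauchy_Schwarz:
  fixes w h :: "'a \<Rightarrow> real"
  assumes [measurable]: "w \<in> borel_measurable M" "h \<in> borel_measurable M"
    and nn: "\<And>x. w x \<ge> 0" "\<And>x. h x \<ge> 0" and B: "(\<integral>\<^sup>+x. ennreal (w x) \<partial>M) \<le> ennreal B" "B > 0"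
  shows "(\<integral>\<^sup>+x. ennreal (w x * h x) \<partial>M)\<^sup>2 \<le> ennreal B * (\<integral>\<^sup>+x. ennreal (w x * (h x)\<^sup>2) \<partial>M)"
proof -
  define X where "X = (\<integral>\<^sup>+x. ennreal (w x * h x) \<partial>M)"
  define A where "A = (\<integral>\<^sup>+x. ennreal (w x * (h x)\<^sup>2) \<partial>M)"
  have amgm: "2 * X \<le> ennreal (c * B) + ennreal (1 / c) * A" if c: "c > 0" for c
  proof -
    have pt: "2 * (w x * h x) \<le> c * w x + (1 / c) * (w x * (h x)\<^sup>2)" for x
    proof -
      have "0 \<le> (h x - c)\<^sup>2 / c" using c by simp
      hence "2 * h x \<le> c + (1 / c) * (h x)\<^sup>2"
        using c by (simp add: power2_eq_square field_simps)
      hence "w x * (2 * h x) \<le> w x * (c + (1 / c) * (h x)\<^sup>2)" using nn by (intro mult_left_mono)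
      thus ?thesis by (simp add: algebra_simps)
    qed
    have "2 * X = (\<integral>\<^sup>+x. ennreal (2 * (w x * h x)) \<partial>M)"
      unfolding X_def by (subst nn_integral_cmult[symmetric]) (auto simp: ennreal_mult nn)
    also have "\<dots> \<le> (\<integral>\<^sup>+x. ennreal c * ennreal (w x) + ennreal (1 / c) * ennreal (w x * (h x)\<^sup>2) \<partial>M)"
    proof (intro nn_integral_mono)
      fix x
      have "ennreal (2 * (w x * h x)) \<le> ennreal (c * w x + (1 / c) * (w x * (h x)\<^sup>2))"
        using pt by (rule ennreal_leI)
      also have "\<dots> = ennreal c * ennreal (w x) + ennreal (1 / c) * ennreal (w x * (h x)\<^sup>2)"
        using c nn by (subst ennreal_plus) (auto simp flip: ennreal_mult)
      finally show "ennreal (2 * (w x * h x)) \<le> ennreal c * ennreal (w x) + ennreal (1 / c) * ennreal (w x * (h x)\<^sup>2)" .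
    qed
    also have "\<dots> = ennreal c * (\<integral>\<^sup>+x. ennreal (w x) \<partial>M) + ennreal (1 / c) * A"
      unfolding A_def by (simp add: nn_integral_add nn_integral_cmult)
    also have "\<dots> \<le> ennreal c * ennreal B + ennreal (1 / c) * A"
      using B by (intro add_mono mult_left_mono) auto
    finally show ?thesis using c B by (simp add: ennreal_mult)
  qed
  have "X\<^sup>2 \<le> ennreal B * A"
  proof (cases A)
    case top
    thus ?thesis using B by (simp add: ennreal_mult_top)
  next
    case (real a)
    \<comment> \<open>The choice c = 1 shows that \<open>X\<close> is finite, which the final choice
      of c presupposes.\<close>
    have "2 * X \<le> ennreal (B + a)"
      using amgm[of 1] real B by (simp add: ennreal_plus)
    moreover have "X \<le> 2 * X" by (simp add: mult_2)
    ultimately have "X \<le> ennreal (B + a)" by (rule order_trans[rotated])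
    hence "X \<noteq> top" by (auto simp: top_unique)
    then obtain x where x: "X = ennreal x" "x \<ge> 0" by (cases X) auto
    have "x\<^sup>2 \<le> B * a"
    proof (cases "x = 0")
      case True
      thus ?thesis using B real by simp
    next
      case False
      \<comment> \<open>With c = \<open>x / B\<close> the inequality reads 2 x \<le> x + B a / x,
        which becomes the claim after multiplication by \<open>x\<close>.\<close>
      hence pos: "x / B > 0" using x B by simp
      have "ennreal (1 / (x / B)) * A = ennreal (1 / (x / B) * a)"
        using pos real unfolding real(2) by (intro ennreal_mult[symmetric] less_imp_le[OF divide_pos_pos]) auto
      moreover have "2 * X = ennreal (2 * x)" using x by (simp add: ennreal_mult)
      ultimately have "ennreal (2 * x) \<le> ennreal (x / B * B) + ennreal (1 / (x / B) * a)"
        using amgm[OF pos] by simp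
      also have "\<dots> = ennreal (x / B * B + 1 / (x / B) * a)"
        using pos B real x by (intro ennreal_plus[symmetric]) auto
      finally have "ennreal (2 * x) \<le> ennreal (x / B * B + 1 / (x / B) * a)" .
      hence "2 * x \<le> x / B * B + 1 / (x / B) * a"
        using pos B real x by (subst (asm) ennreal_le_iff) auto
      hence "x \<le> B * a / x" using B by simp
      thus ?thesis using False x by (simp add: field_simps power2_eq_square)
    qed
    thus ?thesis using x real B by (simp add: ennreal_power flip: ennreal_mult)
  qed
  thus ?thesis by (simp add: X_def A_def)
qed

text \<open>The bound 1/\<nu> is uniform in the length of the interval and serves the global
  estimates; the bound by the length is small on short intervals and serves continuity in
  time.\<close>

lemma nn_integral_exp_decay:
  fixes t t0 \<nu> :: real
  assumes "\<nu> > 0" "t0 \<le> t"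
  shows "(\<integral>\<^sup>+s\<in>{t0..t}. ennreal (exp (- \<nu> * (t - s))) \<partial>lborel) \<le> ennreal (1 / \<nu>)"
    "(\<integral>\<^sup>+s\<in>{t0..t}. ennreal (exp (- \<nu> * (t - s))) \<partial>lborel) \<le> ennreal (t - t0)"
proof -
  have "(\<integral>\<^sup>+s\<in>{t0..t}. ennreal (exp (- \<nu> * (t - s))) \<partial>lborel) =
      ennreal (exp (- \<nu> * (t - t)) / \<nu> - exp (- \<nu> * (t - t0)) / \<nu>)"
    using assms by (intro nn_integral_FTC_Icc) (auto intro!: derivative_eq_intros)
  also have "\<dots> \<le> ennreal (1 / \<nu>)" using assms by (intro ennreal_leI) simp
  finally show "(\<integral>\<^sup>+s\<in>{t0..t}. ennreal (exp (- \<nu> * (t - s))) \<partial>lborel) \<le> ennreal (1 / \<nu>)" .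
  have "(\<integral>\<^sup>+s\<in>{t0..t}. ennreal (exp (- \<nu> * (t - s))) \<partial>lborel) \<le> (\<integral>\<^sup>+s. indicator {t0..t} s \<partial>lborel)"
  proof (intro nn_integral_mono)
    fix s
    have "exp (- \<nu> * (t - s)) \<le> 1" if "s \<le> t" using assms that by (simp add: mult_nonpos_nonneg)
    thus "ennreal (exp (- \<nu> * (t - s))) * indicator {t0..t} s \<le> indicator {t0..t} s"
      by (auto simp: indicator_def)
  qed
  thus "(\<integral>\<^sup>+s\<in>{t0..t}. ennreal (exp (- \<nu> * (t - s))) \<partial>lborel) \<le> ennreal (t - t0)"
    using assms by simp
qed

locale stable_semigroup_noise = brownian_motion M W
  for M :: "'w measure" and W :: "real \<Rightarrow> 'w \<Rightarrow> real" +
  fixes U :: "real \<Rightarrow> 'h::{real_inner, banach, second_countable_topology} \<Rightarrow>\<^sub>L 'h"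
    and \<N> \<nu> :: real
  assumes semigroup: "C0_semigroup U" and N_pos: "\<N> > 0" and nu_pos: "\<nu> > 0"
    and U_bound: "\<And>t. t \<ge> 0 \<Longrightarrow> norm (U t) \<le> \<N> * exp (- \<nu> * t)"
begin

section \<open>Decay and joint continuity of the semigroup\<close>

lemma U_0: "U 0 = id_blinfun"
  using semigroup by (simp add: C0_semigroup_def)

lemma U_add: "s \<ge> 0 \<Longrightarrow> t \<ge> 0 \<Longrightarrow> U (s + t) x = U s (U t x)"
  using semigroup by (simp add: C0_semigroup_def)

lemma norm_U_apply: "t \<ge> 0 \<Longrightarrow> norm (U t x) \<le> \<N> * exp (- \<nu> * t) * norm x"
  using norm_blinfun[of "U t" x] U_bound[of t] by (meson mult_right_mono norm_ge_zero order_trans)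

lemma norm_U_apply_le: "t \<ge> 0 \<Longrightarrow> norm (U t x) \<le> \<N> * norm x"
proof -
  assume t: "t \<ge> 0"
  have "\<N> * exp (- \<nu> * t) \<le> \<N> * 1"
    using N_pos nu_pos t by (intro mult_left_mono) (auto simp: mult_nonneg_nonneg)
  hence "\<N> * exp (- \<nu> * t) * norm x \<le> \<N> * norm x" by (intro mult_right_mono) auto
  thus "norm (U t x) \<le> \<N> * norm x" using norm_U_apply[OF t] by (rule order_trans[rotated])
qed

text \<open>The natural decay exp(-2 \<nu> t) is weakened to exp(-\<nu> t), the kernel that
  Cauchy-Schwarz leaves in the drift. Initial value, drift and noise then share one kernel, and a
  single Gronwall argument covers them.\<close>

lemma norm_U_sq: "t \<ge> 0 \<Longrightarrow> (norm (U t))\<^sup>2 \<le> \<N>\<^sup>2 * exp (- \<nu> * t)"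
proof -
  assume t: "t \<ge> 0"
  have "(norm (U t))\<^sup>2 \<le> (\<N> * exp (- \<nu> * t))\<^sup>2"
    using U_bound[OF t] by (intro power_mono) auto
  also have "\<dots> = \<N>\<^sup>2 * (exp (- \<nu> * t) * exp (- \<nu> * t))" by (simp add: power2_eq_square)
  also have "\<dots> \<le> \<N>\<^sup>2 * (1 * exp (- \<nu> * t))"
    using t nu_pos by (intro mult_left_mono mult_right_mono) auto
  finally show ?thesis by simp
qed

text \<open>For t \<le> s the difference is U(t) applied to U(s - t) x - x. Both one-sided limits at
  any time thus reduce to the right limit at 0, the only continuity in the definition of the
  semigroup.\<close>

lemma U_diff_le:
  assumes "s \<ge> 0" "t \<ge> 0"
  shows "norm (U s x - U t x) \<le> \<N> * norm (U \<bar>s - t\<bar> x - x)"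
proof -
  have le: "norm (U s x - U t x) \<le> \<N> * norm (U (s - t) x - x)" if "t \<le> s" "t \<ge> 0" for s t
  proof -
    have "U s x - U t x = U t (U (s - t) x - x)"
      using U_add[of t "s - t" x] that by (simp add: blinfun.diff_right)
    thus ?thesis using norm_U_apply_le[OF that(2)] by simp
  qed
  show ?thesis
    using le[of t s] le[of s t] assms by (cases "t \<le> s") (auto simp: norm_minus_commute)
qed

text \<open>The uniform bound \<open>\<N>\<close> on the operators upgrades continuity of each orbit
  to joint continuity in time and vector.\<close>

lemma U_continuous: "continuous_on ({0..} \<times> UNIV) (\<lambda>(t, x). U t x)"
  unfolding continuous_on_def
proof
  fix p :: "real \<times> 'h" assume p: "p \<in> {0..} \<times> UNIV"
  obtain t x where tx: "p = (t, x)" "t \<ge> 0" using p by auto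
  let ?F = "at p within {0..} \<times> UNIV"
  have lim: "((\<lambda>q. fst q) \<longlongrightarrow> t) ?F" "((\<lambda>q. snd q) \<longlongrightarrow> x) ?F"
    using tendsto_fst[OF tendsto_ident_at, of p] tendsto_snd[OF tendsto_ident_at, of p] by (auto simp: tx)
  have c0: "continuous (at 0 within {0..}) (\<lambda>h. U h x)"
    using semigroup U_0 by (simp add: C0_semigroup_def continuous_within at_within_Ici_at_right)
  have "((\<lambda>q. \<bar>fst q - t\<bar>) \<longlongrightarrow> \<bar>t - t\<bar>) ?F" by (intro tendsto_intros lim)
  hence "((\<lambda>q. U \<bar>fst q - t\<bar> x) \<longlongrightarrow> U 0 x) ?F"
    by (intro continuous_within_tendsto_compose[OF c0]) auto
  hence "((\<lambda>q. \<N> * norm (snd q - x) + \<N> * norm (U \<bar>fst q - t\<bar> x - x)) \<longlongrightarrow> \<N> * norm (x - x) + \<N> * norm (x - x)) ?F"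
    by (intro tendsto_intros lim) (simp add: U_0)
  hence lim0: "((\<lambda>q. \<N> * norm (snd q - x) + \<N> * norm (U \<bar>fst q - t\<bar> x - x)) \<longlongrightarrow> 0) ?F" by simp
  have "((\<lambda>q. (case q of (t, x) \<Rightarrow> U t x) - U t x) \<longlongrightarrow> 0) ?F"
  proof (rule Lim_null_comparison[OF _ lim0])
    show "\<forall>\<^sub>F q in ?F. norm ((case q of (t, x) \<Rightarrow> U t x) - U t x) \<le>
       \<N> * norm (snd q - x) + \<N> * norm (U \<bar>fst q - t\<bar> x - x)"
      unfolding eventually_at_filter
    proof (intro always_eventually allI impI)
      fix q :: "real \<times> 'h" assume "q \<in> {0..} \<times> UNIV"
      then obtain s y where q: "q = (s, y)" "s \<ge> 0" by auto
      have "norm (U s y - U t x) \<le> norm (U s y - U s x) + norm (U s x - U t x)"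
        using norm_triangle_ineq[of "U s y - U s x" "U s x - U t x"] by simp
      also have "norm (U s y - U s x) \<le> \<N> * norm (y - x)"
        using norm_U_apply_le[OF q(2), of "y - x"] by (simp add: blinfun.diff_right)
      also have "norm (U s x - U t x) \<le> \<N> * norm (U \<bar>s - t\<bar> x - x)"
        using q tx by (intro U_diff_le)
      finally show "norm ((case q of (t, x) \<Rightarrow> U t x) - U t x) \<le>
         \<N> * norm (snd q - x) + \<N> * norm (U \<bar>fst q - t\<bar> x - x)" using q by simp
    qed
  qed
  thus "((\<lambda>(t, x). U t x) \<longlongrightarrow> (case p of (t, x) \<Rightarrow> U t x)) ?F"
    unfolding tx by (simp add: LIM_zero_iff)
qed

lemma U_shift_continuous: "continuous_on ({a..t} \<times> UNIV) (\<lambda>(s, y). U (t - s) y)"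
proof -
  have "continuous_on ({a..t} \<times> UNIV) (\<lambda>p::real \<times> 'h. (t - fst p, snd p))"
    by (intro continuous_intros)
  from continuous_on_compose2[OF U_continuous this] show ?thesis by (simp add: split_def image_subset_iff)
qed

lemma U_orbit_continuous: "continuous_on {r..} (\<lambda>s. U (s - r) y)"
proof -
  have "continuous_on {r..} (\<lambda>s. (s - r, y))"
    by (intro continuous_intros)
  from continuous_on_compose2[OF U_continuous this] show ?thesis by (simp add: image_subset_iff)
qed

lemma measurable_process_on_U:
  "measurable_process_on N a t f \<Longrightarrow> measurable_process_on N a t (\<lambda>s \<omega>. U (t - s) (f s \<omega>))"
  by (rule measurable_process_on_compose[where \<Phi> = "\<lambda>s. blinfun_apply (U (t - s))", OF _ U_shift_continuous])

text \<open>\<open>N\<close> is left arbitrary: with \<open>M\<close> the lemma serves the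
  estimates, with \<open>Filt t\<close> the adaptedness of the drift.\<close>

lemma drift_measurable:
  assumes "measurable_process_on N a t f"
  shows "(\<lambda>\<omega>. LINT s:{a..t}|lborel. U (t - s) (f s \<omega>)) \<in> borel_measurable N"
proof -
  have "(\<lambda>(s, \<omega>). indicator {a..t} s *\<^sub>R U (t - s) (f s \<omega>)) \<in> borel_measurable (lborel \<Otimes>\<^sub>M N)"
    using measurable_process_on_U[OF assms] by (simp add: measurable_process_on_iff)
  hence "(\<lambda>(\<omega>, s). indicator {a..t} s *\<^sub>R U (t - s) (f s \<omega>)) \<in> borel_measurable (N \<Otimes>\<^sub>M lborel)"
    by (subst measurable_pair_swap_iff) simp
  thus ?thesis
    unfolding set_lebesgue_integral_def by (rule lborel.borel_measurable_lebesgue_integral)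
qed

section \<open>Estimates for the drift and noise convolutions\<close>

abbreviation damped :: "real \<Rightarrow> real \<Rightarrow> (real \<Rightarrow> ennreal) \<Rightarrow> ennreal" where
  "damped t0 t h \<equiv> (\<integral>\<^sup>+s\<in>{t0..t}. ennreal (exp (- \<nu> * (t - s))) * h s \<partial>lborel)"

abbreviation drift :: "real \<Rightarrow> real \<Rightarrow> (real \<Rightarrow> 'w \<Rightarrow> 'h) \<Rightarrow> 'w \<Rightarrow> 'h" where
  "drift t0 t f \<omega> \<equiv> (LINT s:{t0..t}|lborel. U (t - s) (f s \<omega>))"

lemma nl2_diff_measurable:
  fixes f f' :: "real \<Rightarrow> 'w \<Rightarrow> 'h"
  assumes "measurable_process_on M a b f" "measurable_process_on M a b f'"
  shows "(\<lambda>s. nl2d M (f s) (f' s) * indicator {a..b} s) \<in> borel_measurable lborel"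
proof -
  have [measurable]: "(\<lambda>(s, \<omega>). indicator {a..b} s *\<^sub>R f s \<omega>) \<in> borel_measurable (lborel \<Otimes>\<^sub>M M)"
    "(\<lambda>(s, \<omega>). indicator {a..b} s *\<^sub>R f' s \<omega>) \<in> borel_measurable (lborel \<Otimes>\<^sub>M M)"
    using assms by (auto simp: measurable_process_on_iff)
  have "nl2d M (f s) (f' s) * indicator {a..b} s =
     (\<integral>\<^sup>+\<omega>. ennreal ((norm ((\<lambda>(s, \<omega>). indicator {a..b} s *\<^sub>R f s \<omega>) (s, \<omega>) - (\<lambda>(s, \<omega>). indicator {a..b} s *\<^sub>R f' s \<omega>) (s, \<omega>)))\<^sup>2) \<partial>M)" for s
    by (cases "s \<in> {a..b}") (auto simp: nl2_def)
  thus ?thesis by simp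
qed

lemma nl2_ito_diff_le:
  assumes I: "has_ito_integral M W t0 t (\<lambda>s \<omega>. U (t - s) (g s \<omega>)) I"
    "has_ito_integral M W t0 t (\<lambda>s \<omega>. U (t - s) (g' s \<omega>)) I'"
    and g: "measurable_process_on M t0 t g" "measurable_process_on M t0 t g'"
  shows "nl2d M I I' \<le> ennreal (\<N>\<^sup>2) *
    (damped t0 t (\<lambda>s. nl2d M (g s) (g' s)))"
proof -
  let ?f = "\<lambda>(s, \<omega>). indicator {t0<..t} s *\<^sub>R U (t - s) (g s \<omega>)"
  let ?f' = "\<lambda>(s, \<omega>). indicator {t0<..t} s *\<^sub>R U (t - s) (g' s \<omega>)"
  have l: "ito_lim ?f I" "ito_lim ?f' I'"
    using I by (auto dest: has_ito_integral_imp_ito_lim)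
  hence [measurable]: "?f \<in> borel_measurable (lborel \<Otimes>\<^sub>M M)" "?f' \<in> borel_measurable (lborel \<Otimes>\<^sub>M M)"
    by (auto simp: ito_lim_def)
  have "nl2d M I I' \<le> nl2 (lborel \<Otimes>\<^sub>M M) (\<lambda>p. ?f p - ?f' p)"
    by (rule ito_lim_bound[OF ito_lim_diff[OF l]])
  also have "\<dots> = (\<integral>\<^sup>+s. nl2 M (\<lambda>\<omega>. ?f (s, \<omega>) - ?f' (s, \<omega>)) \<partial>lborel)"
    unfolding nl2_def by (rule nn_integral_fst[symmetric]) measurable
  also have "\<dots> \<le> (\<integral>\<^sup>+s. ennreal (\<N>\<^sup>2) * (ennreal (exp (- \<nu> * (t - s))) * nl2d M (g s) (g' s) * indicator {t0..t} s) \<partial>lborel)"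
  proof (intro nn_integral_mono)
    fix s :: real
    show "nl2 M (\<lambda>\<omega>. ?f (s, \<omega>) - ?f' (s, \<omega>)) \<le>
      ennreal (\<N>\<^sup>2) * (ennreal (exp (- \<nu> * (t - s))) * nl2d M (g s) (g' s) * indicator {t0..t} s)"
    proof (cases "s \<in> {t0<..t}")
      case True
      have "nl2 M (\<lambda>\<omega>. ?f (s, \<omega>) - ?f' (s, \<omega>)) = nl2 M (\<lambda>\<omega>. U (t - s) (g s \<omega> - g' s \<omega>))"
        using True by (simp add: blinfun.diff_right)
      also have "\<dots> \<le> ennreal ((norm (U (t - s)))\<^sup>2) * nl2d M (g s) (g' s)"
        using measurable_process_on_section[OF g(1), of s] measurable_process_on_section[OF g(2), of s] True
        by (intro nl2_blinfun_le borel_measurable_diff) auto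
      also have "\<dots> \<le> ennreal (\<N>\<^sup>2 * exp (- \<nu> * (t - s))) * nl2d M (g s) (g' s)"
        using True by (intro mult_right_mono ennreal_leI norm_U_sq) auto
      finally show ?thesis using True by (simp add: ennreal_mult mult_ac)
    next
      case False
      thus ?thesis by simp
    qed
  qed
  also have "\<dots> = ennreal (\<N>\<^sup>2) * (damped t0 t (\<lambda>s. nl2d M (g s) (g' s)))"
  proof (rule nn_integral_cmult)
    have "(\<lambda>s. ennreal (exp (- \<nu> * (t - s))) * (nl2d M (g s) (g' s) * indicator {t0..t} s)) \<in> borel_measurable lborel"
      by (intro borel_measurable_times_ennreal nl2_diff_measurable g) measurable
    thus "(\<lambda>s. ennreal (exp (- \<nu> * (t - s))) * nl2d M (g s) (g' s) * indicator {t0..t} s) \<in> borel_measurable lborel"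
      by (simp add: mult.assoc)
  qed
  finally show ?thesis .
qed

text \<open>Cauchy-Schwarz takes the kernel itself as weight: its mass 1/\<nu> is paid once, and the
  kernel stays inside the remaining integral, as the Gronwall argument requires. Fubini's theorem
  then exchanges expectation and time.\<close>

lemma nl2_drift_diff_le:
  assumes "t0 \<le> t"
    and f: "measurable_process_on M t0 t f" "measurable_process_on M t0 t f'"
    and int: "AE \<omega> in M. set_integrable lborel {t0..t} (\<lambda>s. U (t - s) (f s \<omega>))"
      "AE \<omega> in M. set_integrable lborel {t0..t} (\<lambda>s. U (t - s) (f' s \<omega>))"
  shows "nl2 M (\<lambda>\<omega>. drift t0 t f \<omega> - drift t0 t f' \<omega>)
    \<le> ennreal (\<N>\<^sup>2 / \<nu>) *
      (damped t0 t (\<lambda>s. nl2d M (f s) (f' s)))"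
proof -
  interpret pair_sigma_finite lborel M ..
  define d where "d s \<omega> = indicator {t0..t} s *\<^sub>R f s \<omega> - indicator {t0..t} s *\<^sub>R f' s \<omega>" for s \<omega>
  have d_meas [measurable]: "(\<lambda>(s, \<omega>). d s \<omega>) \<in> borel_measurable (lborel \<Otimes>\<^sub>M M)"
    unfolding d_def using f
    by (simp add: measurable_process_on_iff split_def borel_measurable_diff)
  define w where "w s = indicator {t0..t} s * exp (- \<nu> * (t - s))" for s
  have [measurable]: "w \<in> borel_measurable lborel" unfolding w_def by measurable
  have w_nn: "w s \<ge> 0" for s by (simp add: w_def)
  have w_int: "(\<integral>\<^sup>+s. ennreal (w s) \<partial>lborel) \<le> ennreal (1 / \<nu>)"
    using nn_integral_exp_decay(1)[OF nu_pos assms(1)]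
    by (simp add: w_def ennreal_mult' ennreal_indicator mult.commute)
  have "nl2 M (\<lambda>\<omega>. drift t0 t f \<omega> - drift t0 t f' \<omega>)
    \<le> (\<integral>\<^sup>+\<omega>. ennreal (\<N>\<^sup>2 / \<nu>) * (\<integral>\<^sup>+s. ennreal (w s * (norm (d s \<omega>))\<^sup>2) \<partial>lborel) \<partial>M)"
    unfolding nl2_def
  proof (rule nn_integral_mono_AE)
    show "AE \<omega> in M. ennreal ((norm (drift t0 t f \<omega> - drift t0 t f' \<omega>))\<^sup>2)
        \<le> ennreal (\<N>\<^sup>2 / \<nu>) * (\<integral>\<^sup>+s. ennreal (w s * (norm (d s \<omega>))\<^sup>2) \<partial>lborel)"
      using int AE_space
    proof eventually_elim
      case (elim \<omega>)
      have [measurable]: "(\<lambda>s. d s \<omega>) \<in> borel_measurable lborel"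
        using measurable_compose[OF measurable_Pair2'[OF elim(3)] d_meas] by simp
      let ?D = "\<lambda>s. indicator {t0..t} s *\<^sub>R U (t - s) (f s \<omega>) - indicator {t0..t} s *\<^sub>R U (t - s) (f' s \<omega>)"
      have i: "integrable lborel (\<lambda>s. indicator {t0..t} s *\<^sub>R U (t - s) (f s \<omega>))"
        "integrable lborel (\<lambda>s. indicator {t0..t} s *\<^sub>R U (t - s) (f' s \<omega>))"
        using elim(1,2) by (auto simp: set_integrable_def)
      have "drift t0 t f \<omega> - drift t0 t f' \<omega> = (\<integral>s. ?D s \<partial>lborel)"
        unfolding set_lebesgue_integral_def using i by (rule Bochner_Integration.integral_diff[symmetric])
      moreover have "ennreal (norm (\<integral>s. ?D s \<partial>lborel)) \<le> (\<integral>\<^sup>+s. ennreal (norm (?D s)) \<partial>lborel)"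
        using i by (intro integral_norm_bound_ennreal Bochner_Integration.integrable_diff)
      moreover have "(\<integral>\<^sup>+s. ennreal (norm (?D s)) \<partial>lborel) \<le> (\<integral>\<^sup>+s. ennreal \<N> * ennreal (w s * norm (d s \<omega>)) \<partial>lborel)"
      proof (intro nn_integral_mono)
        fix s
        show "ennreal (norm (?D s)) \<le> ennreal \<N> * ennreal (w s * norm (d s \<omega>))"
        proof (cases "s \<in> {t0..t}")
          case True
          have "norm (?D s) = norm (U (t - s) (f s \<omega> - f' s \<omega>))"
            using True by (simp add: blinfun.diff_right)
          also have "\<dots> \<le> \<N> * exp (- \<nu> * (t - s)) * norm (f s \<omega> - f' s \<omega>)"
            using True by (intro norm_U_apply) auto
          finally show ?thesis
            using True N_pos by (auto simp: w_def d_def mult.assoc simp flip: ennreal_mult intro!: ennreal_leI)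
        qed simp
      qed
      moreover have "(\<integral>\<^sup>+s. ennreal \<N> * ennreal (w s * norm (d s \<omega>)) \<partial>lborel) = ennreal \<N> * (\<integral>\<^sup>+s. ennreal (w s * norm (d s \<omega>)) \<partial>lborel)"
        by (rule nn_integral_cmult) measurable
      ultimately have "ennreal (norm (drift t0 t f \<omega> - drift t0 t f' \<omega>))
          \<le> ennreal \<N> * (\<integral>\<^sup>+s. ennreal (w s * norm (d s \<omega>)) \<partial>lborel)"
        by simp
      hence "(ennreal (norm (drift t0 t f \<omega> - drift t0 t f' \<omega>)))\<^sup>2
          \<le> (ennreal \<N> * (\<integral>\<^sup>+s. ennreal (w s * norm (d s \<omega>)) \<partial>lborel))\<^sup>2"
        by (intro power_mono) auto
      also have "\<dots> = ennreal (\<N>\<^sup>2) * (\<integral>\<^sup>+s. ennreal (w s * norm (d s \<omega>)) \<partial>lborel)\<^sup>2"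
        using N_pos by (simp add: power_mult_distrib ennreal_power)
      also have "\<dots> \<le> ennreal (\<N>\<^sup>2) * (ennreal (1 / \<nu>) * (\<integral>\<^sup>+s. ennreal (w s * (norm (d s \<omega>))\<^sup>2) \<partial>lborel))"
        using w_nn w_int nu_pos by (intro mult_left_mono nn_integral_weighted_Cauchy_Schwarz) auto
      also have "\<dots> = ennreal (\<N>\<^sup>2 / \<nu>) * (\<integral>\<^sup>+s. ennreal (w s * (norm (d s \<omega>))\<^sup>2) \<partial>lborel)"
        using nu_pos by (simp add: ennreal_mult[symmetric] mult.assoc[symmetric])
      finally show ?case by (simp add: ennreal_power)
    qed
  qed
  also have "\<dots> = ennreal (\<N>\<^sup>2 / \<nu>) * (\<integral>\<^sup>+\<omega>. (\<integral>\<^sup>+s. ennreal (w s * (norm (d s \<omega>))\<^sup>2) \<partial>lborel) \<partial>M)"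
    by (rule nn_integral_cmult) measurable
  also have "(\<integral>\<^sup>+\<omega>. (\<integral>\<^sup>+s. ennreal (w s * (norm (d s \<omega>))\<^sup>2) \<partial>lborel) \<partial>M) =
      (\<integral>\<^sup>+s. (\<integral>\<^sup>+\<omega>. ennreal (w s * (norm (d s \<omega>))\<^sup>2) \<partial>M) \<partial>lborel)"
    by (rule Fubini') measurable
  also have "\<dots> = (damped t0 t (\<lambda>s. nl2d M (f s) (f' s)))"
  proof (intro nn_integral_cong)
    fix s :: real
    have [measurable]: "d s \<in> borel_measurable M"
      using measurable_compose[OF measurable_Pair1'[of s lborel M] d_meas] by simp
    have "(\<integral>\<^sup>+\<omega>. ennreal (w s * (norm (d s \<omega>))\<^sup>2) \<partial>M) = ennreal (w s) * nl2 M (d s)"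
      unfolding nl2_def using w_nn by (simp add: ennreal_mult nn_integral_cmult)
    thus "(\<integral>\<^sup>+\<omega>. ennreal (w s * (norm (d s \<omega>))\<^sup>2) \<partial>M) =
      ennreal (exp (- \<nu> * (t - s))) * nl2d M (f s) (f' s) * indicator {t0..t} s"
      by (cases "s \<in> {t0..t}") (auto simp: w_def d_def[abs_def])
  qed
  finally show ?thesis .
qed

text \<open>The nonlinear terms are replaced by given processes \<open>f\<close>, \<open>g\<close>,
  and the value at time t by a separate \<open>Y\<close>. The same relation then expresses one
  Picard step, where \<open>Y\<close> is new, and the fixed point equation, where \<open>Y\<close>
  is the process at time t.\<close>

definition mild_at ::
  "real \<Rightarrow> ('w \<Rightarrow> 'h) \<Rightarrow> (real \<Rightarrow> 'w \<Rightarrow> 'h) \<Rightarrow> (real \<Rightarrow> 'w \<Rightarrow> 'h) \<Rightarrow> real \<Rightarrow> ('w \<Rightarrow> 'h) \<Rightarrow> bool" where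
  "mild_at t0 x0 f g t Y \<longleftrightarrow> (\<exists>I.
     has_ito_integral M W t0 t (\<lambda>s \<omega>. U (t - s) (g s \<omega>)) I \<and>
     (AE \<omega> in M. set_integrable lborel {t0..t} (\<lambda>s. U (t - s) (f s \<omega>))) \<and>
     (AE \<omega> in M. Y \<omega> = U (t - t0) (x0 \<omega>) + drift t0 t f \<omega> + I \<omega>))"

lemma mild_at_cong_AE:
  assumes "mild_at t0 x0 f g t Y" "AE \<omega> in M. Y' \<omega> = Y \<omega>"
  shows "mild_at t0 x0 f g t Y'"
proof -
  obtain I where I: "has_ito_integral M W t0 t (\<lambda>s \<omega>. U (t - s) (g s \<omega>)) I"
    "AE \<omega> in M. set_integrable lborel {t0..t} (\<lambda>s. U (t - s) (f s \<omega>))"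
    "AE \<omega> in M. Y \<omega> = U (t - t0) (x0 \<omega>) + drift t0 t f \<omega> + I \<omega>"
    using assms(1) unfolding mild_at_def by blast
  have "AE \<omega> in M. Y' \<omega> = U (t - t0) (x0 \<omega>) + drift t0 t f \<omega> + I \<omega>"
    using I(3) assms(2) by eventually_elim simp
  thus ?thesis unfolding mild_at_def using I(1,2) by blast
qed

lemma mild_at_estimate:
  assumes t: "t0 \<le> t" and Y: "mild_at t0 x0 f g t Y" "mild_at t0 x0' f' g' t Y'"
    and x0 [measurable]: "x0 \<in> borel_measurable M" "x0' \<in> borel_measurable M"
    and fg: "measurable_process_on M t0 t f" "measurable_process_on M t0 t f'"
      "measurable_process_on M t0 t g" "measurable_process_on M t0 t g'"
  shows "nl2d M Y Y' \<le> ennreal (3 * \<N>\<^sup>2) *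
    (ennreal (exp (- \<nu> * (t - t0))) * nl2d M x0 x0' +
     ennreal (1 / \<nu>) * (damped t0 t (\<lambda>s. nl2d M (f s) (f' s))) +
     (damped t0 t (\<lambda>s. nl2d M (g s) (g' s))))"
proof -
  let ?K = "\<lambda>f \<omega>. drift t0 t f \<omega>"
  let ?X = "damped t0 t (\<lambda>s. nl2d M (f s) (f' s))"
  let ?Z = "damped t0 t (\<lambda>s. nl2d M (g s) (g' s))"
  obtain I where I: "has_ito_integral M W t0 t (\<lambda>s \<omega>. U (t - s) (g s \<omega>)) I"
    "AE \<omega> in M. set_integrable lborel {t0..t} (\<lambda>s. U (t - s) (f s \<omega>))"
    "AE \<omega> in M. Y \<omega> = U (t - t0) (x0 \<omega>) + ?K f \<omega> + I \<omega>"
    using Y(1) unfolding mild_at_def by blast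
  obtain I' where I': "has_ito_integral M W t0 t (\<lambda>s \<omega>. U (t - s) (g' s \<omega>)) I'"
    "AE \<omega> in M. set_integrable lborel {t0..t} (\<lambda>s. U (t - s) (f' s \<omega>))"
    "AE \<omega> in M. Y' \<omega> = U (t - t0) (x0' \<omega>) + ?K f' \<omega> + I' \<omega>"
    using Y(2) unfolding mild_at_def by blast
  have [measurable]: "I \<in> borel_measurable M" "I' \<in> borel_measurable M"
    using I(1) I'(1) by (auto simp: has_ito_integral_def)
  note [measurable] = drift_measurable[OF fg(1)] drift_measurable[OF fg(2)]
  have "AE \<omega> in M. Y \<omega> - Y' \<omega> = U (t - t0) (x0 \<omega> - x0' \<omega>) + (?K f \<omega> - ?K f' \<omega>) + (I \<omega> - I' \<omega>)"
    using I(3) I'(3) by eventually_elim (simp add: blinfun.diff_right)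
  hence "nl2d M Y Y' =
      nl2 M (\<lambda>\<omega>. U (t - t0) (x0 \<omega> - x0' \<omega>) + (?K f \<omega> - ?K f' \<omega>) + (I \<omega> - I' \<omega>))"
    by (rule nl2_cong_AE)
  also have "\<dots> \<le> 3 * (nl2 M (\<lambda>\<omega>. U (t - t0) (x0 \<omega> - x0' \<omega>)) + nl2d M (?K f) (?K f') + nl2d M I I')"
    by (rule nl2_add3) measurable
  also have "\<dots> \<le> 3 * (ennreal (\<N>\<^sup>2) * (ennreal (exp (- \<nu> * (t - t0))) * nl2d M x0 x0') +
      ennreal (\<N>\<^sup>2 / \<nu>) * ?X + ennreal (\<N>\<^sup>2) * ?Z)"
  proof (intro mult_left_mono add_mono nl2_drift_diff_le nl2_ito_diff_le fg I I' t)
    have "nl2 M (\<lambda>\<omega>. U (t - t0) (x0 \<omega> - x0' \<omega>)) \<le> ennreal ((norm (U (t - t0)))\<^sup>2) * nl2d M x0 x0'"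
      by (rule nl2_blinfun_le) measurable
    also have "\<dots> \<le> ennreal (\<N>\<^sup>2 * exp (- \<nu> * (t - t0))) * nl2d M x0 x0'"
      using t by (intro mult_right_mono ennreal_leI norm_U_sq) auto
    finally show "nl2 M (\<lambda>\<omega>. U (t - t0) (x0 \<omega> - x0' \<omega>)) \<le>
       ennreal (\<N>\<^sup>2) * (ennreal (exp (- \<nu> * (t - t0))) * nl2d M x0 x0')"
      by (simp add: ennreal_mult mult.assoc)
  qed auto
  also have "\<dots> = ennreal (3 * \<N>\<^sup>2) * (ennreal (exp (- \<nu> * (t - t0))) * nl2d M x0 x0' +
      ennreal (1 / \<nu>) * ?X + ?Z)"
  proof -
    have "ennreal (\<N>\<^sup>2 / \<nu>) = ennreal (\<N>\<^sup>2) * ennreal (1 / \<nu>)"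
      using nu_pos by (simp flip: ennreal_mult)
    moreover have "ennreal (3 * \<N>\<^sup>2) = 3 * ennreal (\<N>\<^sup>2)" by (simp add: ennreal_mult)
    ultimately show ?thesis by (simp add: distrib_left mult.assoc)
  qed
  finally show ?thesis .
qed

text \<open>Used with b = 1/\<nu> for bounds uniform in time and with b = t - t0 for short
  intervals.\<close>

lemma mild_at_estimate_const:
  assumes t: "t0 \<le> t" and Y: "mild_at t0 x0 f g t Y" "mild_at t0 x0' f' g' t Y'"
    and x0: "x0 \<in> borel_measurable M" "x0' \<in> borel_measurable M"
    and fg: "measurable_process_on M t0 t f" "measurable_process_on M t0 t f'"
      "measurable_process_on M t0 t g" "measurable_process_on M t0 t g'"
    and a: "\<And>s. s \<in> {t0..t} \<Longrightarrow> nl2d M (f s) (f' s) \<le> ennreal a"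
      "\<And>s. s \<in> {t0..t} \<Longrightarrow> nl2d M (g s) (g' s) \<le> ennreal a" "a \<ge> 0"
    and b: "(\<integral>\<^sup>+s\<in>{t0..t}. ennreal (exp (- \<nu> * (t - s))) \<partial>lborel) \<le> ennreal b" "b \<ge> 0"
  shows "nl2d M Y Y' \<le> ennreal (3 * \<N>\<^sup>2) *
    (ennreal (exp (- \<nu> * (t - t0))) * nl2d M x0 x0' + ennreal ((1 / \<nu> + 1) * a * b))"
proof -
  have le: "(damped t0 t h) \<le> ennreal (a * b)"
    if "\<And>s. s \<in> {t0..t} \<Longrightarrow> h s \<le> ennreal a" for h
  proof -
    have "(damped t0 t h) \<le>
       (\<integral>\<^sup>+s. ennreal a * (ennreal (exp (- \<nu> * (t - s))) * indicator {t0..t} s) \<partial>lborel)"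
    proof (intro nn_integral_mono)
      fix s
      show "ennreal (exp (- \<nu> * (t - s))) * h s * indicator {t0..t} s \<le>
        ennreal a * (ennreal (exp (- \<nu> * (t - s))) * indicator {t0..t} s)"
        using mult_left_mono[OF that[of s], of "ennreal (exp (- \<nu> * (t - s)))"]
        by (cases "s \<in> {t0..t}") (auto simp: mult.commute)
    qed
    also have "\<dots> = ennreal a * (\<integral>\<^sup>+s\<in>{t0..t}. ennreal (exp (- \<nu> * (t - s))) \<partial>lborel)"
      by (rule nn_integral_cmult) measurable
    also have "\<dots> \<le> ennreal a * ennreal b" by (intro mult_left_mono b) auto
    finally show ?thesis using a b by (simp add: ennreal_mult)
  qed
  have "ennreal (1 / \<nu>) * ennreal (a * b) + ennreal (a * b) = ennreal ((1 / \<nu> + 1) * a * b)"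
    using nu_pos a b by (simp add: distrib_right flip: ennreal_mult ennreal_plus)
  moreover have "ennreal (1 / \<nu>) * (damped t0 t (\<lambda>s. nl2d M (f s) (f' s)))
      + (damped t0 t (\<lambda>s. nl2d M (g s) (g' s))) \<le>
      ennreal (1 / \<nu>) * ennreal (a * b) + ennreal (a * b)"
    using a by (intro add_mono mult_left_mono le) auto
  ultimately show ?thesis
    by (intro order_trans[OF mild_at_estimate[OF t Y x0 fg]] mult_left_mono)
       (auto simp: add.assoc intro: add_left_mono)
qed

section \<open>Existence, flow property and regularity for given integrands\<close>

lemma l2proc_U:
  assumes f: "l2proc t0 f" and t: "t0 \<le> t"
  shows "l2cont M {t0..t} (\<lambda>s \<omega>. U (t - s) (f s \<omega>))"
    "\<And>s. s \<in> {t0..t} \<Longrightarrow> square_integrable M (\<lambda>\<omega>. U (t - s) (f s \<omega>))"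
    "\<And>s. s \<in> {t0..t} \<Longrightarrow> norm2 M (\<lambda>\<omega>. U (t - s) (f s \<omega>)) \<le> \<N> * norm2 M (f s)"
proof -
  have lip: "norm (U (t - s) y - U (t - s) z) \<le> \<N> * norm (y - z)" if "s \<in> {t0..t}" for s y z
    using norm_U_apply_le[of "t - s" "y - z"] that by (simp add: blinfun.diff_right)
  have sq: "square_integrable M (f s)" if "s \<in> {t0..t}" for s
    using l2procD(2)[OF f] that by auto
  have c: "l2cont M {t0..t} f" using l2procD(4)[OF f] by (rule l2cont_subset) auto
  note * = l2cont_compose[where \<Phi> = "\<lambda>s. blinfun_apply (U (t - s))" and K = \<N> and C = 0 and T = "{t0..t}",
      OF U_shift_continuous lip _ less_imp_le[OF N_pos] order.refl sq c]
  show "l2cont M {t0..t} (\<lambda>s \<omega>. U (t - s) (f s \<omega>))"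
    "\<And>s. s \<in> {t0..t} \<Longrightarrow> square_integrable M (\<lambda>\<omega>. U (t - s) (f s \<omega>))"
    "\<And>s. s \<in> {t0..t} \<Longrightarrow> norm2 M (\<lambda>\<omega>. U (t - s) (f s \<omega>)) \<le> \<N> * norm2 M (f s)"
    using * by (auto simp: blinfun.zero_right)
qed

text \<open>First moments are bounded by \<open>norm2\<close>, so by Fubini's theorem the expected
  time integral of the norm is at most \<open>\<N> * C\<close> times the length of the
  interval.\<close>

lemma l2proc_set_integrable:
  assumes f: "l2proc t0 f" and t: "t0 \<le> t"
  shows "AE \<omega> in M. set_integrable lborel {t0..t} (\<lambda>s. U (t - s) (f s \<omega>))"
proof -
  interpret pair_sigma_finite lborel M ..
  obtain C where C: "\<And>s. s \<ge> t0 \<Longrightarrow> norm2 M (f s) \<le> C" using l2procD(3)[OF f] by blast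
  define d where "d s \<omega> = indicator {t0..t} s *\<^sub>R U (t - s) (f s \<omega>)" for s \<omega>
  have d_meas [measurable]: "(\<lambda>(s, \<omega>). d s \<omega>) \<in> borel_measurable (lborel \<Otimes>\<^sub>M M)"
    unfolding d_def using measurable_process_on_U[OF l2procD(6)[OF f t]] by (simp add: measurable_process_on_iff)
  have "(\<integral>\<^sup>+\<omega>. (\<integral>\<^sup>+s. ennreal (norm (d s \<omega>)) \<partial>lborel) \<partial>M) = (\<integral>\<^sup>+s. (\<integral>\<^sup>+\<omega>. ennreal (norm (d s \<omega>)) \<partial>M) \<partial>lborel)"
    by (rule Fubini') measurable
  also have "\<dots> \<le> (\<integral>\<^sup>+s. ennreal (\<N> * C) * indicator {t0..t} s \<partial>lborel)"
  proof (intro nn_integral_mono)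
    fix s
    show "(\<integral>\<^sup>+\<omega>. ennreal (norm (d s \<omega>)) \<partial>M) \<le> ennreal (\<N> * C) * indicator {t0..t} s"
    proof (cases "s \<in> {t0..t}")
      case True
      note sq = l2proc_U(2)[OF f t True]
      have "(\<integral>\<^sup>+\<omega>. ennreal (norm (d s \<omega>)) \<partial>M) = ennreal (\<integral>\<omega>. norm (U (t - s) (f s \<omega>)) \<partial>M)"
        using True expectation_norm_le_norm2(1)[OF sq] by (simp add: d_def nn_integral_eq_integral)
      also have "\<dots> \<le> ennreal (\<N> * C)"
        using expectation_norm_le_norm2(2)[OF sq] l2proc_U(3)[OF f t True] C[of s] True N_pos
        by (intro ennreal_leI) (auto intro!: order_trans[OF _ mult_left_mono[of "norm2 M (f s)" C]])
      finally show ?thesis using True by simp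
    qed (simp add: d_def)
  qed
  also have "\<dots> < \<infinity>"
    using t by (simp add: nn_integral_cmult_indicator ennreal_mult_less_top)
  finally have fin: "AE \<omega> in M. (\<integral>\<^sup>+s. ennreal (norm (d s \<omega>)) \<partial>lborel) \<noteq> \<infinity>"
    by (intro nn_integral_PInf_AE) auto
  show ?thesis
    using fin AE_space
  proof eventually_elim
    case (elim \<omega>)
    have "(\<lambda>s. d s \<omega>) \<in> borel_measurable lborel"
      using measurable_compose[OF measurable_Pair2'[OF elim(2)] d_meas] by simp
    hence "integrable lborel (\<lambda>s. d s \<omega>)"
      using elim(1) by (intro integrableI_bounded) (auto simp: less_top)
    thus ?case by (simp add: set_integrable_def d_def)
  qed
qed

lemma ito_exists_U:
  assumes g: "l2proc t0 g" and t: "t0 \<le> t"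
  shows "\<exists>I. has_ito_integral M W t0 t (\<lambda>s \<omega>. U (t - s) (g s \<omega>)) I \<and> I \<in> borel_measurable (Filt t)"
proof -
  obtain C where C: "\<And>s. s \<ge> t0 \<Longrightarrow> norm2 M (g s) \<le> C" using l2procD(3)[OF g] by blast
  show ?thesis
  proof (rule ito_exists[OF t])
    show "measurable_process_on M t0 t (\<lambda>s \<omega>. U (t - s) (g s \<omega>))"
      by (rule measurable_process_on_U[OF l2procD(6)[OF g t]])
    show "(\<lambda>\<omega>. U (t - s) (g s \<omega>)) \<in> borel_measurable (Filt s)" if "s \<in> {t0..t}" for s
      using l2procD(5)[OF g, of s] that by (intro borel_measurable_blinfun_const) auto
    show "norm2 M (\<lambda>\<omega>. U (t - s) (g s \<omega>)) \<le> \<N> * C" if "s \<in> {t0..t}" for s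
      using l2proc_U(3)[OF g t that] C[of s] that N_pos
      by (auto intro: order_trans[OF _ mult_left_mono[of "norm2 M (g s)" C]])
  qed (use l2proc_U[OF g t] in auto)
qed

lemma mild_at_exists:
  assumes f: "l2proc t0 f" and g: "l2proc t0 g" and x0: "x0 \<in> borel_measurable (Filt t0)" and t: "t0 \<le> t"
  shows "\<exists>Y. mild_at t0 x0 f g t Y \<and> Y \<in> borel_measurable (Filt t)"
proof -
  obtain I where I: "has_ito_integral M W t0 t (\<lambda>s \<omega>. U (t - s) (g s \<omega>)) I" "I \<in> borel_measurable (Filt t)"
    using ito_exists_U[OF g t] by blast
  let ?Y = "\<lambda>\<omega>. U (t - t0) (x0 \<omega>) + drift t0 t f \<omega> + I \<omega>"
  have "mild_at t0 x0 f g t ?Y"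
    unfolding mild_at_def using I(1) l2proc_set_integrable[OF f t] by auto
  moreover have "?Y \<in> borel_measurable (Filt t)"
    using measurable_Filt_mono[OF x0 t] drift_measurable[OF l2procD(1)[OF f t]] I(2)
    by (intro borel_measurable_add borel_measurable_blinfun_const)
  ultimately show ?thesis by blast
qed

text \<open>A comparison solution: the distance to it turns difference estimates into bounds for a
  single solution, or for its deviation from the free orbit. The integral of the zero integrand
  vanishes by the isometry bound.\<close>

lemma mild_at_zero:
  assumes t: "t0 \<le> t"
  shows "mild_at t0 x0 (\<lambda>_ _. 0) (\<lambda>_ _. 0) t (\<lambda>\<omega>. U (t - t0) (x0 \<omega>))"
proof -
  obtain I where I: "has_ito_integral M W t0 t (\<lambda>s \<omega>. U (t - s) (0 :: 'h)) I"
    using ito_exists_U[OF l2proc_zero t] by blast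
  have m: "I \<in> borel_measurable M" using I by (simp add: has_ito_integral_def)
  have "nl2 M I \<le> nl2 (lborel \<Otimes>\<^sub>M M) (\<lambda>(s, \<omega>). indicator {t0<..t} s *\<^sub>R U (t - s) (0 :: 'h))"
    using ito_lim_bound[OF has_ito_integral_imp_ito_lim[OF I]] .
  also have "\<dots> = 0" by (simp add: split_def blinfun.zero_right)
  finally have "nl2 M I = 0" by simp
  hence "AE \<omega> in M. I \<omega> = 0" using m by (simp add: nl2_eq_0_iff)
  hence "AE \<omega> in M. U (t - t0) (x0 \<omega>) = U (t - t0) (x0 \<omega>) + (LINT s:{t0..t}|lborel. U (t - s) 0) + I \<omega>"
    by eventually_elim (simp add: blinfun.zero_right set_lebesgue_integral_def)
  thus ?thesis
    unfolding mild_at_def using I by (auto intro!: exI[of _ I] simp: blinfun.zero_right set_integrable_def)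
qed

text \<open>From U(t - s) = U(t - r) U(r - s) for s \<le> r, the operator U(t - r) is pulled out of
  both integrals over [t0, r]. On the stochastic side the integral over [r, t] is identified by
  subtracting integrands and using uniqueness of the limit integral.\<close>

lemma mild_at_flow:
  assumes f: "l2proc t0 f" and g: "l2proc t0 g" and r: "t0 \<le> r" "r \<le> t"
    and Yr: "mild_at t0 x0 f g r Yr" and Y: "mild_at t0 x0 f g t Y"
  shows "mild_at r Yr f g t Y"
proof -
  have t: "t0 \<le> t" using r by simp
  obtain J where J: "has_ito_integral M W t0 r (\<lambda>s \<omega>. U (r - s) (g s \<omega>)) J"
    "AE \<omega> in M. set_integrable lborel {t0..r} (\<lambda>s. U (r - s) (f s \<omega>))"
    "AE \<omega> in M. Yr \<omega> = U (r - t0) (x0 \<omega>) + drift t0 r f \<omega> + J \<omega>"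
    using Yr unfolding mild_at_def by blast
  obtain I where I: "has_ito_integral M W t0 t (\<lambda>s \<omega>. U (t - s) (g s \<omega>)) I"
    "AE \<omega> in M. set_integrable lborel {t0..t} (\<lambda>s. U (t - s) (f s \<omega>))"
    "AE \<omega> in M. Y \<omega> = U (t - t0) (x0 \<omega>) + drift t0 t f \<omega> + I \<omega>"
    using Y unfolding mild_at_def by blast
  obtain I' where I': "has_ito_integral M W r t (\<lambda>s \<omega>. U (t - s) (g s \<omega>)) I'"
    using ito_exists_U[OF l2proc_later[OF g r(1)] r(2)] by blast
  have split_U: "U (t - s) y = U (t - r) (U (r - s) y)" if "s \<le> r" for s y
    using U_add[of "t - r" "r - s" y] r that by simp
  let ?f1 = "\<lambda>(s, \<omega>). indicator {t0<..t} s *\<^sub>R U (t - s) (g s \<omega>)"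
  let ?f2 = "\<lambda>p. U (t - r) ((\<lambda>(s, \<omega>). indicator {t0<..r} s *\<^sub>R U (r - s) (g s \<omega>)) p)"
  let ?f3 = "\<lambda>(s, \<omega>). indicator {r<..t} s *\<^sub>R U (t - s) (g s \<omega>)"
  have l: "ito_lim (\<lambda>p. ?f1 p - ?f2 p) (\<lambda>\<omega>. I \<omega> - U (t - r) (J \<omega>))" "ito_lim ?f3 I'"
    using I(1) J(1) I' by (auto intro!: ito_lim_diff ito_lim_blinfun has_ito_integral_imp_ito_lim)
  have "?f1 p - ?f2 p = ?f3 p" for p
  proof -
    obtain s \<omega> where p: "p = (s, \<omega>)" by (cases p)
    show ?thesis
      using split_U[of s "g s \<omega>"] r unfolding p by (auto simp: indicator_def blinfun.zero_right)
  qed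
  hence "ito_lim ?f3 (\<lambda>\<omega>. I \<omega> - U (t - r) (J \<omega>))" using l(1) by simp
  from ito_lim_unique[OF this l(2)] have AE_I: "AE \<omega> in M. I \<omega> - U (t - r) (J \<omega>) = I' \<omega>" .
  have int: "AE \<omega> in M. set_integrable lborel {r..t} (\<lambda>s. U (t - s) (f s \<omega>))"
    using I(2)
  proof eventually_elim
    case (elim \<omega>)
    show ?case by (rule set_integrable_subset[OF elim]) (use r in auto)
  qed
  have "AE \<omega> in M. Y \<omega> = U (t - r) (Yr \<omega>) + drift r t f \<omega> + I' \<omega>"
    using I(2,3) J(2,3) AE_I
  proof eventually_elim
    case (elim \<omega>)
    have i1: "set_integrable lborel {t0..r} (\<lambda>s. U (t - s) (f s \<omega>))"
      "set_integrable lborel {r<..t} (\<lambda>s. U (t - s) (f s \<omega>))"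
      by (rule set_integrable_subset[OF elim(1)]; use r in auto)+
    \<comment> \<open>The point \<open>r\<close> is assigned to the left piece to make the pieces
      disjoint; as a null set it is restored to the right piece below.\<close>
    have "drift t0 t f \<omega> = (LINT s:{t0..r} \<union> {r<..t}|lborel. U (t - s) (f s \<omega>))"
      using r by (simp add: ivl_disj_un)
    also have "\<dots> = (LINT s:{t0..r}|lborel. U (t - s) (f s \<omega>)) + (LINT s:{r<..t}|lborel. U (t - s) (f s \<omega>))"
      by (rule set_integral_Un[OF _ i1]) auto
    also have "(LINT s:{r<..t}|lborel. U (t - s) (f s \<omega>)) = drift r t f \<omega>"
    proof -
      have i2: "set_integrable lborel {r..t} (\<lambda>s. U (t - s) (f s \<omega>))"
        by (rule set_integrable_subset[OF elim(1)]) (use r in auto)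
      have "AE s in lborel. indicator {r<..t} s *\<^sub>R U (t - s) (f s \<omega>) = indicator {r..t} s *\<^sub>R U (t - s) (f s \<omega>)"
        using AE_lborel_singleton[of r] by eventually_elim (auto simp: indicator_def)
      with i1(2) i2 show ?thesis
        unfolding set_lebesgue_integral_def set_integrable_def
        by (intro integral_cong_AE borel_measurable_integrable)
    qed
    also have "(LINT s:{t0..r}|lborel. U (t - s) (f s \<omega>)) = U (t - r) (drift t0 r f \<omega>)"
    proof -
      have "(LINT s:{t0..r}|lborel. U (t - s) (f s \<omega>)) = (\<integral>s. U (t - r) (indicator {t0..r} s *\<^sub>R U (r - s) (f s \<omega>)) \<partial>lborel)"
        unfolding set_lebesgue_integral_def
        by (intro Bochner_Integration.integral_cong refl) (auto simp: indicator_def blinfun.zero_right split_U[of _ "f _ \<omega>"])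
      also have "\<dots> = U (t - r) (drift t0 r f \<omega>)"
        unfolding set_lebesgue_integral_def
        using elim(3) by (intro integral_bounded_linear blinfun.bounded_linear_right) (simp add: set_integrable_def)
      finally show ?thesis .
    qed
    finally have K: "drift t0 t f \<omega> =
      U (t - r) (drift t0 r f \<omega>) + drift r t f \<omega>" .
    have I: "I \<omega> = U (t - r) (J \<omega>) + I' \<omega>" using elim(5) by (simp add: algebra_simps)
    show ?case
      unfolding elim(2,4) K I split_U[OF r(1), of "x0 \<omega>"]
      by (simp only: blinfun.add_right ac_simps)
  qed
  thus ?thesis unfolding mild_at_def using I' int by blast
qed

text \<open>Boundedness comes from comparison with the zero solution. For continuity at t, both y(s)
  and y(t) are compared with the free orbit started from y(r) at one r shortly before t, or at r =
  t0: the errors are of order sqrt(s - r) and sqrt(t - r), and the orbit itself is mean-square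
  continuous by dominated convergence.\<close>

lemma mild_regular:
  assumes f: "l2proc t0 f" and g: "l2proc t0 g" and x0: "initial_value M W t0 x0"
    and y_all: "\<forall>t\<ge>t0. mild_at t0 x0 f g t (y t) \<and> y t \<in> borel_measurable (Filt t)"
  shows "\<And>t. t0 \<le> t \<Longrightarrow> square_integrable M (y t)" "\<exists>C. \<forall>t\<ge>t0. norm2 M (y t) \<le> C" "l2cont M {t0..} y"
proof -
  have y: "mild_at t0 x0 f g t (y t)" "y t \<in> borel_measurable (Filt t)" if "t0 \<le> t" for t
    using y_all that by auto
  obtain Cf where Cf: "\<And>s. s \<ge> t0 \<Longrightarrow> norm2 M (f s) \<le> Cf" using l2procD(3)[OF f] by blast
  obtain Cg where Cg: "\<And>s. s \<ge> t0 \<Longrightarrow> norm2 M (g s) \<le> Cg" using l2procD(3)[OF g] by blast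
  define a where "a = (max Cf Cg)\<^sup>2"
  have a: "a \<ge> 0" by (simp add: a_def)
  have fa: "nl2 M (\<lambda>\<omega>. f s \<omega> - 0) \<le> ennreal a" and ga: "nl2 M (\<lambda>\<omega>. g s \<omega> - 0) \<le> ennreal a" if "t0 \<le> s" for s
    using l2procD(2)[OF f that] l2procD(2)[OF g that] Cf[OF that] Cg[OF that]
    by (auto simp: nl2_eq_norm2 a_def intro!: ennreal_leI power_mono)
  have x0': "x0 \<in> borel_measurable M" "nl2 M x0 < \<infinity>"
    using x0 by (auto simp: initial_value_def square_integrable_iff)
  have y_meas [measurable]: "y t \<in> borel_measurable M" if "t0 \<le> t" for t
    using y(2)[OF that] by (rule measurable_Filt_imp)
  have zero_meas: "measurable_process_on M r t (\<lambda>_ _. 0 :: 'h)" for r t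
    by (simp add: measurable_process_on_def)
  define c where "c = sqrt (3 * \<N>\<^sup>2 * ((norm2 M x0)\<^sup>2 + (1 / \<nu> + 1) * a * (1 / \<nu>)))"
  have bounded: "nl2 M (y t) \<le> ennreal (c\<^sup>2)" if t: "t0 \<le> t" for t
  proof -
    have "nl2 M (\<lambda>\<omega>. y t \<omega> - U (t - t0) 0) \<le> ennreal (3 * \<N>\<^sup>2) *
      (ennreal (exp (- \<nu> * (t - t0))) * nl2 M (\<lambda>\<omega>. x0 \<omega> - 0) + ennreal ((1 / \<nu> + 1) * a * (1 / \<nu>)))"
      using t a nu_pos l2procD(6)[OF f t] l2procD(6)[OF g t] x0'(1) fa ga
      by (intro mild_at_estimate_const[OF t y(1)[OF t] mild_at_zero[OF t]] nn_integral_exp_decay(1) zero_meas) auto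
    also have "\<dots> \<le> ennreal (3 * \<N>\<^sup>2) * (1 * nl2 M (\<lambda>\<omega>. x0 \<omega> - 0) + ennreal ((1 / \<nu> + 1) * a * (1 / \<nu>)))"
      using t nu_pos by (intro mult_left_mono add_mono mult_right_mono order.refl) (auto simp: ennreal_le_1)
    also have "\<dots> = ennreal (c\<^sup>2)"
      using x0 nu_pos a unfolding c_def initial_value_def
      by (simp add: nl2_eq_norm2 ennreal_mult[symmetric] ennreal_plus[symmetric] del: ennreal_plus)
    finally show ?thesis by (simp add: blinfun.zero_right)
  qed
  have c_nn: "c \<ge> 0" using nu_pos a by (simp add: c_def)
  show sq: "square_integrable M (y t)" if "t0 \<le> t" for t
    using bounded[OF that] c_nn y_meas[OF that] by (intro nl2_le_imp_norm2_le(1))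
  show "\<exists>C. \<forall>t\<ge>t0. norm2 M (y t) \<le> C"
    using bounded c_nn y_meas by (intro exI[of _ c] allI impI nl2_le_imp_norm2_le(2))
  \<comment> \<open>A constant local to this proof, distinct from the constant in the decay rate of
    the theorem: the squared error per unit of time after a restart.\<close>
  define \<kappa> where "\<kappa> = 3 * \<N>\<^sup>2 * ((1 / \<nu> + 1) * a)"
  have \<kappa>: "\<kappa> \<ge> 0" using nu_pos a by (simp add: \<kappa>_def)
  have step: "norm2 M (\<lambda>\<omega>. y t \<omega> - U (t - r) (y r \<omega>)) \<le> sqrt (\<kappa> * (t - r))" if r: "t0 \<le> r" "r \<le> t" for r t
  proof (rule nl2_le_imp_norm2_le(2))
    have t: "t0 \<le> t" using r by simp
    have fl: "mild_at r (y r) f g t (y t)"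
      using mild_at_flow[OF f g r y(1)[OF r(1)] y(1)[OF t]] .
    have "nl2 M (\<lambda>\<omega>. y t \<omega> - U (t - r) (y r \<omega>)) \<le> ennreal (3 * \<N>\<^sup>2) *
      (ennreal (exp (- \<nu> * (t - r))) * nl2d M (y r) (y r) + ennreal ((1 / \<nu> + 1) * a * (t - r)))"
      using r a nu_pos l2procD(6)[OF l2proc_later[OF f r(1)] r(2)] l2procD(6)[OF l2proc_later[OF g r(1)] r(2)]
        y_meas[OF r(1)] fa ga
      by (intro mild_at_estimate_const[OF r(2) fl mild_at_zero[OF r(2)]] nn_integral_exp_decay(2) zero_meas) auto
    also have "\<dots> = ennreal ((sqrt (\<kappa> * (t - r)))\<^sup>2)"
      using r nu_pos a \<kappa> by (simp add: \<kappa>_def mult.assoc flip: ennreal_mult)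
    finally show "nl2 M (\<lambda>\<omega>. y t \<omega> - U (t - r) (y r \<omega>)) \<le> ennreal ((sqrt (\<kappa> * (t - r)))\<^sup>2)" .
    show "(\<lambda>\<omega>. y t \<omega> - U (t - r) (y r \<omega>)) \<in> borel_measurable M"
      using y_meas[OF r(1)] y_meas[OF t] by (intro borel_measurable_diff borel_measurable_blinfun_const)
  qed (use r \<kappa> in auto)
  show "l2cont M {t0..} y"
    unfolding l2cont_def
  proof (intro ballI allI impI)
    fix t e :: real assume "t \<in> {t0..}" and e: "e > 0"
    hence t: "t0 \<le> t" by simp
    \<comment> \<open>Both s - t and t - r will be at most \<open>\<eta>\<close>, so s - r is at
      most \<open>2 * \<eta>\<close>, and the square root of \<kappa> times this stays below e/3.
      The summand 1 avoids division by zero.\<close>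
    define \<eta> where "\<eta> = (e / 3)\<^sup>2 / (2 * (\<kappa> + 1))"
    have \<eta>: "\<eta> > 0" using e \<kappa> by (simp add: \<eta>_def)
    have small: "sqrt (\<kappa> * x) < e / 3" if "x \<le> 2 * \<eta>" for x
    proof -
      have "\<kappa> * x \<le> \<kappa> * (2 * \<eta>)" using that \<kappa> by (intro mult_left_mono)
      also have "\<dots> < (\<kappa> + 1) * (2 * \<eta>)" using \<eta> by simp
      also have "\<dots> = (e / 3)\<^sup>2" using add_nonneg_pos[OF \<kappa> zero_less_one] by (simp add: \<eta>_def field_simps)
      finally have "sqrt (\<kappa> * x) < sqrt ((e / 3)\<^sup>2)" by (rule real_sqrt_less_mono)
      thus ?thesis using e by simp
    qed
    \<comment> \<open>One restart time for all s near \<open>t\<close>, on either side; the maximum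
      keeps it in the half-line.\<close>
    define r where "r = max t0 (t - \<eta>)"
    have r: "t0 \<le> r" "r \<le> t" "t - r \<le> \<eta>" using t \<eta> by (auto simp: r_def)
    have "\<exists>d>0. \<forall>s\<in>{r..}. \<bar>s - t\<bar> < d \<longrightarrow> norm2 M (\<lambda>\<omega>. U (s - r) (y r \<omega>) - U (t - r) (y r \<omega>)) < e / 3"
    proof (rule l2_dominated_cont[where R = "\<lambda>\<omega>. \<N> * norm (y r \<omega>)"])
      show "(\<lambda>\<omega>. U (s - r) (y r \<omega>)) \<in> borel_measurable M" for s
        using y_meas[OF r(1)] by (rule borel_measurable_blinfun_const)
      show "continuous (at t within {r..}) (\<lambda>s. U (s - r) (y r \<omega>))" for \<omega>
        using U_orbit_continuous[of r "y r \<omega>"] r by (simp add: continuous_on_eq_continuous_within)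
      show "integrable M (\<lambda>\<omega>. (\<N> * norm (y r \<omega>))\<^sup>2)"
        using sq[OF r(1)] by (simp add: power_mult_distrib square_integrable_def)
    qed (use r e norm_U_apply_le in auto)
    then obtain d1 where d1: "d1 > 0"
      "\<And>s. r \<le> s \<Longrightarrow> \<bar>s - t\<bar> < d1 \<Longrightarrow> norm2 M (\<lambda>\<omega>. U (s - r) (y r \<omega>) - U (t - r) (y r \<omega>)) < e / 3"
      by auto
    show "\<exists>d>0. \<forall>s\<in>{t0..}. \<bar>s - t\<bar> < d \<longrightarrow> dist2 M (y s) (y t) < e"
    proof (intro exI[of _ "min \<eta> d1"] conjI ballI impI)
      fix s assume "s \<in> {t0..}" and st: "\<bar>s - t\<bar> < min \<eta> d1"
      hence s: "t0 \<le> s" "r \<le> s" by (auto simp: r_def)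
      have U_sq: "square_integrable M (\<lambda>\<omega>. U h (y r \<omega>))" for h
        using sq[OF r(1)] by (rule square_integrable_blinfun)
      have "dist2 M (y s) (y t) \<le> norm2 M (\<lambda>\<omega>. y s \<omega> - U (s - r) (y r \<omega>)) + norm2 M (\<lambda>\<omega>. U (s - r) (y r \<omega>) - y t \<omega>)"
        by (intro norm2_diff_triangle sq U_sq s t)
      also have "norm2 M (\<lambda>\<omega>. U (s - r) (y r \<omega>) - y t \<omega>) \<le>
          norm2 M (\<lambda>\<omega>. U (s - r) (y r \<omega>) - U (t - r) (y r \<omega>)) + norm2 M (\<lambda>\<omega>. U (t - r) (y r \<omega>) - y t \<omega>)"
        by (intro norm2_diff_triangle sq U_sq s t)
      finally have "dist2 M (y s) (y t) \<le> norm2 M (\<lambda>\<omega>. y s \<omega> - U (s - r) (y r \<omega>)) +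
          (norm2 M (\<lambda>\<omega>. U (s - r) (y r \<omega>) - U (t - r) (y r \<omega>)) + norm2 M (\<lambda>\<omega>. U (t - r) (y r \<omega>) - y t \<omega>))" by simp
      moreover have "norm2 M (\<lambda>\<omega>. y s \<omega> - U (s - r) (y r \<omega>)) < e / 3"
        using step[OF r(1) s(2)] small[of "s - r"] st r(3) by linarith
      moreover have "norm2 M (\<lambda>\<omega>. U (t - r) (y r \<omega>) - y t \<omega>) < e / 3"
        using step[OF r(1,2)] small[of "t - r"] \<eta> r(3) norm2_minus_commute[of M "y t"] by simp
      moreover have "norm2 M (\<lambda>\<omega>. U (s - r) (y r \<omega>) - U (t - r) (y r \<omega>)) < e / 3"
        using s st by (intro d1) auto
      ultimately show "dist2 M (y s) (y t) < e" by linarith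
    qed (use \<eta> d1 in auto)
  qed
qed

text \<open>Values are chosen separately for each t, regularity is derived for this raw family, and
  only then is it replaced by a progressively measurable version; \<open>mild_at\<close> tolerates
  changes of the value on null sets.\<close>

lemma mild_exists:
  assumes f: "l2proc t0 f" and g: "l2proc t0 g" and x0: "initial_value M W t0 x0"
  shows "\<exists>y. l2proc t0 y \<and> (\<forall>t\<ge>t0. mild_at t0 x0 f g t (y t))"
proof -
  have "\<forall>t. \<exists>Y. t0 \<le> t \<longrightarrow> mild_at t0 x0 f g t Y \<and> Y \<in> borel_measurable (Filt t)"
    using mild_at_exists[OF f g] x0 by (auto simp: initial_value_def)
  from choice[OF this] obtain y where y: "\<And>t. t0 \<le> t \<Longrightarrow> mild_at t0 x0 f g t (y t)"
    "\<And>t. t0 \<le> t \<Longrightarrow> y t \<in> borel_measurable (Filt t)" by blast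
  have "\<forall>t\<ge>t0. mild_at t0 x0 f g t (y t) \<and> y t \<in> borel_measurable (Filt t)" using y by blast
  note reg = mild_regular[OF f g x0 this]
  have "\<exists>x. (\<forall>t\<ge>t0. AE \<omega> in M. x t \<omega> = y t \<omega>) \<and> (\<forall>t\<ge>t0. measurable_process_on (Filt t) t0 t x)"
    by (rule measurable_modification; fact y(2) reg(1) reg(3))
  then obtain x where x: "\<And>t. t \<ge> t0 \<Longrightarrow> AE \<omega> in M. x t \<omega> = y t \<omega>"
    "\<And>t. t \<ge> t0 \<Longrightarrow> measurable_process_on (Filt t) t0 t x"
    by blast
  have x_meas: "x t \<in> borel_measurable M" if "t \<ge> t0" for t
    using measurable_process_on_section[OF x(2)[OF that]] that by (auto intro: measurable_Filt_imp)
  have y_meas: "y t \<in> borel_measurable M" if "t \<ge> t0" for t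
    using y(2)[OF that] by (rule measurable_Filt_imp)
  have eq: "norm2 M (x t) = norm2 M (y t)" if "t \<ge> t0" for t
    using x(1) x_meas y_meas that by (intro norm2_cong_AE)
  have eq2: "dist2 M (x s) (x t) = dist2 M (y s) (y t)" if st: "s \<ge> t0" "t \<ge> t0" for s t
  proof (intro norm2_cong_AE borel_measurable_diff x_meas y_meas st)
    show "AE \<omega> in M. x s \<omega> - x t \<omega> = y s \<omega> - y t \<omega>"
      using x(1)[OF st(1)] x(1)[OF st(2)] by eventually_elim simp
  qed
  have "l2proc t0 x"
    unfolding l2proc_def
  proof (intro conjI allI impI)
    show "square_integrable M (x t)" if t: "t \<ge> t0" for t
    proof (rule square_integrable_cong_AE[OF reg(1)[OF t] _ x_meas[OF t]])
      show "AE \<omega> in M. y t \<omega> = x t \<omega>" using x(1)[OF t] by eventually_elim simp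
    qed
    obtain C where "\<And>t. t \<ge> t0 \<Longrightarrow> norm2 M (y t) \<le> C" using reg(2) by blast
    thus "\<exists>C. \<forall>t\<ge>t0. norm2 M (x t) \<le> C" using eq by (intro exI[of _ C]) simp
    show "l2cont M {t0..} x"
      unfolding l2cont_def
    proof (intro ballI allI impI)
      fix t e :: real assume t: "t \<in> {t0..}" and "e > 0"
      then obtain d where "d > 0" "\<And>s. s \<in> {t0..} \<Longrightarrow> \<bar>s - t\<bar> < d \<Longrightarrow> dist2 M (y s) (y t) < e"
        using reg(3) unfolding l2cont_def by blast
      thus "\<exists>d>0. \<forall>s\<in>{t0..}. \<bar>s - t\<bar> < d \<longrightarrow> dist2 M (x s) (x t) < e"
        using eq2 t by (intro exI[of _ d]) simp
    qed
  qed (rule x(2))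
  moreover have "mild_at t0 x0 f g t (x t)" if "t \<ge> t0" for t
    using y(1)[OF that] x(1)[OF that] by (rule mild_at_cong_AE)
  ultimately show ?thesis by blast
qed

end

section \<open>A Gronwall inequality\<close>

text \<open>The crude bound \<open>B\<close> is fed into the integral inequality n times. Each round
  can be integrated exactly and leaves \<open>B\<close> multiplied by the n-th term of an
  exponential series, which tends to 0.\<close>

lemma gronwall_iterate:
  fixes v :: "real \<Rightarrow> real"
  assumes nn: "a \<ge> 0" "k \<ge> 0" "B \<ge> 0" and v: "\<And>t. t \<in> {t0..T} \<Longrightarrow> v t \<ge> 0"
    and le: "\<And>t. t \<in> {t0..T} \<Longrightarrow>
      ennreal (v t) \<le> ennreal a + ennreal k * (\<integral>\<^sup>+s\<in>{t0..t}. ennreal (v s) \<partial>lborel)"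
    and B: "\<And>t. t \<in> {t0..T} \<Longrightarrow> v t \<le> B"
  shows "t \<in> {t0..T} \<Longrightarrow> v t \<le> a * exp (k * (t - t0)) + B * (k * (t - t0)) ^ n / fact n"
proof (induction n arbitrary: t)
  case 0
  have "0 \<le> a * exp (k * (t - t0))" using nn by simp
  thus ?case using B[OF 0] by simp
next
  case (Suc n)
  define h where "h s = a * exp (k * (s - t0)) + B * (k * (s - t0)) ^ n / fact n" for s
  \<comment> \<open>\<open>H\<close> is the primitive of \<open>k * h\<close> with
    \<open>H t0 = a\<close>, so one round of the inequality replaces \<open>h\<close> by
    \<open>H\<close>.\<close>
  define H where "H s = a * exp (k * (s - t0)) + B * (k * (s - t0)) ^ Suc n / fact (Suc n)" for s
  have h_nn: "h s \<ge> 0" if "t0 \<le> s" for s using nn that by (simp add: h_def)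
  have h_meas [measurable]: "h \<in> borel_measurable borel" unfolding h_def by measurable
  have deriv: "(H has_real_derivative k * h s) (at s)" for s
  proof -
    have "((\<lambda>s. (k * (s - t0)) ^ Suc n) has_real_derivative real (Suc n) * (k * (s - t0)) ^ n * k) (at s)"
      by (auto intro!: derivative_eq_intros simp del: power_Suc)
    from DERIV_cmult[OF this, of "B / fact (Suc n)"]
    have "((\<lambda>s. B * (k * (s - t0)) ^ Suc n / fact (Suc n)) has_real_derivative
        B / fact (Suc n) * (real (Suc n) * (k * (s - t0)) ^ n * k)) (at s)" by simp
    also have "B / fact (Suc n) * (real (Suc n) * (k * (s - t0)) ^ n * k) = k * (B * (k * (s - t0)) ^ n / fact n)"
      unfolding fact_Suc by (simp add: divide_simps del: of_nat_Suc)
    finally have 1: "((\<lambda>s. B * (k * (s - t0)) ^ Suc n / fact (Suc n)) has_real_derivative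
        k * (B * (k * (s - t0)) ^ n / fact n)) (at s)" .
    have 2: "((\<lambda>s. a * exp (k * (s - t0))) has_real_derivative k * (a * exp (k * (s - t0)))) (at s)"
      by (auto intro!: derivative_eq_intros)
    show ?thesis
      unfolding H_def h_def distrib_left by (rule DERIV_add[OF 2 1])
  qed
  have t: "t0 \<le> t" using Suc.prems by simp
  have "(\<integral>\<^sup>+s\<in>{t0..t}. ennreal (v s) \<partial>lborel) \<le> (\<integral>\<^sup>+s\<in>{t0..t}. ennreal (h s) \<partial>lborel)"
  proof (intro nn_integral_mono)
    fix s
    show "ennreal (v s) * indicator {t0..t} s \<le> ennreal (h s) * indicator {t0..t} s"
      using Suc.IH[of s] Suc.prems by (cases "s \<in> {t0..t}") (auto simp: h_def intro!: ennreal_leI)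
  qed
  hence "ennreal k * (\<integral>\<^sup>+s\<in>{t0..t}. ennreal (v s) \<partial>lborel) \<le> ennreal k * (\<integral>\<^sup>+s\<in>{t0..t}. ennreal (h s) \<partial>lborel)"
    by (intro mult_left_mono) auto
  also have "\<dots> = (\<integral>\<^sup>+s. ennreal (k * h s) * indicator {t0..t} s \<partial>lborel)"
    by (subst nn_integral_cmult[symmetric])
       (auto intro!: nn_integral_cong simp: ennreal_mult h_nn nn indicator_def)
  also have "\<dots> = ennreal (H t - H t0)"
    using t nn h_nn deriv by (intro nn_integral_FTC_Icc) (auto intro: has_field_derivative_at_within)
  finally have "ennreal (v t) \<le> ennreal a + ennreal (H t - H t0)"
    using le[OF Suc.prems] by (meson add_left_mono order_trans)
  moreover have H0: "H t0 = a" by (simp add: H_def)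
  moreover have Hle: "H t0 \<le> H t"
  proof -
    have "a * 1 \<le> a * exp (k * (t - t0))" using t nn by (intro mult_left_mono) auto
    moreover have "0 \<le> B * (k * (t - t0)) ^ Suc n / fact (Suc n)"
      using t nn by (intro divide_nonneg_nonneg mult_nonneg_nonneg zero_le_power) auto
    ultimately show ?thesis unfolding H0 unfolding H_def by linarith
  qed
  ultimately have "ennreal (v t) \<le> ennreal (H t)"
    using nn by (simp flip: ennreal_plus)
  moreover have "H t \<ge> 0" using Hle H0 nn by simp
  ultimately show ?case by (simp add: H_def)
qed

text \<open>Passing to exp(\<nu>(s - t0)) u(s) removes the damping from the kernel and leaves the
  classical inequality. Finiteness of the integral of \<open>u\<close> supplies the pointwise bound
  from which the iteration starts.\<close>

lemma gronwall_exp: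
  fixes u :: "real \<Rightarrow> real"
  assumes nn: "a \<ge> 0" "k \<ge> 0" "\<nu> > 0" and u: "\<And>t. t \<ge> t0 \<Longrightarrow> u t \<ge> 0"
    and meas: "\<And>t. t \<ge> t0 \<Longrightarrow> (\<lambda>s. ennreal (u s) * indicator {t0..t} s) \<in> borel_measurable lborel"
    and fin: "\<And>t. t \<ge> t0 \<Longrightarrow> (\<integral>\<^sup>+s\<in>{t0..t}. ennreal (u s) \<partial>lborel) < \<infinity>"
    and le: "\<And>t. t \<ge> t0 \<Longrightarrow> ennreal (u t) \<le> ennreal (a * exp (- \<nu> * (t - t0))) +
      ennreal k * (\<integral>\<^sup>+s\<in>{t0..t}. ennreal (exp (- \<nu> * (t - s))) * ennreal (u s) \<partial>lborel)"
    and T: "T \<ge> t0"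
  shows "u T \<le> a * exp (- (\<nu> - k) * (T - t0))"
proof -
  define v where "v s = exp (\<nu> * (s - t0)) * u s" for s
  have v_nn: "v t \<ge> 0" if "t0 \<le> t" for t using u[OF that] by (simp add: v_def)
  have v_le: "ennreal (v t) \<le> ennreal a + ennreal k * (\<integral>\<^sup>+s\<in>{t0..t}. ennreal (v s) \<partial>lborel)"
    if t: "t \<ge> t0" for t
  proof -
    define E where "E = exp (\<nu> * (t - t0))"
    have E: "E > 0" by (simp add: E_def)
    have "ennreal (v t) = ennreal E * ennreal (u t)" using u[OF t] by (simp add: v_def E_def ennreal_mult)
    also have "\<dots> \<le> ennreal E * (ennreal (a * exp (- \<nu> * (t - t0))) +
      ennreal k * (\<integral>\<^sup>+s\<in>{t0..t}. ennreal (exp (- \<nu> * (t - s))) * ennreal (u s) \<partial>lborel))"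
      by (intro mult_left_mono le t) auto
    also have "\<dots> = ennreal E * ennreal (a * exp (- \<nu> * (t - t0))) +
       ennreal k * (ennreal E * (\<integral>\<^sup>+s\<in>{t0..t}. ennreal (exp (- \<nu> * (t - s))) * ennreal (u s) \<partial>lborel))"
      by (simp add: distrib_left mult_ac)
    also have "ennreal E * ennreal (a * exp (- \<nu> * (t - t0))) = ennreal a"
    proof -
      have "E * exp (- \<nu> * (t - t0)) = 1" by (simp add: E_def flip: exp_add)
      hence "E * (a * exp (- \<nu> * (t - t0))) = a" by (simp add: mult.left_commute)
      thus ?thesis using E nn by (simp flip: ennreal_mult)
    qed
    also have "ennreal E * (\<integral>\<^sup>+s\<in>{t0..t}. ennreal (exp (- \<nu> * (t - s))) * ennreal (u s) \<partial>lborel) =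
        (\<integral>\<^sup>+s. ennreal E * (ennreal (exp (- \<nu> * (t - s))) * (ennreal (u s) * indicator {t0..t} s)) \<partial>lborel)"
      using meas[OF t] by (subst nn_integral_cmult[symmetric]) (auto simp: mult.assoc)
    also have "\<dots> = (\<integral>\<^sup>+s\<in>{t0..t}. ennreal (v s) \<partial>lborel)"
    proof (intro nn_integral_cong)
      fix s
      have "E * exp (- \<nu> * (t - s)) = exp (\<nu> * (s - t0))"
        by (simp add: E_def exp_add[symmetric] algebra_simps)
      hence "ennreal E * ennreal (exp (- \<nu> * (t - s))) = ennreal (exp (\<nu> * (s - t0)))"
        using E by (simp flip: ennreal_mult)
      thus "ennreal E * (ennreal (exp (- \<nu> * (t - s))) * (ennreal (u s) * indicator {t0..t} s)) =
        ennreal (v s) * indicator {t0..t} s"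
        using u[of s] by (cases "s \<in> {t0..t}") (auto simp: v_def ennreal_mult mult.assoc[symmetric])
    qed
    finally show ?thesis .
  qed
  have J_fin: "(\<integral>\<^sup>+s\<in>{t0..T}. ennreal (v s) \<partial>lborel) < \<infinity>"
  proof -
    have "(\<integral>\<^sup>+s\<in>{t0..T}. ennreal (v s) \<partial>lborel) \<le>
      (\<integral>\<^sup>+s. ennreal (exp (\<nu> * (T - t0))) * (ennreal (u s) * indicator {t0..T} s) \<partial>lborel)"
    proof (intro nn_integral_mono)
      fix s
      show "ennreal (v s) * indicator {t0..T} s \<le> ennreal (exp (\<nu> * (T - t0))) * (ennreal (u s) * indicator {t0..T} s)"
        using u[of s] nn by (cases "s \<in> {t0..T}") (auto simp: v_def simp flip: ennreal_mult intro!: ennreal_leI mult_right_mono)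
    qed
    also have "\<dots> = ennreal (exp (\<nu> * (T - t0))) * (\<integral>\<^sup>+s\<in>{t0..T}. ennreal (u s) \<partial>lborel)"
      using meas[OF T] by (rule nn_integral_cmult)
    also have "\<dots> < \<infinity>" using fin[OF T] by (simp add: ennreal_mult_less_top)
    finally show ?thesis .
  qed
  then obtain J where J: "(\<integral>\<^sup>+s\<in>{t0..T}. ennreal (v s) \<partial>lborel) = ennreal J" "J \<ge> 0"
    by (cases "\<integral>\<^sup>+s\<in>{t0..T}. ennreal (v s) \<partial>lborel") auto
  \<comment> \<open>The inequality itself, with its integral enlarged to [t0, T], turns the finite
    integral \<open>J\<close> into a pointwise bound.\<close>
  define B where "B = a + k * J"
  have B: "B \<ge> 0" using nn J by (simp add: B_def)
  have v_B: "v t \<le> B" if t: "t \<in> {t0..T}" for t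
  proof -
    have "ennreal (v t) \<le> ennreal a + ennreal k * (\<integral>\<^sup>+s\<in>{t0..t}. ennreal (v s) \<partial>lborel)"
      using t by (intro v_le) auto
    also have "\<dots> \<le> ennreal a + ennreal k * (\<integral>\<^sup>+s\<in>{t0..T}. ennreal (v s) \<partial>lborel)"
      using t by (intro add_left_mono mult_left_mono nn_integral_mono) (auto simp: indicator_def)
    also have "\<dots> = ennreal B"
      using J nn by (simp add: B_def ennreal_mult ennreal_plus)
    finally show ?thesis using B by simp
  qed
  have it: "v T \<le> a * exp (k * (T - t0)) + B * (k * (T - t0)) ^ n / fact n" for n
    using nn B v_nn v_le v_B T by (intro gronwall_iterate[where T = T]) auto
  have "(\<lambda>n. a * exp (k * (T - t0)) + B * (inverse (fact n) * (k * (T - t0)) ^ n)) \<longlonglongrightarrow> a * exp (k * (T - t0)) + B * 0"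
    by (intro tendsto_intros summable_LIMSEQ_zero[OF summable_exp])
  hence "v T \<le> a * exp (k * (T - t0)) + B * 0"
    by (rule tendsto_lowerbound) (use it in \<open>auto simp: divide_inverse mult_ac\<close>)
  hence "u T * (exp (\<nu> * (T - t0)) * exp (- \<nu> * (T - t0))) \<le> a * exp (k * (T - t0)) * exp (- \<nu> * (T - t0))"
    unfolding v_def using mult_right_mono[of _ _ "exp (- \<nu> * (T - t0))"] by (simp add: mult_ac)
  thus ?thesis
    by (simp add: exp_add[symmetric] algebra_simps)
qed

section \<open>The semilinear equation\<close>

locale semilinear_equation = stable_semigroup_noise M W U \<N> \<nu>
  for M :: "'w measure" and W :: "real \<Rightarrow> 'w \<Rightarrow> real"
    and U :: "real \<Rightarrow> 'h::{real_inner, banach, second_countable_topology} \<Rightarrow>\<^sub>L 'h" and \<N> \<nu> :: real +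
  fixes F G :: "real \<Rightarrow> 'h \<Rightarrow> 'h" and \<L> A0 :: real
  assumes F_cont: "continuous_on UNIV (\<lambda>(t, x). F t x)" and G_cont: "continuous_on UNIV (\<lambda>(t, x). G t x)"
    and F_lip: "\<And>t. \<L>-lipschitz_on UNIV (F t)" and G_lip: "\<And>t. \<L>-lipschitz_on UNIV (G t)"
    and F_0: "\<And>t. norm (F t 0) \<le> A0" and G_0: "\<And>t. norm (G t 0) \<le> A0"
    and L_less: "\<L> < \<nu> / (\<N> * sqrt (3 * (\<nu> + 1)))"
begin

definition \<kappa> :: real where "\<kappa> = 3 * (1 + 1 / \<nu>) * \<N>\<^sup>2 * \<L>\<^sup>2"

lemma L_nonneg: "\<L> \<ge> 0"
  using F_lip[of 0] by (rule lipschitz_on_nonneg)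

lemma A0_nonneg: "A0 \<ge> 0"
  using F_0[of 0] norm_ge_zero order_trans by blast

lemma kappa_nonneg: "\<kappa> \<ge> 0"
  using nu_pos by (simp add: \<kappa>_def)

text \<open>Squaring the smallness hypothesis gives 3(\<nu> + 1)
  \<open>\<N>\<^sup>2 * \<L>\<^sup>2 < \<nu>\<^sup>2\<close>; division by \<nu> is the claim, since
  (\<nu> + 1)/\<nu> = 1 + 1/\<nu>.\<close>

lemma kappa_less: "\<kappa> < \<nu>"
proof -
  have "\<L>\<^sup>2 < (\<nu> / (\<N> * sqrt (3 * (\<nu> + 1))))\<^sup>2"
    using L_less L_nonneg by (intro power_strict_mono) auto
  also have "\<dots> = \<nu>\<^sup>2 / (\<N>\<^sup>2 * (3 * (\<nu> + 1)))"
    using nu_pos by (simp add: power_divide power_mult_distrib)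
  finally have "\<L>\<^sup>2 * (\<N>\<^sup>2 * (3 * (\<nu> + 1))) < \<nu>\<^sup>2"
    using nu_pos N_pos by (simp add: pos_less_divide_eq)
  hence "\<L>\<^sup>2 * (\<N>\<^sup>2 * (3 * (\<nu> + 1))) / \<nu> < \<nu>\<^sup>2 / \<nu>"
    using nu_pos by (intro divide_strict_right_mono)
  thus ?thesis
    using nu_pos by (simp add: \<kappa>_def field_simps power2_eq_square)
qed

lemma FG_lip: "norm (F t x - F t y) \<le> \<L> * norm (x - y)" "norm (G t x - G t y) \<le> \<L> * norm (x - y)"
  using lipschitz_onD[OF F_lip, of x y t] lipschitz_onD[OF G_lip, of x y t] by (auto simp: dist_norm)

lemma measurable_process_on_FG:
  assumes "measurable_process_on N a b x"
  shows "measurable_process_on N a b (\<lambda>s \<omega>. F s (x s \<omega>))" "measurable_process_on N a b (\<lambda>s \<omega>. G s (x s \<omega>))"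
  by (rule measurable_process_on_compose[OF assms, of F, OF continuous_on_subset[OF F_cont subset_UNIV]])
     (rule measurable_process_on_compose[OF assms, of G, OF continuous_on_subset[OF G_cont subset_UNIV]])

lemma l2proc_Nemytskii:
  assumes x: "l2proc t0 x" and \<Phi>: "continuous_on UNIV (\<lambda>(s, y). \<Phi> s y)"
    "\<And>s y z. norm (\<Phi> s y - \<Phi> s z) \<le> \<L> * norm (y - z)" "\<And>s. norm (\<Phi> s (0::'h)) \<le> A0"
  shows "l2proc t0 (\<lambda>s \<omega>. \<Phi> s (x s \<omega>) :: 'h)"
proof -
  obtain C where C: "\<And>s. s \<ge> t0 \<Longrightarrow> norm2 M (x s) \<le> C" using l2procD(3)[OF x] by blast
  have sq: "square_integrable M (x s)" if "s \<in> {t0..}" for s using l2procD(2)[OF x] that by simp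
  have c: "continuous_on ({t0..} \<times> UNIV) (\<lambda>(s, y). \<Phi> s y)"
    using \<Phi>(1) by (rule continuous_on_subset) simp
  note * = l2cont_compose[OF c \<Phi>(2,3) L_nonneg A0_nonneg sq l2procD(4)[OF x]]
  show ?thesis
    unfolding l2proc_def
  proof (intro conjI allI impI)
    show "measurable_process_on (Filt t) t0 t (\<lambda>s \<omega>. \<Phi> s (x s \<omega>))" if "t \<ge> t0" for t
      by (rule measurable_process_on_compose[OF l2procD(1)[OF x that], of \<Phi>, OF continuous_on_subset[OF \<Phi>(1) subset_UNIV]])
    show "square_integrable M (\<lambda>\<omega>. \<Phi> t (x t \<omega>))" if "t \<ge> t0" for t using *(2) that by auto
    show "l2cont M {t0..} (\<lambda>s \<omega>. \<Phi> s (x s \<omega>))" using *(1) by auto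
    have "norm2 M (\<lambda>\<omega>. \<Phi> t (x t \<omega>)) \<le> A0 + \<L> * C" if "t \<ge> t0" for t
      using *(3)[of t] mult_left_mono[OF C[OF that] L_nonneg] that by auto
    thus "\<exists>C. \<forall>t\<ge>t0. norm2 M (\<lambda>\<omega>. \<Phi> t (x t \<omega>)) \<le> C" by blast
  qed
qed

lemma l2proc_F: "l2proc t0 x \<Longrightarrow> l2proc t0 (\<lambda>s \<omega>. F s (x s \<omega>))"
  and l2proc_G: "l2proc t0 x \<Longrightarrow> l2proc t0 (\<lambda>s \<omega>. G s (x s \<omega>))"
  using l2proc_Nemytskii[of t0 x F, OF _ F_cont FG_lip(1) F_0] l2proc_Nemytskii[of t0 x G, OF _ G_cont FG_lip(2) G_0]
  by blast+

text \<open>The Picard map is a relation, since the stochastic integral is determined only almost surely.\<close>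

abbreviation picard_at where
  "picard_at t0 x0 x t Y \<equiv> mild_at t0 x0 (\<lambda>s \<omega>. F s (x s \<omega>)) (\<lambda>s \<omega>. G s (x s \<omega>)) t Y"

lemma mild_solution_iff:
  "mild_solution M W U F G t0 x0 x \<longleftrightarrow>
     (\<forall>t\<ge>t0. x t \<in> borel_measurable (Filt t) \<and> square_integrable M (x t)) \<and>
     (\<forall>t\<ge>t0. measurable_process_on M t0 t x \<and>
        (\<integral>\<^sup>+s\<in>{t0..t}. nl2 M (x s) \<partial>lborel) < \<infinity>) \<and>
     (\<forall>t\<ge>t0. picard_at t0 x0 x t (x t))"
  unfolding mild_solution_def mild_at_def nl2_def ..

text \<open>In the factor 1 + 1/\<nu> of \<kappa> the summand 1/\<nu> belongs to the drift and the
  summand 1 to the noise. Only joint measurability is asked of the two processes, so the estimate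
  covers mild solutions that are not known to lie in \<open>l2proc\<close>.\<close>

lemma picard_at_estimate:
  assumes t: "t0 \<le> t" and Y: "picard_at t0 x0 x t Y" "picard_at t0 x0' x' t Y'"
    and x0: "x0 \<in> borel_measurable M" "x0' \<in> borel_measurable M"
    and x: "measurable_process_on M t0 t x" "measurable_process_on M t0 t x'"
  shows "nl2d M Y Y' \<le>
    ennreal (3 * \<N>\<^sup>2 * exp (- \<nu> * (t - t0))) * nl2d M x0 x0' +
    ennreal \<kappa> * (damped t0 t (\<lambda>s. nl2d M (x s) (x' s)))"
proof -
  let ?D = "damped t0 t (\<lambda>s. nl2d M (x s) (x' s))"
  have le: "(\<integral>\<^sup>+s\<in>{t0..t}. ennreal (exp (- \<nu> * (t - s))) * nl2 M (\<lambda>\<omega>. \<Phi> s (x s \<omega>) - \<Phi> s (x' s \<omega>)) \<partial>lborel)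
      \<le> ennreal (\<L>\<^sup>2) * ?D"
    if \<Phi>: "\<And>s y z. norm (\<Phi> s y - \<Phi> s z :: 'h) \<le> \<L> * norm (y - z)" for \<Phi>
  proof -
    have "(\<integral>\<^sup>+s\<in>{t0..t}. ennreal (exp (- \<nu> * (t - s))) * nl2 M (\<lambda>\<omega>. \<Phi> s (x s \<omega>) - \<Phi> s (x' s \<omega>)) \<partial>lborel)
      \<le> (\<integral>\<^sup>+s. ennreal (\<L>\<^sup>2) * (ennreal (exp (- \<nu> * (t - s))) * (nl2d M (x s) (x' s) * indicator {t0..t} s)) \<partial>lborel)"
    proof (intro nn_integral_mono)
      fix s
      show "ennreal (exp (- \<nu> * (t - s))) * nl2 M (\<lambda>\<omega>. \<Phi> s (x s \<omega>) - \<Phi> s (x' s \<omega>)) * indicator {t0..t} s \<le>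
        ennreal (\<L>\<^sup>2) * (ennreal (exp (- \<nu> * (t - s))) * (nl2d M (x s) (x' s) * indicator {t0..t} s))"
      proof (cases "s \<in> {t0..t}")
        case True
        note [measurable] = measurable_process_on_section[OF x(1) True] measurable_process_on_section[OF x(2) True]
        have "nl2 M (\<lambda>\<omega>. \<Phi> s (x s \<omega>) - \<Phi> s (x' s \<omega>)) \<le> (\<integral>\<^sup>+\<omega>. ennreal (\<L>\<^sup>2) * ennreal ((norm (x s \<omega> - x' s \<omega>))\<^sup>2) \<partial>M)"
          unfolding nl2_def
        proof (intro nn_integral_mono)
          fix \<omega>
          have "(norm (\<Phi> s (x s \<omega>) - \<Phi> s (x' s \<omega>)))\<^sup>2 \<le> (\<L> * norm (x s \<omega> - x' s \<omega>))\<^sup>2"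
            using \<Phi> by (intro power_mono) auto
          thus "ennreal ((norm (\<Phi> s (x s \<omega>) - \<Phi> s (x' s \<omega>)))\<^sup>2) \<le> ennreal (\<L>\<^sup>2) * ennreal ((norm (x s \<omega> - x' s \<omega>))\<^sup>2)"
            by (simp add: power_mult_distrib ennreal_leI flip: ennreal_mult)
        qed
        also have "\<dots> = ennreal (\<L>\<^sup>2) * nl2d M (x s) (x' s)"
          unfolding nl2_def by (rule nn_integral_cmult) measurable
        finally have "ennreal (exp (- \<nu> * (t - s))) * nl2 M (\<lambda>\<omega>. \<Phi> s (x s \<omega>) - \<Phi> s (x' s \<omega>)) \<le>
          ennreal (exp (- \<nu> * (t - s))) * (ennreal (\<L>\<^sup>2) * nl2d M (x s) (x' s))"
          by (intro mult_left_mono) auto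
        thus ?thesis using True by (simp add: mult_ac)
      qed simp
    qed
    also have "\<dots> = ennreal (\<L>\<^sup>2) * (\<integral>\<^sup>+s. ennreal (exp (- \<nu> * (t - s))) * (nl2d M (x s) (x' s) * indicator {t0..t} s) \<partial>lborel)"
      by (intro nn_integral_cmult borel_measurable_times_ennreal nl2_diff_measurable x) measurable
    finally show ?thesis by (simp add: mult.assoc)
  qed
  have "nl2d M Y Y' \<le> ennreal (3 * \<N>\<^sup>2) *
    (ennreal (exp (- \<nu> * (t - t0))) * nl2d M x0 x0' + ennreal (1 / \<nu>) * (ennreal (\<L>\<^sup>2) * ?D) + ennreal (\<L>\<^sup>2) * ?D)"
    by (intro order_trans[OF mild_at_estimate[OF t Y x0 measurable_process_on_FG(1)[OF x(1)] measurable_process_on_FG(1)[OF x(2)]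
          measurable_process_on_FG(2)[OF x(1)] measurable_process_on_FG(2)[OF x(2)]]]
        mult_left_mono add_mono order.refl le FG_lip) auto
  also have "\<dots> = ennreal (3 * \<N>\<^sup>2 * exp (- \<nu> * (t - t0))) * nl2d M x0 x0' + ennreal \<kappa> * ?D"
  proof -
    have "ennreal \<kappa> = ennreal (3 * \<N>\<^sup>2) * ((ennreal (1 / \<nu>) + 1) * ennreal (\<L>\<^sup>2))"
    proof -
      have "\<kappa> = 3 * \<N>\<^sup>2 * ((1 / \<nu> + 1) * \<L>\<^sup>2)" by (simp add: \<kappa>_def algebra_simps)
      also have "ennreal \<dots> = ennreal (3 * \<N>\<^sup>2) * ennreal ((1 / \<nu> + 1) * \<L>\<^sup>2)"
        using nu_pos by (intro ennreal_mult) auto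
      also have "ennreal ((1 / \<nu> + 1) * \<L>\<^sup>2) = ennreal (1 / \<nu> + 1) * ennreal (\<L>\<^sup>2)"
        using nu_pos by (intro ennreal_mult) auto
      also have "ennreal (1 / \<nu> + 1) = ennreal (1 / \<nu>) + ennreal 1"
        using nu_pos by (intro ennreal_plus) auto
      finally show ?thesis by simp
    qed
    moreover have "ennreal (3 * \<N>\<^sup>2 * exp (- \<nu> * (t - t0))) = ennreal (3 * \<N>\<^sup>2) * ennreal (exp (- \<nu> * (t - t0)))"
      by (simp add: ennreal_mult)
    ultimately show ?thesis by (simp add: distrib_left distrib_right mult.assoc add.assoc)
  qed
  finally show ?thesis .
qed

text \<open>A distance bounded uniformly in time leaves only the mass of the kernel, at most
  1/\<nu>, which turns \<kappa> into \<kappa>/\<nu>.\<close>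

lemma picard_at_estimate_sup:
  assumes t: "t0 \<le> t" and Y: "picard_at t0 x0 x t Y" "picard_at t0 x0' x' t Y'"
    and x0: "x0 \<in> borel_measurable M" "x0' \<in> borel_measurable M"
    and x: "l2proc t0 x" "l2proc t0 x'"
    and m: "\<And>s. s \<ge> t0 \<Longrightarrow> dist2 M (x s) (x' s) \<le> m"
    and z: "nl2d M x0 x0' \<le> ennreal (z\<^sup>2)"
  shows "nl2d M Y Y' \<le> ennreal (3 * \<N>\<^sup>2 * z\<^sup>2 + \<kappa> / \<nu> * m\<^sup>2)"
proof -
  have "(damped t0 t (\<lambda>s. nl2d M (x s) (x' s))) \<le>
     (\<integral>\<^sup>+s. ennreal (m\<^sup>2) * (ennreal (exp (- \<nu> * (t - s))) * indicator {t0..t} s) \<partial>lborel)"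
  proof (intro nn_integral_mono)
    fix s
    show "ennreal (exp (- \<nu> * (t - s))) * nl2d M (x s) (x' s) * indicator {t0..t} s \<le>
      ennreal (m\<^sup>2) * (ennreal (exp (- \<nu> * (t - s))) * indicator {t0..t} s)"
    proof (cases "s \<in> {t0..t}")
      case True
      have "nl2d M (x s) (x' s) \<le> ennreal (m\<^sup>2)"
        using True l2procD(2)[OF x(1), of s] l2procD(2)[OF x(2), of s] m[of s]
        by (subst nl2_eq_norm2) (auto intro!: square_integrable_diff ennreal_leI power_mono)
      from mult_left_mono[OF this, of "ennreal (exp (- \<nu> * (t - s)))"] show ?thesis
        using True by (simp add: mult.commute)
    qed simp
  qed
  also have "\<dots> = ennreal (m\<^sup>2) * (\<integral>\<^sup>+s\<in>{t0..t}. ennreal (exp (- \<nu> * (t - s))) \<partial>lborel)"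
    by (rule nn_integral_cmult) measurable
  also have "\<dots> \<le> ennreal (m\<^sup>2) * ennreal (1 / \<nu>)"
    by (intro mult_left_mono nn_integral_exp_decay nu_pos t) auto
  finally have D: "(damped t0 t (\<lambda>s. nl2d M (x s) (x' s))) \<le>
     ennreal (m\<^sup>2 / \<nu>)" using nu_pos by (simp flip: ennreal_mult)
  have "3 * \<N>\<^sup>2 * exp (- \<nu> * (t - t0)) \<le> 3 * \<N>\<^sup>2 * 1"
    using nu_pos t by (intro mult_left_mono) auto
  hence e: "ennreal (3 * \<N>\<^sup>2 * exp (- \<nu> * (t - t0))) \<le> ennreal (3 * \<N>\<^sup>2)"
    by (intro ennreal_leI) simp
  have "nl2d M Y Y' \<le> ennreal (3 * \<N>\<^sup>2) * ennreal (z\<^sup>2) + ennreal \<kappa> * ennreal (m\<^sup>2 / \<nu>)"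
    by (rule order_trans[OF picard_at_estimate[OF t Y x0 l2procD(6)[OF x(1) t] l2procD(6)[OF x(2) t]]
          add_mono[OF mult_mono[OF e z] mult_left_mono[OF D]]]) auto
  also have "\<dots> = ennreal (3 * \<N>\<^sup>2 * z\<^sup>2 + \<kappa> / \<nu> * m\<^sup>2)"
    using kappa_nonneg nu_pos by (simp flip: ennreal_mult ennreal_plus)
  finally show ?thesis .
qed

text \<open>A mild solution is its own Picard value, so \<open>picard_at_estimate\<close> becomes
  the hypothesis of \<open>gronwall_exp\<close>; the required finiteness is the square integrability
  in time demanded by \<open>mild_solution\<close>. The result therefore holds for any two mild
  solutions in the sense of the definition, and all uniqueness claims follow from it.\<close>

lemma mild_solution_diff_le:
  assumes x: "initial_value M W t0 x1" "initial_value M W t0 x2"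
    and X: "mild_solution M W U F G t0 x1 X1" "mild_solution M W U F G t0 x2 X2" and t: "t0 \<le> t"
  shows "(\<integral>\<omega>. (norm (X1 t \<omega> - X2 t \<omega>))\<^sup>2 \<partial>M) \<le>
    3 * \<N>\<^sup>2 * exp (- (\<nu> - \<kappa>) * (t - t0)) * (\<integral>\<omega>. (norm (x1 \<omega> - x2 \<omega>))\<^sup>2 \<partial>M)"
proof -
  define u where "u s = (\<integral>\<omega>. (norm (X1 s \<omega> - X2 s \<omega>))\<^sup>2 \<partial>M)" for s
  define u0 where "u0 = (\<integral>\<omega>. (norm (x1 \<omega> - x2 \<omega>))\<^sup>2 \<partial>M)"
  note X' = X[unfolded mild_solution_iff]
  have sq: "square_integrable M (X1 s)" "square_integrable M (X2 s)" if "s \<ge> t0" for s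
    using X' that by auto
  have mp: "measurable_process_on M t0 s X1" "measurable_process_on M t0 s X2" if "s \<ge> t0" for s
    using X' that by auto
  have sq0: "square_integrable M x1" "square_integrable M x2" using x by (auto simp: initial_value_def)
  have nl2_u: "nl2d M (X1 s) (X2 s) = ennreal (u s)" if "s \<ge> t0" for s
    using sq[OF that] by (simp add: nl2_eq_norm2 square_integrable_diff norm2_sq u_def)
  have nl2_u0: "nl2d M x1 x2 = ennreal u0"
    using sq0 by (simp add: nl2_eq_norm2 square_integrable_diff norm2_sq u0_def)
  have u_nn: "u s \<ge> 0" "u0 \<ge> 0" for s by (auto simp: u_def u0_def intro: integral_nonneg_AE)
  have ind: "ennreal (u s) * indicator {t0..r} s = nl2d M (X1 s) (X2 s) * indicator {t0..r} s" for r s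
    by (cases "s \<in> {t0..r}") (auto simp: nl2_u)
  have "u t \<le> 3 * \<N>\<^sup>2 * u0 * exp (- (\<nu> - \<kappa>) * (t - t0))"
  proof (rule gronwall_exp[OF _ kappa_nonneg nu_pos u_nn(1) _ _ _ t])
    show "(\<lambda>s. ennreal (u s) * indicator {t0..r} s) \<in> borel_measurable lborel" if "t0 \<le> r" for r
      unfolding ind by (rule nl2_diff_measurable[OF mp[OF that]])
    show "(\<integral>\<^sup>+s\<in>{t0..r}. ennreal (u s) \<partial>lborel) < \<infinity>" if r: "t0 \<le> r" for r
    proof -
      have m: "(\<lambda>s. nl2 M (X1 s) * indicator {t0..r} s) \<in> borel_measurable lborel"
        "(\<lambda>s. nl2 M (X2 s) * indicator {t0..r} s) \<in> borel_measurable lborel"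
        using nl2_diff_measurable[OF mp(1)[OF r], of "\<lambda>_ _. 0"] nl2_diff_measurable[OF mp(2)[OF r], of "\<lambda>_ _. 0"]
        by (auto simp: measurable_process_on_def)
      have "(\<integral>\<^sup>+s\<in>{t0..r}. ennreal (u s) \<partial>lborel) \<le>
        (\<integral>\<^sup>+s. 2 * (nl2 M (X1 s) * indicator {t0..r} s) + 2 * (nl2 M (X2 s) * indicator {t0..r} s) \<partial>lborel)"
        unfolding ind
      proof (intro nn_integral_mono)
        fix s
        show "nl2d M (X1 s) (X2 s) * indicator {t0..r} s \<le>
          2 * (nl2 M (X1 s) * indicator {t0..r} s) + 2 * (nl2 M (X2 s) * indicator {t0..r} s)"
        proof (cases "s \<in> {t0..r}")
          case True
          hence "nl2d M (X1 s) (X2 s) \<le> 2 * nl2 M (\<lambda>\<omega>. X1 s \<omega> - 0) + 2 * nl2 M (\<lambda>\<omega>. 0 - X2 s \<omega>)"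
            using sq[of s] by (intro nl2_triangle) (auto intro: square_integrable_measurable)
          thus ?thesis using True nl2_minus_commute[of M "\<lambda>_. 0" "X2 s"] by simp
        qed simp
      qed
      also have "\<dots> = 2 * (\<integral>\<^sup>+s\<in>{t0..r}. nl2 M (X1 s) \<partial>lborel) + 2 * (\<integral>\<^sup>+s\<in>{t0..r}. nl2 M (X2 s) \<partial>lborel)"
        using m by (simp add: nn_integral_add nn_integral_cmult)
      also have "\<dots> < \<infinity>" using X' r by (auto simp: ennreal_mult_less_top)
      finally show ?thesis .
    qed
    show "ennreal (u r) \<le> ennreal (3 * \<N>\<^sup>2 * u0 * exp (- \<nu> * (r - t0))) +
      ennreal \<kappa> * (damped t0 r (\<lambda>s. ennreal (u s)))" if r: "t0 \<le> r" for r
    proof -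
      have Y: "picard_at t0 x1 X1 r (X1 r)" "picard_at t0 x2 X2 r (X2 r)" using X' r by auto
      have "ennreal (u r) \<le> ennreal (3 * \<N>\<^sup>2 * exp (- \<nu> * (r - t0))) * ennreal u0 +
        ennreal \<kappa> * (damped t0 r (\<lambda>s. nl2d M (X1 s) (X2 s)))"
        using picard_at_estimate[OF r Y _ _ mp[OF r]] sq0 nl2_u[OF r] nl2_u0
        by (simp add: square_integrable_measurable)
      also have "ennreal (3 * \<N>\<^sup>2 * exp (- \<nu> * (r - t0))) * ennreal u0 = ennreal (3 * \<N>\<^sup>2 * u0 * exp (- \<nu> * (r - t0)))"
        using u_nn by (simp add: mult_ac flip: ennreal_mult)
      finally show ?thesis by (simp add: mult.assoc ind)
    qed
  qed (use u_nn in auto)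
  thus ?thesis by (simp add: u_def u0_def mult_ac)
qed

lemma l2proc_initial_value: "l2proc t0 x \<Longrightarrow> t0 \<le> r \<Longrightarrow> initial_value M W r (x r)"
  by (simp add: initial_value_def l2procD)

lemma initial_value_zero: "initial_value M W r (\<lambda>_. 0 :: 'h)"
  by (simp add: initial_value_def)

lemma initial_value_measurable: "initial_value M W r x \<Longrightarrow> x \<in> borel_measurable M"
  by (auto simp: initial_value_def square_integrable_def)

lemma l2proc_mild_solution:
  assumes x: "l2proc t0 x" and p: "\<And>t. t \<ge> t0 \<Longrightarrow> picard_at t0 x0 x t (x t)"
  shows "mild_solution M W U F G t0 x0 x"
proof -
  obtain C where C: "\<And>s. s \<ge> t0 \<Longrightarrow> norm2 M (x s) \<le> C" using l2procD(3)[OF x] by blast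
  have "(\<integral>\<^sup>+s\<in>{t0..t}. nl2 M (x s) \<partial>lborel) < \<infinity>" for t
  proof -
    have "(\<integral>\<^sup>+s\<in>{t0..t}. nl2 M (x s) \<partial>lborel) \<le> (\<integral>\<^sup>+s. ennreal (C\<^sup>2) * indicator {t0..t} s \<partial>lborel)"
    proof (intro nn_integral_mono)
      fix s
      show "nl2 M (x s) * indicator {t0..t} s \<le> ennreal (C\<^sup>2) * indicator {t0..t} s"
        using l2procD(2)[OF x, of s] C[of s]
        by (cases "s \<in> {t0..t}") (auto simp: nl2_eq_norm2 intro!: ennreal_leI power_mono)
    qed
    also have "\<dots> = ennreal (C\<^sup>2) * emeasure lborel {t0..t}"
      by (simp add: nn_integral_cmult_indicator)
    also have "\<dots> < \<infinity>"
      by (simp add: ennreal_mult_less_top emeasure_lborel_Icc_eq)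
    finally show ?thesis .
  qed
  thus ?thesis
    unfolding mild_solution_iff using l2procD(2,5,6)[OF x] p by simp
qed

lemma picard_at_flow:
  assumes "l2proc t0 x" "t0 \<le> r" "r \<le> t" "picard_at t0 x0 x r (x r)" "picard_at t0 x0 x t (x t)"
  shows "picard_at r (x r) x t (x t)"
  using mild_at_flow[OF l2proc_F[OF assms(1)] l2proc_G[OF assms(1)] assms(2-5)] .

text \<open>Closedness of the fixed point relation under uniform mean-square convergence. It yields both the
  existence of solutions (with \<open>y n = x (n + 1)\<close>) and the mild equation for the limit \<open>\<phi>\<close> (with \<open>y = x\<close>).\<close>

lemma picard_at_limit:
  assumes x: "l2proc t0 x" "\<And>n. l2proc t0 (X n)" and z: "initial_value M W t0 z" "\<And>n. initial_value M W t0 (Z n)"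
    and Y: "\<And>n t. t \<ge> t0 \<Longrightarrow> picard_at t0 (Z n) (X n) t (Y n t)" "\<And>n t. t \<ge> t0 \<Longrightarrow> square_integrable M (Y n t)"
    and e: "e \<longlonglongrightarrow> 0" "\<And>n t. t \<ge> t0 \<Longrightarrow> dist2 M (X n t) (x t) \<le> e n"
      "\<And>n t. t \<ge> t0 \<Longrightarrow> dist2 M (Y n t) (x t) \<le> e n"
      "\<And>n. dist2 M (Z n) z \<le> e n"
    and t: "t0 \<le> t"
  shows "picard_at t0 z x t (x t)"
proof -
  \<comment> \<open>\<open>y\<close> is a true Picard image of the limit \<open>x\<close>. The
    values \<open>Y n\<close> are close to \<open>x\<close> by assumption and close to
    \<open>y\<close> because the Picard map is Lipschitz, so \<open>x\<close> and \<open>y\<close>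
    coincide almost surely at each time.\<close>
  obtain y where y: "l2proc t0 y" "\<And>t. t \<ge> t0 \<Longrightarrow> picard_at t0 z x t (y t)"
    using mild_exists[OF l2proc_F[OF x(1)] l2proc_G[OF x(1)] z(1)] by blast
  \<comment> \<open>The constant of \<open>picard_at_estimate_sup\<close> when the processes and the
    initial values both differ by at most \<open>e n\<close>.\<close>
  define K where "K = sqrt (3 * \<N>\<^sup>2 + \<kappa> / \<nu>)"
  have K: "K \<ge> 0" "K\<^sup>2 = 3 * \<N>\<^sup>2 + \<kappa> / \<nu>" using kappa_nonneg nu_pos by (auto simp: K_def)
  have e_nn: "e n \<ge> 0" for n using order_trans[OF norm2_nonneg e(4)] .
  have sq: "square_integrable M (x t)" "square_integrable M (y t)" "square_integrable M (Y n t)" for n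
    using l2procD(2)[OF x(1) t] l2procD(2)[OF y(1) t] Y(2)[OF t] by auto
  have "dist2 M (Y n t) (y t) \<le> K * e n" for n
  proof (rule nl2_le_imp_norm2_le(2))
    have "nl2d M (Z n) z \<le> ennreal ((e n)\<^sup>2)"
      using z e(4)[of n] unfolding initial_value_def
      by (subst nl2_eq_norm2) (auto intro!: square_integrable_diff ennreal_leI power_mono)
    hence "nl2d M (Y n t) (y t) \<le> ennreal (3 * \<N>\<^sup>2 * (e n)\<^sup>2 + \<kappa> / \<nu> * (e n)\<^sup>2)"
      using picard_at_estimate_sup[OF t Y(1)[OF t] y(2)[OF t] initial_value_measurable[OF z(2)]
        initial_value_measurable[OF z(1)] x(2) x(1) e(2)] by simp
    also have "3 * \<N>\<^sup>2 * (e n)\<^sup>2 + \<kappa> / \<nu> * (e n)\<^sup>2 = (K * e n)\<^sup>2"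
      by (simp add: power_mult_distrib K(2) distrib_right)
    finally show "nl2d M (Y n t) (y t) \<le> ennreal ((K * e n)\<^sup>2)" .
    show "(\<lambda>\<omega>. Y n t \<omega> - y t \<omega>) \<in> borel_measurable M"
      by (intro borel_measurable_diff square_integrable_measurable sq)
    show "0 \<le> K * e n" using K(1) e_nn by simp
  qed
  hence sum_le: "dist2 M (Y n t) (x t) + dist2 M (Y n t) (y t) \<le> e n + K * e n" for n
    by (intro add_mono e(3)[OF t])
  have "dist2 M (x t) (y t) \<le> e n + K * e n" for n
    using norm2_diff_triangle[OF sq(1) sq(3)[of n] sq(2)] norm2_minus_commute[of M "Y n t" "x t"] sum_le[of n]
    by linarith
  moreover have "(\<lambda>n. e n + K * e n) \<longlonglongrightarrow> 0 + K * 0" by (intro tendsto_intros e(1))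
  ultimately have "dist2 M (x t) (y t) \<le> 0 + K * 0"
    by (intro tendsto_lowerbound[of _ _ sequentially]) auto
  hence "dist2 M (x t) (y t) = 0" using norm2_nonneg[of M "\<lambda>\<omega>. x t \<omega> - y t \<omega>"] by linarith
  hence "AE \<omega> in M. x t \<omega> = y t \<omega>"
    by (intro norm2_eq_0_imp_AE square_integrable_diff sq)
  with y(2)[OF t] show ?thesis by (rule mild_at_cong_AE)
qed

section \<open>Picard iteration\<close>

definition q :: real where "q = sqrt (\<kappa> / \<nu>)"

lemma q_bounds: "0 \<le> q" "q < 1" "q\<^sup>2 = \<kappa> / \<nu>"
  using kappa_nonneg kappa_less nu_pos by (auto simp: q_def)

lemma picard_at_contraction:
  assumes t: "t0 \<le> t" and Y: "picard_at t0 x0 x t Y" "picard_at t0 x0 x' t Y'"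
    and Y_sq: "square_integrable M Y" "square_integrable M Y'"
    and x0: "x0 \<in> borel_measurable M" and x: "l2proc t0 x" "l2proc t0 x'"
    and m: "\<And>s. s \<ge> t0 \<Longrightarrow> dist2 M (x s) (x' s) \<le> m"
  shows "dist2 M Y Y' \<le> q * m"
proof (rule nl2_le_imp_norm2_le(2))
  show "nl2d M Y Y' \<le> ennreal ((q * m)\<^sup>2)"
    using picard_at_estimate_sup[OF t Y x0 x0 x m, of 0] by (simp add: power_mult_distrib q_bounds(3))
  show "0 \<le> q * m" using q_bounds(1) order_trans[OF norm2_nonneg m[OF order.refl]] by simp
  show "(\<lambda>\<omega>. Y \<omega> - Y' \<omega>) \<in> borel_measurable M"
    by (intro borel_measurable_diff square_integrable_measurable Y_sq)
qed

lemma solution_exists: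
  assumes x0: "initial_value M W t0 x0"
  shows "\<exists>x. l2proc t0 x \<and> (\<forall>t\<ge>t0. picard_at t0 x0 x t (x t))"
proof -
  \<comment> \<open>The Picard relation becomes a map by choice of a regular image for each process
    in \<open>l2proc\<close>.\<close>
  have "\<forall>x. \<exists>y. l2proc t0 x \<longrightarrow> l2proc t0 y \<and> (\<forall>t\<ge>t0. picard_at t0 x0 x t (y t))"
    using mild_exists[OF l2proc_F l2proc_G x0] by blast
  from choice[OF this] obtain T where T: "\<And>x. l2proc t0 x \<Longrightarrow> l2proc t0 (T x)"
    "\<And>x t. l2proc t0 x \<Longrightarrow> t \<ge> t0 \<Longrightarrow> picard_at t0 x0 x t (T x t)" by blast
  define X where "X n = (T ^^ n) (\<lambda>_ _. 0)" for n
  have X_Suc: "X (Suc n) = T (X n)" for n by (simp add: X_def)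
  have X: "l2proc t0 (X n)" for n
    by (induction n) (auto simp: X_Suc T, simp add: X_def l2proc_zero)
  have P: "picard_at t0 x0 (X n) t (X (Suc n) t)" if "t \<ge> t0" for n t
    unfolding X_Suc by (rule T(2)[OF X that])
  \<comment> \<open>The iteration starts from the zero process, so a bound on the first iterate is a
    bound on the first step.\<close>
  obtain C where C: "\<And>t. t \<ge> t0 \<Longrightarrow> norm2 M (X 1 t) \<le> C" using l2procD(3)[OF X[of 1]] by blast
  have le: "dist2 M (X (Suc n) t) (X n t) \<le> C * q ^ n" if "t \<ge> t0" for n t
    using that
  proof (induction n arbitrary: t)
    case 0
    thus ?case using C[of t] by (simp add: X_def)
  next
    case (Suc n)
    have "dist2 M (X (Suc (Suc n)) t) (X (Suc n) t) \<le> q * (C * q ^ n)"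
      using Suc by (intro picard_at_contraction[OF _ P P l2procD(2)[OF X] l2procD(2)[OF X]
          initial_value_measurable[OF x0] X X]) auto
    thus ?case by (simp add: mult_ac)
  qed
  let ?x = "\<lambda>t \<omega>. lim (\<lambda>n. X n t \<omega>)"
  have L1: "l2proc t0 ?x" by (rule l2proc_lim(1)[OF X _ q_bounds(1,2)]) (rule le)
  have L2: "dist2 M (X n t) (?x t) \<le> C * q ^ n / (1 - q)" if "t \<ge> t0" for n t
    by (rule l2proc_lim(2)[OF X _ q_bounds(1,2) that]) (rule le)
  have "picard_at t0 x0 ?x t (?x t)" if t: "t \<ge> t0" for t
  proof (rule picard_at_limit[where X = X and Y = "\<lambda>n. X (Suc n)" and Z = "\<lambda>_. x0" and e = "\<lambda>n. C * q ^ n / (1 - q)"])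
    have "(\<lambda>n. C * q ^ n / (1 - q)) \<longlonglongrightarrow> C * 0 / (1 - q)"
      using q_bounds by (intro tendsto_intros LIMSEQ_realpow_zero) auto
    thus "(\<lambda>n. C * q ^ n / (1 - q)) \<longlonglongrightarrow> 0" by simp
    have C_nn: "C \<ge> 0" using order_trans[OF norm2_nonneg C[OF order.refl]] .
    \<comment> \<open>One error sequence must serve both \<open>X n\<close> and its image
      \<open>X (Suc n)\<close>.\<close>
    show "dist2 M (X (Suc n) t) (?x t) \<le> C * q ^ n / (1 - q)" if "t \<ge> t0" for n t
    proof -
      have "C * q ^ Suc n / (1 - q) \<le> C * q ^ n / (1 - q)"
        using C_nn q_bounds by (intro divide_right_mono mult_left_mono power_decreasing) auto
      thus ?thesis using L2[OF that, of "Suc n"] by linarith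
    qed
    show "dist2 M x0 x0 \<le> C * q ^ n / (1 - q)" for n
      using C_nn q_bounds by simp
  qed ((assumption | rule t x0 L1 X P L2 l2procD(2)[OF X])+)
  thus ?thesis using L1 by blast
qed

text \<open>The point is the order of quantifiers: \<open>B\<close> does not depend on the starting
  time. The Picard image of the zero process is bounded by \<open>b\<close>, so the supremum m of
  the solution satisfies m \<le> b + q m, and m is finite because the process lies in
  \<open>l2proc\<close>.\<close>

lemma zero_start_bound:
  "\<exists>B. \<forall>t0 x. l2proc t0 x \<longrightarrow> (\<forall>t\<ge>t0. picard_at t0 (\<lambda>_. 0) x t (x t)) \<longrightarrow> (\<forall>t\<ge>t0. norm2 M (x t) \<le> B)"
proof -
  define b where "b = sqrt (3 * \<N>\<^sup>2 * ((1 / \<nu> + 1) * A0\<^sup>2 * (1 / \<nu>)))"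
  have b: "b \<ge> 0" "b\<^sup>2 = 3 * \<N>\<^sup>2 * ((1 / \<nu> + 1) * A0\<^sup>2 * (1 / \<nu>))" using nu_pos by (auto simp: b_def)
  have "norm2 M (x t) \<le> b / (1 - q)"
    if x: "l2proc t0 x" and p: "\<forall>t\<ge>t0. picard_at t0 (\<lambda>_. 0) x t (x t)" and t: "t \<ge> t0" for t0 x t
  proof -
    obtain C where C: "\<And>t. t \<ge> t0 \<Longrightarrow> norm2 M (x t) \<le> C" using l2procD(3)[OF x] by blast
    define m where "m = (SUP t\<in>{t0..}. norm2 M (x t))"
    have bdd: "bdd_above ((\<lambda>t. norm2 M (x t)) ` {t0..})" using C by (intro bdd_aboveI[of _ C]) auto
    have le_m: "norm2 M (x t) \<le> m" if "t \<ge> t0" for t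
      unfolding m_def using that by (intro cSUP_upper[OF _ bdd]) auto
    have "norm2 M (x t) \<le> b + q * m" if t: "t \<ge> t0" for t
    proof -
      obtain Y where Y: "picard_at t0 (\<lambda>_. 0) (\<lambda>_ _. 0) t Y" "Y \<in> borel_measurable (Filt t)"
        using mild_at_exists[OF l2proc_F[OF l2proc_zero] l2proc_G[OF l2proc_zero] _ t, of "\<lambda>_. 0"] by auto
      \<comment> \<open>F(s, 0) and G(s, 0) do not depend on the random parameter, so their squared
        mean is controlled by \<open>A0\<close> directly.\<close>
      have c: "nl2 M (\<lambda>\<omega>. H \<omega> - (0 :: 'h)) \<le> ennreal (A0\<^sup>2)" if "H = (\<lambda>_. h)" "norm h \<le> A0" for H :: "'w \<Rightarrow> 'h" and h
        unfolding nl2_def that(1) using that(2) by (simp add: emeasure_space_1 ennreal_leI power_mono)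
      have "nl2 M (\<lambda>\<omega>. Y \<omega> - U (t - t0) 0) \<le> ennreal (3 * \<N>\<^sup>2) *
        (ennreal (exp (- \<nu> * (t - t0))) * nl2 M (\<lambda>\<omega>. (0 :: 'h) - 0) + ennreal ((1 / \<nu> + 1) * A0\<^sup>2 * (1 / \<nu>)))"
        using nu_pos F_0 G_0
        by (intro mild_at_estimate_const[OF t Y(1) mild_at_zero[OF t] _ _
              l2procD(6)[OF l2proc_F[OF l2proc_zero] t] l2procD(6)[OF l2proc_zero t]
              l2procD(6)[OF l2proc_G[OF l2proc_zero] t] l2procD(6)[OF l2proc_zero t]]
            nn_integral_exp_decay(1) t c) auto
      also have "\<dots> = ennreal (b\<^sup>2)"
        unfolding b(2) using nu_pos by (simp flip: ennreal_mult)
      finally have "nl2 M Y \<le> ennreal (b\<^sup>2)" by (simp add: blinfun.zero_right)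
      note Yb = nl2_le_imp_norm2_le[OF measurable_Filt_imp[OF Y(2)] this b(1)]
      have "dist2 M (x t) Y \<le> q * m"
        using p le_m by (intro picard_at_contraction[OF t _ Y(1) l2procD(2)[OF x t] Yb(1) _ x l2proc_zero]) (auto simp: t)
      moreover have "norm2 M (\<lambda>\<omega>. x t \<omega> - 0) \<le> dist2 M (x t) Y + norm2 M (\<lambda>\<omega>. Y \<omega> - 0)"
        by (intro norm2_diff_triangle l2procD(2)[OF x t] Yb) auto
      ultimately show ?thesis using Yb(2) by simp
    qed
    hence "m \<le> b + q * m" unfolding m_def by (intro cSUP_least) auto
    hence "m \<le> b / (1 - q)" using q_bounds by (simp add: field_simps)
    thus ?thesis using le_m[OF t] by linarith
  qed
  thus ?thesis by blast
qed

section \<open>The bounded solution on the whole line\<close>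

lemma mild_solution_initial_value: "mild_solution M W U F G t0 x0 x \<Longrightarrow> initial_value M W t0 (x t0)"
  by (simp add: mild_solution_iff initial_value_def)

lemma l2cont_tendsto:
  assumes "l2cont M {t - 1..} x"
  shows "((\<lambda>s. dist2 M (x s) (x t)) \<longlongrightarrow> 0) (at t)"
proof (rule tendstoI)
  fix e :: real assume "e > 0"
  moreover have "t \<in> {t - 1..}" by simp
  ultimately obtain d where d: "d > 0" "\<And>s. s \<in> {t - 1..} \<Longrightarrow> \<bar>s - t\<bar> < d \<Longrightarrow> dist2 M (x s) (x t) < e"
    using assms unfolding l2cont_def by blast
  show "\<forall>\<^sub>F s in at t. dist (dist2 M (x s) (x t)) 0 < e"
    unfolding eventually_at
  proof (intro exI[of _ "min d 1"] conjI ballI impI)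
    fix s assume "s \<noteq> t \<and> dist s t < min d 1"
    thus "dist (dist2 M (x s) (x t)) 0 < e"
      using d(2)[of s] by (auto simp: dist_real_def)
  qed (use d in auto)
qed

lemma entire_solution_exists:
  "\<exists>\<phi>. Cb_L2 M \<phi> \<and> mild_solution_on_line M W U F G \<phi>"
proof -
  obtain B where B: "\<And>t0 x t. l2proc t0 x \<Longrightarrow> \<forall>t\<ge>t0. picard_at t0 (\<lambda>_. 0) x t (x t) \<Longrightarrow> t \<ge> t0 \<Longrightarrow> norm2 M (x t) \<le> B"
    using zero_start_bound by blast
  have "\<forall>n::nat. \<exists>x. l2proc (- real n) x \<and> (\<forall>t\<ge>- real n. picard_at (- real n) (\<lambda>_. 0) x t (x t))"
    using solution_exists[OF initial_value_zero] by blast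
  from choice[OF this] obtain X where X: "\<And>n. l2proc (- real n) (X n)"
    "\<And>n. \<forall>t\<ge>- real n. picard_at (- real n) (\<lambda>_. 0) (X n) t (X n t)" by blast
  have X_bd: "norm2 M (X n t) \<le> B" if "t \<ge> - real n" for n t using B[OF X that] .
  have B_nn: "B \<ge> 0" using order_trans[OF norm2_nonneg X_bd[OF order.refl]] .
  have flow: "picard_at r (X n r) (X n) t (X n t)" if "- real n \<le> r" "r \<le> t" for n r t
    using X(2)[of n] that by (intro picard_at_flow[OF X(1)]) auto
  \<comment> \<open>At time -n the next solution is bounded by \<open>B\<close> while
    \<open>X n\<close> is 0. The constant and the halved exponent are the square roots of those in
    the squared estimate.\<close>
  define C where "C = sqrt 3 * \<N> * B"
  have C_nn: "C \<ge> 0" using B_nn N_pos by (simp add: C_def)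
  define \<rho> where "\<rho> = exp (- (\<nu> - \<kappa>) / 2)"
  have \<rho>: "0 \<le> \<rho>" "\<rho> < 1" using kappa_less by (auto simp: \<rho>_def)
  have step: "dist2 M (X (Suc n) t) (X n t) \<le> C * exp (- (\<nu> - \<kappa>) / 2 * (t + real n))"
    if t: "t \<ge> - real n" for n t
  proof -
    let ?r = "- real n"
    have r: "- real (Suc n) \<le> ?r" by simp
    have "mild_solution M W U F G ?r (X (Suc n) ?r) (X (Suc n))"
      using r by (intro l2proc_mild_solution l2proc_later[OF X(1)] flow)
    moreover have "mild_solution M W U F G ?r (\<lambda>_. 0) (X n)"
      using X(2) by (intro l2proc_mild_solution X(1)) auto
    moreover have "initial_value M W ?r (X (Suc n) ?r)"
      using X(1) r by (rule l2proc_initial_value)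
    ultimately have "(\<integral>\<omega>. (norm (X (Suc n) t \<omega> - X n t \<omega>))\<^sup>2 \<partial>M) \<le>
       3 * \<N>\<^sup>2 * exp (- (\<nu> - \<kappa>) * (t - ?r)) * (\<integral>\<omega>. (norm (X (Suc n) ?r \<omega> - 0))\<^sup>2 \<partial>M)"
      using t by (intro mild_solution_diff_le initial_value_zero)
    hence "(dist2 M (X (Suc n) t) (X n t))\<^sup>2 \<le> 3 * \<N>\<^sup>2 * exp (- (\<nu> - \<kappa>) * (t - ?r)) * (norm2 M (X (Suc n) ?r))\<^sup>2"
      by (simp add: norm2_sq)
    also have "\<dots> \<le> 3 * \<N>\<^sup>2 * exp (- (\<nu> - \<kappa>) * (t - ?r)) * B\<^sup>2"
      using X_bd[OF r] by (intro mult_left_mono power_mono) auto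
    also have "\<dots> = (C * exp (- (\<nu> - \<kappa>) / 2 * (t + real n)))\<^sup>2"
      by (simp add: C_def power_mult_distrib exp_double[symmetric] mult_ac)
    finally show ?thesis
      by (rule power2_le_imp_le) (use C_nn in simp)
  qed
  define \<phi> where "\<phi> t \<omega> = lim (\<lambda>n. X n t \<omega>)" for t \<omega>
  have main: "l2proc t0 \<phi> \<and> (\<forall>t\<ge>t0. picard_at t0 (\<phi> t0) \<phi> t (\<phi> t)) \<and> (\<forall>t\<ge>t0. norm2 M (\<phi> t) \<le> B + C / (1 - \<rho>))" for t0
  proof -
    \<comment> \<open>Once \<open>n0\<close> terms are dropped, every solution has started before
      \<open>t0\<close>, and the convergence is geometric uniformly for t \<ge> t0.\<close>
    obtain n0 :: nat where n0: "- t0 \<le> real n0" using real_arch_simple by blast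
    define X' where "X' n = X (n + n0)" for n
    have early: "- real (n + n0) \<le> t0" for n using n0 by simp
    have X': "l2proc t0 (X' n)" for n unfolding X'_def using X(1) early by (rule l2proc_later)
    have le: "dist2 M (X' (Suc n) t) (X' n t) \<le> C * \<rho> ^ n" if t: "t \<ge> t0" for n t
    proof -
      have "dist2 M (X' (Suc n) t) (X' n t) \<le> C * exp (- (\<nu> - \<kappa>) / 2 * (t + real (n + n0)))"
        unfolding X'_def using step[of "n + n0" t] early[of n] t by simp
      also have "\<dots> \<le> C * exp (- (\<nu> - \<kappa>) / 2 * real n)"
      proof -
        have "(\<nu> - \<kappa>) / 2 * real n \<le> (\<nu> - \<kappa>) / 2 * (t + real (n + n0))"
          using kappa_less n0 t by (intro mult_left_mono) auto
        hence "- (\<nu> - \<kappa>) / 2 * (t + real (n + n0)) \<le> - (\<nu> - \<kappa>) / 2 * real n"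
          unfolding minus_divide_left[symmetric] minus_mult_left[symmetric] neg_le_iff_le .
        thus ?thesis by (intro mult_left_mono C_nn) (simp only: exp_le_cancel_iff)
      qed
      also have "\<dots> = C * \<rho> ^ n" by (simp add: \<rho>_def exp_of_nat_mult[symmetric] mult.commute)
      finally show ?thesis .
    qed
    \<comment> \<open>Dropping finitely many terms does not change the pointwise limit, so one
      process \<open>\<phi>\<close> serves every \<open>t0\<close>.\<close>
    have lim_eq: "lim (\<lambda>n. X' n t \<omega>) = \<phi> t \<omega>" for t \<omega>
    proof -
      have "((\<lambda>n. X (n + n0) t \<omega>) \<longlonglongrightarrow> L) = ((\<lambda>n. X n t \<omega>) \<longlonglongrightarrow> L)" for L
        using LIMSEQ_ignore_initial_segment[of "\<lambda>n. X n t \<omega>" L n0] LIMSEQ_offset[of "\<lambda>n. X n t \<omega>" n0 L]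
        by blast
      thus ?thesis unfolding \<phi>_def X'_def lim_def by simp
    qed
    have lim_eq': "\<phi> = (\<lambda>t \<omega>. lim (\<lambda>n. X' n t \<omega>))" by (intro ext lim_eq[symmetric])
    have \<phi>: "l2proc t0 \<phi>"
      unfolding lim_eq' by (rule l2proc_lim(1)[OF X' _ \<rho>]) (rule le)
    have L2: "dist2 M (X' n t) (\<phi> t) \<le> C * \<rho> ^ n / (1 - \<rho>)" if "t \<ge> t0" for n t
      unfolding lim_eq' by (rule l2proc_lim(2)[OF X' _ \<rho> that]) (rule le)
    have "picard_at t0 (\<phi> t0) \<phi> t (\<phi> t)" if t: "t0 \<le> t" for t
    proof (rule picard_at_limit[where X = X' and Y = X' and Z = "\<lambda>n. X' n t0" and e = "\<lambda>n. C * \<rho> ^ n / (1 - \<rho>)"])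
      have "(\<lambda>n. C * \<rho> ^ n / (1 - \<rho>)) \<longlonglongrightarrow> C * 0 / (1 - \<rho>)"
        using \<rho> by (intro tendsto_intros LIMSEQ_realpow_zero) auto
      thus "(\<lambda>n. C * \<rho> ^ n / (1 - \<rho>)) \<longlonglongrightarrow> 0" by simp
      show "picard_at t0 (X' n t0) (X' n) t (X' n t)" if "t0 \<le> t" for n t
        unfolding X'_def using early that by (intro flow)
    qed ((assumption | rule t \<phi> X' L2 l2procD(2)[OF X'] l2proc_initial_value[OF \<phi>] l2proc_initial_value[OF X'] order.refl)+)
    moreover have "norm2 M (\<phi> t) \<le> B + C / (1 - \<rho>)" if t: "t0 \<le> t" for t
    proof -
      have "norm2 M (\<lambda>\<omega>. \<phi> t \<omega> - 0) \<le> dist2 M (\<phi> t) (X' 0 t) + norm2 M (\<lambda>\<omega>. X' 0 t \<omega> - 0)"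
        using l2procD(2)[OF \<phi> t] l2procD(2)[OF X' t] by (intro norm2_diff_triangle) auto
      moreover have "norm2 M (X' 0 t) \<le> B"
        unfolding X'_def using early[of 0] t by (intro X_bd) auto
      ultimately show ?thesis
        using L2[OF t, of 0] norm2_minus_commute[of M "\<phi> t" "X' 0 t"] by simp
    qed
    ultimately show ?thesis using \<phi> by blast
  qed
  have "Cb_L2 M \<phi>"
    unfolding Cb_L2_def
  proof (intro conjI allI)
    show "square_integrable M (\<phi> t)" for t using main[of t] l2procD(2) by blast
    show "\<exists>C. \<forall>t. norm2 M (\<phi> t) \<le> C" using main by (intro exI[of _ "B + C / (1 - \<rho>)"]) blast
    \<comment> \<open>Continuity on a half-line that begins strictly before \<open>t\<close> is
      two-sided at \<open>t\<close>.\<close>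
    show "((\<lambda>s. dist2 M (\<phi> s) (\<phi> t)) \<longlongrightarrow> 0) (at t)" for t
      using main[of "t - 1"] l2procD(4) by (intro l2cont_tendsto) blast
  qed
  moreover have "mild_solution_on_line M W U F G \<phi>"
    unfolding mild_solution_on_line_def using main by (intro allI l2proc_mild_solution) blast+
  ultimately show ?thesis by blast
qed

text \<open>The decay estimate is applied from time t - k. Boundedness keeps the distance there
  below C1 + C2, and letting k tend to infinity leaves 0.\<close>

lemma entire_solution_unique:
  assumes \<phi>: "Cb_L2 M \<phi>" "mild_solution_on_line M W U F G \<phi>"
    and \<psi>: "Cb_L2 M \<psi>" "mild_solution_on_line M W U F G \<psi>"
  shows "AE \<omega> in M. \<psi> t \<omega> = \<phi> t \<omega>"
proof -
  obtain C1 C2 where C: "\<And>t. norm2 M (\<phi> t) \<le> C1" "\<And>t. norm2 M (\<psi> t) \<le> C2"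
    using \<phi>(1) \<psi>(1) unfolding Cb_L2_def by blast
  have sq: "square_integrable M (\<phi> t)" "square_integrable M (\<psi> t)" for t
    using \<phi>(1) \<psi>(1) unfolding Cb_L2_def by auto
  have sol: "mild_solution M W U F G r (\<phi> r) \<phi>" "mild_solution M W U F G r (\<psi> r) \<psi>" for r
    using \<phi>(2) \<psi>(2) by (auto simp: mild_solution_on_line_def)
  have "(dist2 M (\<psi> t) (\<phi> t))\<^sup>2 \<le> 3 * \<N>\<^sup>2 * exp (- (\<nu> - \<kappa>)) ^ k * (C1 + C2)\<^sup>2" for k
  proof -
    define r where "r = t - real k"
    have "dist2 M (\<psi> r) (\<phi> r) \<le> norm2 M (\<lambda>\<omega>. \<psi> r \<omega> - 0) + norm2 M (\<lambda>\<omega>. 0 - \<phi> r \<omega>)"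
      by (intro norm2_diff_triangle sq) auto
    hence le: "dist2 M (\<psi> r) (\<phi> r) \<le> C1 + C2"
      using C(1)[of r] C(2)[of r] norm2_minus_commute[of M "\<lambda>_. 0" "\<phi> r"] by simp
    have "(dist2 M (\<psi> t) (\<phi> t))\<^sup>2 \<le> 3 * \<N>\<^sup>2 * exp (- (\<nu> - \<kappa>) * (t - r)) * (dist2 M (\<psi> r) (\<phi> r))\<^sup>2"
      unfolding norm2_sq
      by (intro mild_solution_diff_le sol mild_solution_initial_value[OF sol(1)] mild_solution_initial_value[OF sol(2)])
         (simp add: r_def)
    also have "\<dots> \<le> 3 * \<N>\<^sup>2 * exp (- (\<nu> - \<kappa>) * (t - r)) * (C1 + C2)\<^sup>2"
      using le by (intro mult_left_mono power_mono) auto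
    also have "exp (- (\<nu> - \<kappa>) * (t - r)) = exp (- (\<nu> - \<kappa>)) ^ k"
      by (simp add: r_def exp_of_nat_mult[symmetric] mult.commute)
    finally show ?thesis .
  qed
  moreover have "(\<lambda>k. 3 * \<N>\<^sup>2 * exp (- (\<nu> - \<kappa>)) ^ k * (C1 + C2)\<^sup>2) \<longlonglongrightarrow> 3 * \<N>\<^sup>2 * 0 * (C1 + C2)\<^sup>2"
    using kappa_less by (intro tendsto_intros LIMSEQ_realpow_zero) auto
  ultimately have "(dist2 M (\<psi> t) (\<phi> t))\<^sup>2 \<le> 3 * \<N>\<^sup>2 * 0 * (C1 + C2)\<^sup>2"
    by (intro tendsto_lowerbound[of _ _ sequentially]) auto
  hence "dist2 M (\<psi> t) (\<phi> t) = 0" by simp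
  thus ?thesis by (intro norm2_eq_0_imp_AE square_integrable_diff sq)
qed

section \<open>Stability of the solution on the line and uniqueness for the initial value
  problem\<close>

lemma stability_bound:
  assumes \<phi>: "mild_solution_on_line M W U F G \<phi>"
    and x: "initial_value M W t0 x0" "mild_solution M W U F G t0 x0 x" and t: "t0 \<le> t"
  shows "(\<integral>\<omega>. (norm (x t \<omega> - \<phi> t \<omega>))\<^sup>2 \<partial>M) \<le>
    3 * \<N>\<^sup>2 * exp (- (\<nu> - \<kappa>) * (t - t0)) * (\<integral>\<omega>. (norm (x0 \<omega> - \<phi> t0 \<omega>))\<^sup>2 \<partial>M)"
proof -
  have "mild_solution M W U F G t0 (\<phi> t0) \<phi>" using \<phi> by (simp add: mild_solution_on_line_def)
  from mild_solution_diff_le[OF x(1) mild_solution_initial_value[OF this] x(2) this t] show ?thesis .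
qed

lemma norm2_stability_bound:
  assumes \<phi>: "mild_solution_on_line M W U F G \<phi>"
    and x: "initial_value M W t0 x0" "mild_solution M W U F G t0 x0 x" and t: "t0 \<le> t"
  shows "dist2 M (x t) (\<phi> t) \<le>
    sqrt 3 * \<N> * exp (- (\<nu> - \<kappa>) / 2 * (t - t0)) * dist2 M x0 (\<phi> t0)"
proof (rule power2_le_imp_le)
  show "(dist2 M (x t) (\<phi> t))\<^sup>2 \<le>
    (sqrt 3 * \<N> * exp (- (\<nu> - \<kappa>) / 2 * (t - t0)) * dist2 M x0 (\<phi> t0))\<^sup>2"
    using stability_bound[OF assms] by (simp add: norm2_sq power_mult_distrib exp_double[symmetric])
  show "0 \<le> sqrt 3 * \<N> * exp (- (\<nu> - \<kappa>) / 2 * (t - t0)) * dist2 M x0 (\<phi> t0)"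
    using N_pos by simp
qed

lemma entire_solution_stable:
  assumes \<phi>: "mild_solution_on_line M W U F G \<phi>"
  shows "globally_asymptotically_stable M W U F G \<phi>"
  unfolding globally_asymptotically_stable_def lyapunov_stable_def
proof (intro conjI allI impI)
  fix t0 \<epsilon> :: real assume \<epsilon>: "\<epsilon> > 0"
  show "\<exists>\<delta>>0. \<forall>x0 x. initial_value M W t0 x0 \<longrightarrow> mild_solution M W U F G t0 x0 x \<longrightarrow>
        dist2 M x0 (\<phi> t0) < \<delta> \<longrightarrow> (\<forall>t\<ge>t0. dist2 M (x t) (\<phi> t) < \<epsilon>)"
  \<comment> \<open>The exponential factor is at most 1 after \<open>t0\<close>, so dividing
    \<epsilon> by the constant in front of it suffices, for every \<open>t0\<close> alike.\<close>
  proof (intro exI[of _ "\<epsilon> / (sqrt 3 * \<N>)"] conjI allI impI)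
    fix x0 :: "'w \<Rightarrow> 'h" and x t assume *: "initial_value M W t0 x0" "mild_solution M W U F G t0 x0 x"
      "dist2 M x0 (\<phi> t0) < \<epsilon> / (sqrt 3 * \<N>)" "t0 \<le> t"
    have "exp (- (\<nu> - \<kappa>) / 2 * (t - t0)) \<le> 1"
      using kappa_less *(4) by (simp add: mult_nonpos_nonneg)
    hence "sqrt 3 * \<N> * exp (- (\<nu> - \<kappa>) / 2 * (t - t0)) * dist2 M x0 (\<phi> t0) \<le>
        sqrt 3 * \<N> * 1 * dist2 M x0 (\<phi> t0)"
      using N_pos by (intro mult_right_mono mult_left_mono) auto
    also have "\<dots> < \<epsilon>" using *(3) N_pos by (simp add: field_simps)
    finally show "dist2 M (x t) (\<phi> t) < \<epsilon>"
      using norm2_stability_bound[OF \<phi> *(1,2,4)] by linarith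
  qed (use \<epsilon> N_pos in auto)
next
  fix t0 and x0 :: "'w \<Rightarrow> 'h" and x assume *: "initial_value M W t0 x0" "mild_solution M W U F G t0 x0 x"
  let ?D = "dist2 M x0 (\<phi> t0)"
  have c: "- (\<nu> - \<kappa>) / 2 < 0" using kappa_less by simp
  show "((\<lambda>t. dist2 M (x t) (\<phi> t)) \<longlongrightarrow> 0) at_top"
  proof (rule tendsto_sandwich[OF _ _ tendsto_const])
    have "filterlim (\<lambda>t. - t0 + t) at_top at_top"
      by (rule filterlim_tendsto_add_at_top[OF tendsto_const filterlim_ident])
    hence "filterlim (\<lambda>t. - (\<nu> - \<kappa>) / 2 * (t - t0)) at_bot at_top"
      by (intro filterlim_tendsto_neg_mult_at_bot[OF tendsto_const c]) simp
    from filterlim_compose[OF exp_at_bot this]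
    have "((\<lambda>t. sqrt 3 * \<N> * exp (- (\<nu> - \<kappa>) / 2 * (t - t0)) * ?D) \<longlongrightarrow> sqrt 3 * \<N> * 0 * ?D) at_top"
      by (intro tendsto_intros)
    thus "((\<lambda>t. sqrt 3 * \<N> * exp (- (\<nu> - \<kappa>) / 2 * (t - t0)) * ?D) \<longlongrightarrow> 0) at_top" by simp
    show "\<forall>\<^sub>F t in at_top. dist2 M (x t) (\<phi> t) \<le> sqrt 3 * \<N> * exp (- (\<nu> - \<kappa>) / 2 * (t - t0)) * ?D"
      using eventually_ge_at_top[of t0] by eventually_elim (rule norm2_stability_bound[OF \<phi> *])
  qed auto
qed

lemma mild_solution_unique:
  assumes x0: "initial_value M W t0 x0"
    and X: "mild_solution M W U F G t0 x0 x" "mild_solution M W U F G t0 x0 y" and t: "t0 \<le> t"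
  shows "AE \<omega> in M. y t \<omega> = x t \<omega>"
proof -
  have "(dist2 M (y t) (x t))\<^sup>2 \<le> 0"
    using mild_solution_diff_le[OF x0 x0 X(2,1) t] by (simp add: norm2_sq)
  hence "dist2 M (y t) (x t) = 0" by simp
  thus ?thesis
    using X t by (intro norm2_eq_0_imp_AE square_integrable_diff) (auto simp: mild_solution_iff)
qed

end

text \<open>The first conjunct gives meaning to the notation x(t; t0, x0): a mild solution exists
  and is determined almost surely at each time. Accordingly the other conjuncts speak of arbitrary
  mild solutions with the given initial values.\<close>

theorem theorem5p4:
  fixes M :: "'w measure"
    and W :: "real \<Rightarrow> 'w \<Rightarrow> real"
    and U :: "real \<Rightarrow> 'h::{real_inner, banach, second_countable_topology} \<Rightarrow>\<^sub>L 'h"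
    and D :: "'h set"
    and A :: "'h \<Rightarrow> 'h"
    and F G :: "real \<Rightarrow> 'h \<Rightarrow> 'h"
    and \<N> \<nu> \<L> A0 :: real
  assumes "prob_space M"
    and "two_sided_brownian_motion M W"
    and "C0_semigroup U"
    and "infinitesimal_generator U D A"
    and "\<N> > 0" and "\<nu> > 0"
    and "\<forall>t\<ge>0. norm (U t) \<le> \<N> * exp (- \<nu> * t)"
    and "continuous_on UNIV (\<lambda>(t, x). F t x)"
    and "continuous_on UNIV (\<lambda>(t, x). G t x)"
    and "\<forall>t. \<L>-lipschitz_on UNIV (F t)"
    and "\<forall>t. \<L>-lipschitz_on UNIV (G t)"
    and "A0 > 0"
    and "\<forall>t. norm (F t 0) \<le> A0 \<and> norm (G t 0) \<le> A0"
    and "\<L> < \<nu> / (\<N> * sqrt (3 * (\<nu> + 1)))"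
  shows
    "(\<forall>t0 x0. initial_value M W t0 x0 \<longrightarrow>
        (\<exists>x. mild_solution M W U F G t0 x0 x \<and>
           (\<forall>y. mild_solution M W U F G t0 x0 y \<longrightarrow> (\<forall>t\<ge>t0. AE \<omega> in M. y t \<omega> = x t \<omega>)))) \<and>
     (\<forall>t0 x1 x2 X1 X2.
        initial_value M W t0 x1 \<longrightarrow> initial_value M W t0 x2 \<longrightarrow>
        mild_solution M W U F G t0 x1 X1 \<longrightarrow> mild_solution M W U F G t0 x2 X2 \<longrightarrow>
        (\<forall>t\<ge>t0. (\<integral>\<omega>. (norm (X1 t \<omega> - X2 t \<omega>))\<^sup>2 \<partial>M)
           \<le> 3 * \<N>\<^sup>2 * exp (- (\<nu> - 3 * (1 + 1 / \<nu>) * \<N>\<^sup>2 * \<L>\<^sup>2) * (t - t0))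
               * (\<integral>\<omega>. (norm (x1 \<omega> - x2 \<omega>))\<^sup>2 \<partial>M))) \<and>
     (\<exists>\<phi>. Cb_L2 M \<phi> \<and> mild_solution_on_line M W U F G \<phi> \<and>
        (\<forall>\<psi>. Cb_L2 M \<psi> \<longrightarrow> mild_solution_on_line M W U F G \<psi> \<longrightarrow>
           (\<forall>t. AE \<omega> in M. \<psi> t \<omega> = \<phi> t \<omega>)) \<and>
        globally_asymptotically_stable M W U F G \<phi> \<and>
        (\<forall>t0 x0 x. initial_value M W t0 x0 \<longrightarrow> mild_solution M W U F G t0 x0 x \<longrightarrow>
           (\<forall>t\<ge>t0. (\<integral>\<omega>. (norm (x t \<omega> - \<phi> t \<omega>))\<^sup>2 \<partial>M)
              \<le> 3 * \<N>\<^sup>2 * exp (- (\<nu> - 3 * (1 + 1 / \<nu>) * \<N>\<^sup>2 * \<L>\<^sup>2) * (t - t0))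
                  * (\<integral>\<omega>. (norm (x0 \<omega> - \<phi> t0 \<omega>))\<^sup>2 \<partial>M))))"
proof -
  interpret prob_space M by fact
  interpret semilinear_equation M W U \<N> \<nu> F G \<L> A0
    by unfold_locales (use assms in auto)
  obtain \<phi> where \<phi>: "Cb_L2 M \<phi>" "mild_solution_on_line M W U F G \<phi>"
    using entire_solution_exists by blast
  show ?thesis
    \<comment> \<open>The explicit rate is folded back into \<open>\<kappa>\<close>, the form in
      which the estimates were proved.\<close>
    unfolding \<kappa>_def[symmetric]
  proof (intro conjI allI impI)
    fix t0 and x0 :: "'w \<Rightarrow> 'h" assume x0: "initial_value M W t0 x0"
    obtain x where "l2proc t0 x" "\<forall>t\<ge>t0. picard_at t0 x0 x t (x t)"
      using solution_exists[OF x0] by blast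
    hence "mild_solution M W U F G t0 x0 x" by (intro l2proc_mild_solution) auto
    thus "\<exists>x. mild_solution M W U F G t0 x0 x \<and>
           (\<forall>y. mild_solution M W U F G t0 x0 y \<longrightarrow> (\<forall>t\<ge>t0. AE \<omega> in M. y t \<omega> = x t \<omega>))"
      using mild_solution_unique[OF x0] by blast
  next
    show "\<exists>\<phi>. Cb_L2 M \<phi> \<and> mild_solution_on_line M W U F G \<phi> \<and>
        (\<forall>\<psi>. Cb_L2 M \<psi> \<longrightarrow> mild_solution_on_line M W U F G \<psi> \<longrightarrow> (\<forall>t. AE \<omega> in M. \<psi> t \<omega> = \<phi> t \<omega>)) \<and>
        globally_asymptotically_stable M W U F G \<phi> \<and>
        (\<forall>t0 x0 x. initial_value M W t0 x0 \<longrightarrow> mild_solution M W U F G t0 x0 x \<longrightarrow>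
           (\<forall>t\<ge>t0. (\<integral>\<omega>. (norm (x t \<omega> - \<phi> t \<omega>))\<^sup>2 \<partial>M)
              \<le> 3 * \<N>\<^sup>2 * exp (- (\<nu> - \<kappa>) * (t - t0)) * (\<integral>\<omega>. (norm (x0 \<omega> - \<phi> t0 \<omega>))\<^sup>2 \<partial>M)))"
    proof (intro exI[of _ \<phi>] conjI allI impI \<phi>)
      show "globally_asymptotically_stable M W U F G \<phi>" by (rule entire_solution_stable[OF \<phi>(2)])
    qed (fact entire_solution_unique[OF \<phi>], fact stability_bound[OF \<phi>(2)])
  \<comment> \<open>The goal still open here is part (i).\<close>
  qed (rule mild_solution_diff_le)
qed

end
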